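(* Let $N\ge 1$, $c\in\mathbb{R}$, let $\phi:[0,\infty)\to(0,\infty)$ be an admissible profile, and let $d\mu_w=y^c\phi(|z|)\,dz$ on $\mathbb{H}^{N+1}$. The embedding $H^1_{\mu_w}(\mathbb{H}^{N+1})\hookrightarrow L^2_{\mu_w}(\mathbb{H}^{N+1})$ is compact if and only if the unit ball $\mathcal{B}=\{u\in H^1_{\mu_w}:\|u\|_{H^1_{\mu_w}}\le1\}$ is globally tight.
   Context: For an integer $N\ge1$, $\mathbb{H}^{N+1}=\{z=(y,x)\in\mathbb{R}\times\mathbb{R}^N: y>0\}$, and $dz$ is Lebesgue measure. Let $c\in\mathbb{R}$. A Borel measurable function $\phi:[0,\infty)\to(0,\infty)$ is admissible if for every compact interval $K\subset[0,\infty)$ (possibly containing $0$) there are constants $0<m_K\le M_K<\infty$ with $m_K\le\phi(\rho)\le M_K$ for a.e. $\rho\in K$. The weight is $w(z)=y^c\phi(|z|)$ and $d\mu_w=w(z)\,dz$ on $\mathbb{H}^{N+1}$. $L^2_{\mu_w}$ is the space of $u\in L^1_{\mathrm{loc}}(\mathbb{H}^{N+1})$ with $\|u\|_{L^2_{\mu_w}}^2=\int_{\mathbb{H}^{N+1}}|u|^2\,d\mu_w<\infty$. $H^1_{\mu_w}$ is the space of $u\in L^2_{\mu_w}$ whose weak gradient $\nabla u$ lies in $L^2_{\mu_w}(\mathbb{H}^{N+1};\mathbb{R}^{N+1})$, with $\|u\|_{H^1_{\mu_w}}^2=\|u\|_{L^2_{\mu_w}}^2+\|\nabla u\|_{L^2_{\mu_w}}^2$.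 The embedding $H^1_{\mu_w}\hookrightarrow L^2_{\mu_w}$ is compact if every bounded sequence in $H^1_{\mu_w}$ has a subsequence converging in $L^2_{\mu_w}$. A subset $\mathcal{B}\subset L^2_{\mu_w}$ is globally tight if both of the following hold: (tail tightness) $\lim_{R\to\infty}\sup_{u\in\mathcal{B}}\|u\|_{L^2_{\mu_w}(\{z:|z|>R\})}=0$; (boundary tightness) $\lim_{\delta\to0}\sup_{u\in\mathcal{B}}\|u\|_{L^2_{\mu_w}(\{z:0<y<\delta\})}=0$. *)

theory Defs
  imports "HOL-Analysis.Analysis"
begin

text \<open>
  Points of the half-space are pairs \<open>z = (y, x)\<close> with \<open>y\<close> real and \<open>x\<close> in \<open>real ^ 'n\<close>, so that
  \<open>N = CARD('n) \<ge> 1\<close>; the product norm is the Euclidean one. Elements of Lebesgue and Sobolev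
  spaces are represented by functions, and only their values on the half-space, up to null sets,
  matter to the norms and to weak gradients.
\<close>

type_synonym 'n point = "real \<times> (real ^ 'n)"

definition halfspace :: "'n::finite point set" where
  "halfspace = {z. fst z > 0}"

definition admissible :: "(real \<Rightarrow> real) \<Rightarrow> bool" where
  "admissible \<phi> \<longleftrightarrow>
     (\<forall>\<rho>\<ge>0. \<phi> \<rho> > 0) \<and>
     \<phi> \<in> borel_measurable (restrict_space borel {0..}) \<and>
     (\<forall>a b. 0 \<le> a \<and> a \<le> b \<longrightarrow>
        (\<exists>m M. 0 < m \<and> m \<le> M \<and> (AE \<rho> in lborel. \<rho> \<in> {a..b} \<longrightarrow> m \<le> \<phi> \<rho> \<and> \<phi> \<rho> \<le> M)))"

definition weight :: "real \<Rightarrow> (real \<Rightarrow> real) \<Rightarrow> 'n::finite point \<Rightarrow> real" where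
  "weight c \<phi> z = fst z powr c * \<phi> (norm z)"

definition weighted_measure :: "real \<Rightarrow> (real \<Rightarrow> real) \<Rightarrow> 'n::finite point measure" where
  "weighted_measure c \<phi> = density (lebesgue_on halfspace) (\<lambda>z. ennreal (weight c \<phi> z))"

definition L1_loc :: "('n::finite point \<Rightarrow> 'b::euclidean_space) set" where
  "L1_loc = {f. f \<in> borel_measurable (lebesgue_on halfspace) \<and>
                (\<forall>K. compact K \<and> K \<subseteq> halfspace \<longrightarrow> integrable (lebesgue_on K) f)}"

definition L2 :: "real \<Rightarrow> (real \<Rightarrow> real) \<Rightarrow> ('n::finite point \<Rightarrow> 'b::euclidean_space) set" where
  "L2 c \<phi> = {f \<in> L1_loc. integrable (weighted_measure c \<phi>) (\<lambda>z. (norm (f z))\<^sup>2)}"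

definition L2_norm_on ::
    "real \<Rightarrow> (real \<Rightarrow> real) \<Rightarrow> 'n::finite point set \<Rightarrow> ('n point \<Rightarrow> 'b::euclidean_space) \<Rightarrow> real" where
  "L2_norm_on c \<phi> A f = sqrt (LINT z:A|weighted_measure c \<phi>. (norm (f z))\<^sup>2)"

abbreviation L2_norm ::
    "real \<Rightarrow> (real \<Rightarrow> real) \<Rightarrow> ('n::finite point \<Rightarrow> 'b::euclidean_space) \<Rightarrow> real" where
  "L2_norm c \<phi> \<equiv> L2_norm_on c \<phi> halfspace"

primrec Ck :: "nat \<Rightarrow> ('a::euclidean_space \<Rightarrow> real) \<Rightarrow> bool" where
  "Ck 0 f \<longleftrightarrow> continuous_on UNIV f"
| "Ck (Suc k) f \<longleftrightarrow> (\<forall>z. f differentiable (at z)) \<and>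
     (\<forall>b\<in>Basis. Ck k (\<lambda>z. frechet_derivative f (at z) b))"

definition test_function :: "('n::finite point \<Rightarrow> real) \<Rightarrow> bool" where
  "test_function \<eta> \<longleftrightarrow> (\<forall>k. Ck k \<eta>) \<and>
     compact (closure {z. \<eta> z \<noteq> 0}) \<and> closure {z. \<eta> z \<noteq> 0} \<subseteq> halfspace"

definition has_weak_gradient ::
    "('n::finite point \<Rightarrow> real) \<Rightarrow> ('n point \<Rightarrow> 'n point) \<Rightarrow> bool" where
  "has_weak_gradient u G \<longleftrightarrow> u \<in> L1_loc \<and> G \<in> L1_loc \<and>
     (\<forall>\<eta>. test_function \<eta> \<longrightarrow> (\<forall>b\<in>Basis.
        (LINT z:halfspace|lebesgue. u z * frechet_derivative \<eta> (at z) b) =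
        - (LINT z:halfspace|lebesgue. (G z \<bullet> b) * \<eta> z)))"

text \<open>The weak gradient is unique only almost everywhere; a representative is chosen.\<close>

definition weak_gradient :: "('n::finite point \<Rightarrow> real) \<Rightarrow> ('n point \<Rightarrow> 'n point)" where
  "weak_gradient u = (SOME G. has_weak_gradient u G)"

definition H1 :: "real \<Rightarrow> (real \<Rightarrow> real) \<Rightarrow> ('n::finite point \<Rightarrow> real) set" where
  "H1 c \<phi> = {u \<in> L2 c \<phi>. (\<exists>G. has_weak_gradient u G) \<and> weak_gradient u \<in> L2 c \<phi>}"

definition H1_norm :: "real \<Rightarrow> (real \<Rightarrow> real) \<Rightarrow> ('n::finite point \<Rightarrow> real) \<Rightarrow> real" where
  "H1_norm c \<phi> u = sqrt ((L2_norm c \<phi> u)\<^sup>2 + (L2_norm c \<phi> (weak_gradient u))\<^sup>2)"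

definition H1_unit_ball :: "real \<Rightarrow> (real \<Rightarrow> real) \<Rightarrow> ('n::finite point \<Rightarrow> real) set" where
  "H1_unit_ball c \<phi> = {u \<in> H1 c \<phi>. H1_norm c \<phi> u \<le> 1}"

text \<open>The type argument only fixes the dimension of the half-space.\<close>

definition compact_embedding :: "'n::finite itself \<Rightarrow> real \<Rightarrow> (real \<Rightarrow> real) \<Rightarrow> bool" where
  "compact_embedding (_ :: 'n itself) c \<phi> \<longleftrightarrow>
     (\<forall>u :: nat \<Rightarrow> 'n point \<Rightarrow> real.
        (\<forall>k. u k \<in> H1 c \<phi>) \<and> (\<exists>M. \<forall>k. H1_norm c \<phi> (u k) \<le> M) \<longrightarrow>
        (\<exists>r v. strict_mono (r :: nat \<Rightarrow> nat) \<and> v \<in> L2 c \<phi> \<and>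
           (\<lambda>k. L2_norm c \<phi> (\<lambda>z. u (r k) z - v z)) \<longlonglongrightarrow> 0))"

text \<open>Suprema are taken in the extended nonnegative reals, so that they are meaningful also for
  families that are unbounded or empty.\<close>

definition globally_tight ::
    "real \<Rightarrow> (real \<Rightarrow> real) \<Rightarrow> ('n::finite point \<Rightarrow> real) set \<Rightarrow> bool" where
  "globally_tight c \<phi> B \<longleftrightarrow> B \<subseteq> L2 c \<phi> \<and>
     ((\<lambda>R. SUP u\<in>B. ennreal (L2_norm_on c \<phi> {z \<in> halfspace. norm z > R} u)) \<longlongrightarrow> 0) at_top \<and>
     ((\<lambda>\<delta>. SUP u\<in>B. ennreal (L2_norm_on c \<phi> {z. 0 < fst z \<and> fst z < \<delta>} u)) \<longlongrightarrow> 0) (at_right 0)"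

end

theory Submission
  imports Defs "HOL-Complex_Analysis.Great_Picard"
begin

text \<open>
  If the embedding is compact but tightness fails, there are unit-ball functions \<open>u\<^sub>k\<close> with norm
  bounded below on sets \<open>A\<^sub>k\<close> decreasing to the empty set; the \<open>L\<^sup>2\<close> limit of a subsequence would
  then have norm bounded below on \<open>A\<^sub>k\<close>, which dominated convergence forbids.

  For the converse, tightness makes the mass outside a compact subset of the half-space uniformly
  small, so it suffices to extract a subsequence that is Cauchy in \<open>L\<^sup>2\<close> of each compact subset;
  there the weight is bounded above and below almost everywhere and can be dropped. Testing the weak
  gradient \<open>G\<close> of \<open>u\<close> with translated bump functions gives
  \<open>u (z + h) - u z = \<integral>\<^sub>0\<^sup>1 G (z + t h) \<bullet> h dt\<close> for almost every \<open>z\<close>, hence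
  \<open>\<parallel>u (\<cdot> + h) - u\<parallel> \<le> |h| \<parallel>G\<parallel>\<close>, and therefore \<open>u\<close> is, up to an error of order \<open>r\<close>, determined by
  its averages over finitely many balls of radius \<open>r\<close>. By a diagonal argument the averages over all
  balls from a countable family converge along a subsequence.
\<close>

section \<open>Smooth bump functions\<close>

text \<open>Two obstacles shape the local argument. Members of the spaces are only Lebesgue
  measurable on the half-space and known up to null sets, whereas Fubini and translation of
  arguments call for Borel functions on the whole space. Each function is therefore replaced, on a
  compact set, by an integrable Borel truncation. Cutting off creates jumps, so the truncated pair
  obeys the weak formulation only against test functions supported inside that compact set, and
  every estimate keeps a margin around the set on which it holds. Sobolev functions are never
  approximated by smooth ones: the fundamental theorem of calculus is applied to the test function
  alone and carried over to \<open>u\<close> by Fubini and duality. Boxes are the natural supports,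
  because products of one-variable functions live on them and because they generate the Borel sets
  and are stable under intersection. The weight may degenerate at y = 0 and at infinity, so only
  balls inside some slab y >= 1/(n+1), |z| <= n are averaged over. The family of these balls does
  not depend on n, hence one subsequence serves all slabs.\<close>

text \<open>The factor \<open>p (1 / t)\<close> makes this family closed under differentiation.\<close>

definition flat :: "real poly \<Rightarrow> real \<Rightarrow> real" where
  "flat p t = (if t > 0 then poly p (1 / t) * exp (- (1 / t)) else 0)"

lemma tendsto_poly_mult_exp_neg: "((\<lambda>x::real. poly p x * exp (- x)) \<longlongrightarrow> 0) at_top"
proof -
  have "((\<lambda>x::real. \<Sum>i\<le>degree p. coeff p i * (x ^ i / exp x)) \<longlongrightarrow> (\<Sum>i\<le>degree p. coeff p i * 0)) at_top"
    by (intro tendsto_intros tendsto_power_div_exp_0)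
  moreover have "(\<Sum>i\<le>degree p. coeff p i * (x ^ i / exp x)) = poly p x * exp (- x)" for x :: real
    by (simp add: poly_altdef sum_distrib_right exp_minus divide_inverse mult.assoc)
  ultimately show ?thesis by simp
qed

text \<open>For t > 0 the product and chain rules turn p into the polynomial X^2 (p - p'), evaluated
  at 1/t. Only t = 0 needs an argument, and there exp(-1/t) beats every power of 1/t.\<close>

lemma flat_has_real_derivative:
  "(flat p has_real_derivative flat (monom 1 2 * (p - pderiv p)) t) (at t)"
proof -
  consider "t > 0" | "t < 0" | "t = 0" by linarith
  then show ?thesis
  proof cases
    case 1
    have "((\<lambda>t. poly p (1 / t) * exp (- (1 / t))) has_real_derivative
          poly (pderiv p) (1/t) * (- 1 / t^2) * exp (- (1/t)) + poly p (1/t) * (exp (- (1/t)) * (1 / t^2))) (at t)"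
      using 1 by (auto intro!: derivative_eq_intros DERIV_chain'[OF _ poly_DERIV] simp: power2_eq_square)
    moreover have "poly (pderiv p) (1/t) * (- 1 / t^2) * exp (- (1/t)) + poly p (1/t) * (exp (- (1/t)) * (1 / t^2))
       = flat (monom 1 2 * (p - pderiv p)) t"
      using 1 by (simp add: flat_def poly_monom power_divide field_simps)
    ultimately have "((\<lambda>t. poly p (1 / t) * exp (- (1 / t))) has_real_derivative flat (monom 1 2 * (p - pderiv p)) t) (at t)"
      by simp
    then show ?thesis
      by (rule has_field_derivative_transform_within_open[of _ _ _ "{0<..}"]) (use 1 in \<open>auto simp: flat_def\<close>)
  next
    case 2
    have "((\<lambda>t. 0) has_real_derivative flat (monom 1 2 * (p - pderiv p)) t) (at t)"
      using 2 by (simp add: flat_def)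
    then show ?thesis
      by (rule has_field_derivative_transform_within_open[of _ _ _ "{..<0}"]) (use 2 in \<open>auto simp: flat_def\<close>)
  next
    case 3
    \<comment> \<open>The polynomial \<open>pCons 0 p\<close> is X p: dividing by h costs one more
      power of 1/h, which the exponential absorbs as well.\<close>
    have "((\<lambda>h. poly (pCons 0 p) (inverse h) * exp (- inverse h)) \<longlongrightarrow> 0) (at_right (0::real))"
      by (rule filterlim_compose[OF tendsto_poly_mult_exp_neg filterlim_inverse_at_top_right])
    then have "((\<lambda>h. flat p h / h) \<longlongrightarrow> 0) (at_right 0)"
    proof (rule Lim_transform_eventually)
      show "\<forall>\<^sub>F h in at_right 0. poly (pCons 0 p) (inverse h) * exp (- inverse h) = flat p h / h"
        unfolding eventually_at_right_field
        by (rule exI[of _ 1]) (auto simp: flat_def field_simps)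
    qed
    moreover have "((\<lambda>h. flat p h / h) \<longlongrightarrow> 0) (at_left 0)"
    proof (rule Lim_transform_eventually[OF tendsto_const])
      show "\<forall>\<^sub>F h in at_left 0. 0 = flat p h / h"
        unfolding eventually_at_left_field
        by (rule exI[of _ "-1"]) (auto simp: flat_def)
    qed
    ultimately have "((\<lambda>h. flat p h / h) \<longlongrightarrow> 0) (at 0)"
      by (simp add: filterlim_split_at)
    then show ?thesis
      using 3 by (simp add: DERIV_def flat_def)
  qed
qed

section \<open>Calculus in the classes \<open>Ck\<close>\<close>

lemma Ck_Suc_imp: "Ck (Suc k) f \<Longrightarrow> Ck k f"
proof (induction k arbitrary: f)
  case 0
  then show ?case
    by (auto intro!: differentiable_imp_continuous_on simp: differentiable_on_def differentiable_at_withinI)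
next
  case (Suc k)
  then show ?case
    unfolding Ck.simps(2)[of "Suc k" f] Ck.simps(2)[of k f] by (blast intro: Suc.IH)
qed

text \<open>Since \<open>Ck\<close> is phrased with the choice-based
  \<open>frechet_derivative\<close>, this rule is the way to feed in a derivative known by
  formula.\<close>

lemma Ck_SucI:
  assumes "\<And>z. (f has_derivative D z) (at z)" and "\<And>b. b \<in> Basis \<Longrightarrow> Ck k (\<lambda>z. D z b)"
  shows "Ck (Suc k) f"
proof -
  have "frechet_derivative f (at z) = D z" "f differentiable at z" for z
    using assms(1)[of z] by (auto simp: frechet_derivative_at[symmetric] intro: differentiableI)
  then show ?thesis using assms(2) by simp
qed

lemma Ck_const: "Ck k (\<lambda>z. c)"
proof (induction k arbitrary: c)
  case (Suc k)
  then show ?case by (intro Ck_SucI[where D = "\<lambda>z h. 0"]) auto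
qed simp

lemma Ck_add: "Ck k f \<Longrightarrow> Ck k g \<Longrightarrow> Ck k (\<lambda>z. f z + g z)"
proof (induction k arbitrary: f g)
  case (Suc k)
  show ?case
    by (rule Ck_SucI, rule has_derivative_add[OF frechet_derivative_works[THEN iffD1] frechet_derivative_works[THEN iffD1]])
      (use Suc in auto)
qed (simp add: continuous_on_add)

text \<open>The product rule leaves one factor undifferentiated in each summand, so the induction
  also needs that factor at the lower order; this is the purpose of
  \<open>Ck_Suc_imp\<close>.\<close>

lemma Ck_mult: "Ck k f \<Longrightarrow> Ck k g \<Longrightarrow> Ck k (\<lambda>z. f z * g z)"
proof (induction k arbitrary: f g)
  case (Suc k)
  show ?case
    by (rule Ck_SucI, rule has_derivative_mult[OF frechet_derivative_works[THEN iffD1] frechet_derivative_works[THEN iffD1]])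
      (use Suc Ck_Suc_imp[of k f] Ck_Suc_imp[of k g] in \<open>auto intro!: Ck_add\<close>)
qed (simp add: continuous_on_mult)

lemma Ck_prod: "(\<And>i. i \<in> I \<Longrightarrow> Ck k (f i)) \<Longrightarrow> Ck k (\<lambda>z. \<Prod>i\<in>I. f i z)"
  by (induction I rule: infinite_finite_induct) (auto intro: Ck_mult Ck_const)

text \<open>Smoothness of all orders at once: a partial derivative is a constant times a function of
  the same shape with another polynomial, so the induction must leave \<open>p\<close>
  arbitrary.\<close>

lemma Ck_flat_inner: "Ck k (\<lambda>z. flat p (a * (z \<bullet> v) + d))"
proof (induction k arbitrary: p)
  case 0
  have "continuous_on UNIV (flat p)"
    using flat_has_real_derivative DERIV_continuous_on by blast
  then have "continuous_on UNIV (\<lambda>z. flat p (a * (z \<bullet> v) + d))"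
    by (rule continuous_on_compose2) (auto intro!: continuous_intros)
  then show ?case by simp
next
  case (Suc k)
  have "((\<lambda>z. flat p (a * (z \<bullet> v) + d)) has_derivative
      (\<lambda>h. (a * (h \<bullet> v)) * flat (monom 1 2 * (p - pderiv p)) (a * (z \<bullet> v) + d))) (at z)" for z
  proof -
    have 1: "((\<lambda>z. a * (z \<bullet> v) + d) has_derivative (\<lambda>h. a * (h \<bullet> v))) (at z)"
      by (auto intro!: derivative_eq_intros)
    show ?thesis
      using has_derivative_compose[OF 1 flat_has_real_derivative[of p "a * (z \<bullet> v) + d", unfolded has_field_derivative_def]]
      by (simp add: mult.commute)
  qed
  then show ?case
    by (rule Ck_SucI) (intro Ck_mult Ck_const Suc.IH)
qed

text \<open>Each factor equals exp(-1/((m+1)t)), with t > 0 the distance of a coordinate to a face,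
  and tends to 1 as \<open>m\<close> grows; so the bumps are a smooth approximation of the indicator
  of \<open>box l u\<close>. Being a formula in \<open>l\<close> and \<open>u\<close>, a translated
  bump is the bump of the translated box.\<close>

definition bump :: "'a::euclidean_space \<Rightarrow> 'a \<Rightarrow> nat \<Rightarrow> 'a \<Rightarrow> real" where
  "bump l u m z = (\<Prod>b\<in>Basis. flat 1 (real (Suc m) * (z \<bullet> b - l \<bullet> b)) * flat 1 (real (Suc m) * (u \<bullet> b - z \<bullet> b)))"

lemma Ck_bump: "Ck k (bump l u m)"
proof -
  have "Ck k (\<lambda>z. \<Prod>b\<in>Basis. flat 1 (real (Suc m) * (z \<bullet> b) + (- real (Suc m) * (l \<bullet> b))) * flat 1 ((- real (Suc m)) * (z \<bullet> b) + real (Suc m) * (u \<bullet> b)))"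
    by (intro Ck_prod Ck_mult Ck_flat_inner)
  then show ?thesis
    unfolding bump_def[abs_def] by (simp add: algebra_simps)
qed

lemma flat_1: "flat 1 t = (if t > 0 then exp (- (1 / t)) else 0)"
  by (simp add: flat_def)

lemma flat_1_bounds: "0 \<le> flat 1 t" "flat 1 t \<le> 1"
  by (simp_all add: flat_1)

lemma bump_bounds: "0 \<le> bump l u m z" "bump l u m z \<le> 1"
  unfolding bump_def by (intro prod_nonneg mult_nonneg_nonneg ballI flat_1_bounds)
    (intro prod_le_1 conjI mult_nonneg_nonneg mult_le_one flat_1_bounds)

lemma bump_eq_0:
  assumes "z \<notin> box l u"
  shows "bump l u m z = 0"
proof -
  obtain b where b: "b \<in> Basis" "z \<bullet> b \<le> l \<bullet> b \<or> u \<bullet> b \<le> z \<bullet> b"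
    using assms by (auto simp: mem_box not_less)
  then have "real (Suc m) * (z \<bullet> b - l \<bullet> b) \<le> 0 \<or> real (Suc m) * (u \<bullet> b - z \<bullet> b) \<le> 0"
    by (metis diff_le_0_iff_le mult_nonneg_nonpos of_nat_0_le_iff)
  then have "flat 1 (real (Suc m) * (z \<bullet> b - l \<bullet> b)) * flat 1 (real (Suc m) * (u \<bullet> b - z \<bullet> b)) = 0"
    by (metis flat_1 mult_eq_0_iff not_less)
  then show ?thesis
    unfolding bump_def using b(1) by (meson finite_Basis prod_zero)
qed

lemma bump_tendsto: "(\<lambda>m. bump l u m z) \<longlonglongrightarrow> indicator (box l u) z"
proof (cases "z \<in> box l u")
  case True
  have *: "(\<lambda>m. flat 1 (real (Suc m) * t)) \<longlonglongrightarrow> 1" if "t > 0" for t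
  proof -
    have "(\<lambda>m. exp (- (inverse (real (Suc m)) * (1 / t)))) \<longlonglongrightarrow> exp (- (0 * (1 / t)))"
      by (intro tendsto_intros LIMSEQ_inverse_real_of_nat)
    then show ?thesis using that by (simp add: flat_1 zero_less_mult_iff divide_simps)
  qed
  have "(\<lambda>m. bump l u m z) \<longlonglongrightarrow> (\<Prod>b\<in>(Basis::'a set). 1 * 1)"
    unfolding bump_def using True by (intro tendsto_intros *) (auto simp: mem_box)
  then show ?thesis using True by simp
qed (simp add: bump_eq_0)

lemma bump_shift: "bump (l + a) (u + a) m z = bump l u m (z - a)"
  by (simp add: bump_def inner_simps algebra_simps)

lemma bump_support: "closure {z. bump l u m z \<noteq> 0} \<subseteq> cbox l u"
proof (rule closure_minimal)
  show "{z. bump l u m z \<noteq> 0} \<subseteq> cbox l u"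
    using bump_eq_0 box_subset_cbox by blast
qed (rule closed_cbox)

lemma test_function_bump: "cbox l u \<subseteq> halfspace \<Longrightarrow> test_function (bump l u m)"
  unfolding test_function_def
  using Ck_bump bump_support[of l u m] compact_Int_closed[OF compact_cbox closed_closure, of l u "{z. bump l u m z \<noteq> 0}"]
  by (auto simp: Int_absorb1)

section \<open>Directional derivatives of bumps\<close>

definition dbump :: "'a::euclidean_space \<Rightarrow> 'a \<Rightarrow> nat \<Rightarrow> 'a \<Rightarrow> 'a \<Rightarrow> real" where
  "dbump l u m h z = frechet_derivative (bump l u m) (at z) h"

lemma bump_has_derivative: "(bump l u m has_derivative (\<lambda>h. dbump l u m h z)) (at z)"
  using Ck_bump[of "Suc 0" l u m] by (simp add: frechet_derivative_works dbump_def)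

text \<open>\<open>Ck\<close> and the weak formulation speak of basis directions only; linearity of
  the derivative extends both to an arbitrary translation vector \<open>h\<close>.\<close>

lemma dbump_sum: "dbump l u m h z = (\<Sum>b\<in>Basis. (h \<bullet> b) * dbump l u m b z)"
proof -
  interpret bounded_linear "(\<lambda>h. dbump l u m h z)"
    using bump_has_derivative has_derivative_bounded_linear by blast
  have "dbump l u m (\<Sum>b\<in>Basis. (h \<bullet> b) *\<^sub>R b) z = (\<Sum>b\<in>Basis. (h \<bullet> b) * dbump l u m b z)"
    by (simp add: sum scaleR)
  then show ?thesis by (simp add: euclidean_representation)
qed

lemma continuous_bump: "continuous_on UNIV (bump l u m)"
  using Ck_bump[of 0] by simp

lemma continuous_dbump: "continuous_on UNIV (dbump l u m h)"
proof -
  have "continuous_on UNIV (\<lambda>z. \<Sum>b\<in>Basis. (h \<bullet> b) * dbump l u m b z)"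
    using Ck_bump[of "Suc 0" l u m] by (intro continuous_intros) (auto simp: dbump_def)
  then show ?thesis by (simp add: dbump_sum[of l u m h, abs_def])
qed

lemma dbump_eq_0: "z \<notin> cbox l u \<Longrightarrow> dbump l u m h z = 0"
proof -
  assume z: "z \<notin> cbox l u"
  have "((\<lambda>_. 0) has_derivative (\<lambda>_. 0)) (at z)" by simp
  then have "(bump l u m has_derivative (\<lambda>_. 0)) (at z)"
    by (rule has_derivative_transform_within_open[of _ _ _ _ "- cbox l u"])
      (use z bump_eq_0[of _ l u m] box_subset_cbox[of l u] in \<open>auto simp: open_Compl\<close>)
  then show ?thesis using bump_has_derivative[of l u m z] has_derivative_unique by metis
qed

lemma dbump_bounded: "\<exists>C. \<forall>z. \<bar>dbump l u m h z\<bar> \<le> C"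
proof -
  have "bounded (dbump l u m h ` cbox l u)"
    by (intro compact_imp_bounded compact_continuous_image continuous_on_subset[OF continuous_dbump]) auto
  then obtain C where "\<forall>z\<in>cbox l u. \<bar>dbump l u m h z\<bar> \<le> C"
    by (auto simp: bounded_iff)
  then have "\<bar>dbump l u m h z\<bar> \<le> max C 0" for z
    by (cases "z \<in> cbox l u") (auto simp: dbump_eq_0 le_max_iff_disj)
  then show ?thesis by blast
qed

lemma bump_measurable [measurable]: "bump l u m \<in> borel_measurable borel"
  using continuous_bump by (rule borel_measurable_continuous_onI)

lemma dbump_measurable [measurable]: "dbump l u m h \<in> borel_measurable borel"
  using continuous_dbump by (rule borel_measurable_continuous_onI)

section \<open>The fundamental lemma of the calculus of variations\<close>

text \<open>The positive and negative parts of \<open>g\<close> are densities of two finite measures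
  that agree on all boxes. Boxes form an intersection-stable generator, so the measures coincide,
  and hence so do their densities almost everywhere.\<close>

lemma AE_eq_0_if_integral_box_eq_0:
  fixes g :: "'a::euclidean_space \<Rightarrow> real"
  assumes int: "integrable lborel g"
    and box: "\<And>l u. (LINT z|lborel. g z * indicator (box l u) z) = 0"
  shows "AE z in lborel. g z = 0"
proof -
  note [measurable] = borel_measurable_integrable[OF int]
  let ?p = "\<lambda>z. max 0 (g z)" and ?n = "\<lambda>z. max 0 (- g z)"
  have ip: "integrable lborel ?p" "integrable lborel ?n"
    using int by auto
  have em: "emeasure (density lborel (\<lambda>z. ennreal (f z))) X = ennreal (LINT z|lborel. f z * indicator X z)"
    if "integrable lborel f" "\<And>z. 0 \<le> f z" "X \<in> sets lborel" for f :: "'a \<Rightarrow> real" and X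
  proof -
    have "emeasure (density lborel (\<lambda>z. ennreal (f z))) X = (\<integral>\<^sup>+z. ennreal (f z) * indicator X z \<partial>lborel)"
      using that by (intro emeasure_density) auto
    also have "\<dots> = (\<integral>\<^sup>+z. ennreal (f z * indicator X z) \<partial>lborel)"
      by (intro nn_integral_cong) (auto simp: indicator_def)
    also have "\<dots> = ennreal (LINT z|lborel. f z * indicator X z)"
      using that by (intro nn_integral_eq_integral integrable_real_mult_indicator) auto
    finally show ?thesis .
  qed
  have eq: "density lborel (\<lambda>z. ennreal (?p z)) = density lborel (\<lambda>z. ennreal (?n z))" (is "?M = ?N")
  proof (rule measure_eqI_generator_eq)
    let ?E = "range (\<lambda>(a, b). box a b::'a set)"
    show "Int_stable ?E"
      by (auto simp: Int_stable_def box_Int_box)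
    show "?E \<subseteq> Pow UNIV" "sets ?M = sigma_sets UNIV ?E" "sets ?N = sigma_sets UNIV ?E"
      by (simp_all add: borel_eq_box)
    let ?A = "\<lambda>n::nat. box (- (real n *\<^sub>R One)) (real n *\<^sub>R One) :: 'a set"
    show "range ?A \<subseteq> ?E" "(\<Union>i. ?A i) = UNIV"
      unfolding UN_box_eq_UNIV by auto
    show "emeasure ?M (?A i) \<noteq> \<infinity>" for i
      by (subst em) (use ip in auto)
    fix X assume "X \<in> ?E"
    then obtain l u where X: "X = box l u" by auto
    have "(LINT z|lborel. ?p z * indicator X z) - (LINT z|lborel. ?n z * indicator X z)
        = (LINT z|lborel. ?p z * indicator X z - ?n z * indicator X z)"
      using ip by (intro Bochner_Integration.integral_diff[symmetric] integrable_real_mult_indicator) (auto simp: X)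
    also have "\<dots> = (LINT z|lborel. g z * indicator X z)"
      by (intro Bochner_Integration.integral_cong) (auto simp: indicator_def)
    also have "\<dots> = 0" by (simp add: X box)
    finally have "(LINT z|lborel. ?p z * indicator X z) = (LINT z|lborel. ?n z * indicator X z)" by simp
    then show "emeasure ?M X = emeasure ?N X"
      using ip by (subst (1 2) em) (auto simp: X)
  qed
  have "AE z in lborel. ennreal (?p z) = ennreal (?n z)"
    by (rule sigma_finite_measure.density_unique[OF sigma_finite_lborel _ _ eq]) auto
  then show ?thesis
    by eventually_elim (auto simp: max_def split: if_splits)
qed

text \<open>Bumps tend boundedly to indicators of boxes, so the integrals of \<open>f\<close> over
  boxes inside \<open>\<Omega>\<close> vanish. The global box criterion is then applied to
  \<open>f\<close> cut off to one box at a time, and countably many boxes cover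
  \<open>\<Omega>\<close>.\<close>

lemma AE_eq_0_if_integral_bump_eq_0:
  fixes f :: "'a::euclidean_space \<Rightarrow> real"
  assumes int: "integrable lborel f" and "open \<Omega>"
    and bump0: "\<And>l u m. cbox l u \<subseteq> \<Omega> \<Longrightarrow> (LINT z|lborel. f z * bump l u m z) = 0"
  shows "AE z in lborel. z \<in> \<Omega> \<longrightarrow> f z = 0"
proof -
  note [measurable] = borel_measurable_integrable[OF int]
  have box0: "(LINT z|lborel. f z * indicator (box l u) z) = 0" if "cbox l u \<subseteq> \<Omega>" for l u
  proof -
    have "(\<lambda>m. LINT z|lborel. f z * bump l u m z) \<longlonglongrightarrow> (LINT z|lborel. f z * indicator (box l u) z)"
    proof (rule integral_dominated_convergence)
      show "integrable lborel (\<lambda>z. \<bar>f z\<bar>)" using int by auto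
      show "AE z in lborel. (\<lambda>m. f z * bump l u m z) \<longlonglongrightarrow> f z * indicator (box l u) z"
        by (intro AE_I2 tendsto_intros bump_tendsto)
      show "AE z in lborel. norm (f z * bump l u m z) \<le> \<bar>f z\<bar>" for m
        by (auto simp: abs_mult bump_bounds intro!: mult_left_le)
    qed auto
    then show ?thesis
      using bump0[OF that] by (simp add: LIMSEQ_const_iff)
  qed
  have loc: "AE z in lborel. z \<in> cbox a b \<longrightarrow> f z = 0" if ab: "cbox a b \<subseteq> \<Omega>" for a b
  proof -
    have "AE z in lborel. f z * indicator (box a b) z = 0"
    proof (rule AE_eq_0_if_integral_box_eq_0)
      show "integrable lborel (\<lambda>z. f z * indicator (box a b) z)"
        using int by (intro integrable_real_mult_indicator) auto
      fix l u
      \<comment> \<open>The corners of the intersection of the two boxes. Testing the cut-off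
        function on an arbitrary box thus amounts to testing \<open>f\<close> on a box whose closed
        version stays in \<open>cbox a b\<close>, where \<open>box0\<close> applies.\<close>
      define l' u' where "l' = (\<Sum>i\<in>Basis. max (a \<bullet> i) (l \<bullet> i) *\<^sub>R i)"
        and "u' = (\<Sum>i\<in>Basis. min (b \<bullet> i) (u \<bullet> i) *\<^sub>R i)"
      have *: "box a b \<inter> box l u = box l' u'" "cbox l' u' \<subseteq> cbox a b"
        unfolding l'_def u'_def box_Int_box by (auto simp: mem_box)
      have "(LINT z|lborel. f z * indicator (box a b) z * indicator (box l u) z)
        = (LINT z|lborel. f z * indicator (box l' u') z)"
        by (intro Bochner_Integration.integral_cong) (auto simp: *(1)[symmetric] indicator_inter_arith)
      also have "\<dots> = 0" using *(2) ab by (intro box0) auto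
      finally show "(LINT z|lborel. f z * indicator (box a b) z * indicator (box l u) z) = 0" .
    qed
    moreover have "AE z in lborel. z \<notin> cbox a b - box a b"
      by (rule AE_not_in) (simp add: null_sets_def emeasure_Diff box_subset_cbox emeasure_lborel_cbox_eq emeasure_lborel_box_eq)
    ultimately show ?thesis by eventually_elim (auto simp: indicator_def)
  qed
  obtain D where D: "countable D" "\<And>X. X \<in> D \<Longrightarrow> X \<subseteq> \<Omega>" "\<And>X. X \<in> D \<Longrightarrow> \<exists>a b. X = cbox a b" "\<Union>D = \<Omega>"
    by (rule open_countable_Union_open_cbox[OF \<open>open \<Omega>\<close>]) blast
  have "AE z in lborel. \<forall>X\<in>D. z \<in> X \<longrightarrow> f z = 0"
    unfolding AE_ball_countable[OF D(1)]
  proof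
    fix X assume "X \<in> D"
    with D(2,3) obtain a b where "X = cbox a b" "cbox a b \<subseteq> \<Omega>" by metis
    then show "AE z in lborel. z \<in> X \<longrightarrow> f z = 0" using loc by simp
  qed
  then show ?thesis
    by eventually_elim (use D(4) in blast)
qed

section \<open>Square integrability on sets of finite measure\<close>

lemma abs_le_one_plus_square: "\<bar>x\<bar> \<le> 1 + (x::real)\<^sup>2"
  using zero_le_power2[of "\<bar>x\<bar> - 1"] by (simp add: power2_eq_square algebra_simps)

text \<open>The right-hand side takes extended values, so square integrability need not be checked
  before use: either it is infinite, or |x| <= 1 + x^2 makes \<open>f\<close> integrable over
  \<open>A\<close> and the classical proof runs.\<close>

lemma Cauchy_Schwarz_indicator:
  fixes f :: "'a \<Rightarrow> real"
  assumes [measurable]: "f \<in> borel_measurable M" "A \<in> sets M" and fin: "emeasure M A < \<infinity>"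
  shows "ennreal ((LINT z|M. indicator A z * f z)\<^sup>2) \<le> ennreal (measure M A) * (\<integral>\<^sup>+z\<in>A. ennreal ((f z)\<^sup>2) \<partial>M)"
proof (cases "measure M A = 0")
  case True
  then have "A \<in> null_sets M"
    using fin by (auto simp: measure_def enn2real_eq_0_iff)
  then have "AE z in M. z \<notin> A" by (rule AE_not_in)
  then have "(LINT z|M. indicator A z * f z) = (LINT z|M. 0)"
    by (intro integral_cong_AE) auto
  then show ?thesis by simp
next
  case False
  then have m: "measure M A > 0" by (simp add: zero_less_measure_iff)
  have iA: "integrable M (\<lambda>z. indicator A z :: real)" using fin by simp
  show ?thesis
  proof (cases "(\<integral>\<^sup>+z\<in>A. ennreal ((f z)\<^sup>2) \<partial>M) = \<infinity>")
    case True
    then show ?thesis using m by (simp add: ennreal_mult_top)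
  next
    case False
    have eq: "(\<integral>\<^sup>+z\<in>A. ennreal ((f z)\<^sup>2) \<partial>M) = (\<integral>\<^sup>+z. ennreal (indicator A z * (f z)\<^sup>2) \<partial>M)"
      by (intro nn_integral_cong) (auto simp: indicator_def)
    have i2: "integrable M (\<lambda>z. indicator A z * (f z)\<^sup>2)"
      using False eq by (intro integrableI_nonneg) (auto simp: less_top[symmetric])
    have i1: "integrable M (\<lambda>z. indicator A z * f z)"
    proof (rule Bochner_Integration.integrable_bound[OF Bochner_Integration.integrable_add[OF iA i2]])
      show "AE z in M. norm (indicat_real A z * f z) \<le> norm (indicat_real A z + indicat_real A z * (f z)\<^sup>2)"
        using abs_le_one_plus_square by (auto simp: indicator_def)
    qed auto
    define I J \<mu> where "I = (LINT z|M. indicator A z * f z)" and "J = (LINT z|M. indicator A z * (f z)\<^sup>2)" and "\<mu> = measure M A"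
    \<comment> \<open>\<open>\<mu> * f z - I\<close> is \<open>\<mu>\<close> times the deviation of
      \<open>f\<close> from its mean over \<open>A\<close>; expanding its square gives the
      inequality multiplied by \<open>\<mu>\<close>.\<close>
    have "0 \<le> (LINT z|M. indicator A z * (\<mu> * f z - I)\<^sup>2)" by (intro integral_nonneg_AE) auto
    also have "\<dots> = (LINT z|M. \<mu>\<^sup>2 * (indicator A z * (f z)\<^sup>2) - 2 * \<mu> * I * (indicator A z * f z) + I\<^sup>2 * indicator A z)"
      by (intro Bochner_Integration.integral_cong) (auto simp: power2_eq_square algebra_simps)
    also have "\<dots> = \<mu>\<^sup>2 * J - 2 * \<mu> * I * I + I\<^sup>2 * \<mu>"
      using i1 i2 iA fin unfolding I_def J_def \<mu>_def by simp
    finally have "0 \<le> \<mu> * (\<mu> * J - I\<^sup>2)" by (simp add: power2_eq_square algebra_simps)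
    then have "I\<^sup>2 \<le> \<mu> * J" using m by (simp add: \<mu>_def zero_le_mult_iff)
    moreover have "(\<integral>\<^sup>+z. ennreal (indicator A z * (f z)\<^sup>2) \<partial>M) = ennreal J"
      unfolding J_def using i2 by (intro nn_integral_eq_integral) auto
    ultimately show ?thesis
      using m by (simp add: eq I_def \<mu>_def ennreal_mult'[symmetric] ennreal_leI)
  qed
qed

section \<open>Translation estimate for weakly differentiable functions\<close>

lemma integrable_lborel_shift:
  fixes f :: "'a::euclidean_space \<Rightarrow> 'b::{banach, second_countable_topology}"
  assumes "integrable lborel f"
  shows "integrable lborel (\<lambda>z. f (z + a))"
proof -
  note [measurable] = borel_measurable_integrable[OF assms]
  have "integrable (distr lborel borel ((+) a)) f" using assms by (simp add: lborel_distr_plus)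
  then show ?thesis
    by (subst (asm) integrable_distr_eq) (auto simp: add.commute)
qed

lemma integral_lborel_shift:
  fixes f :: "'a::euclidean_space \<Rightarrow> 'b::{banach, second_countable_topology}"
  assumes [measurable]: "f \<in> borel_measurable borel"
  shows "(LINT z|lborel. f (z + a)) = (LINT z|lborel. f z)"
proof -
  have "(LINT z|lborel. f z) = (LINT z|distr lborel borel ((+) a). f z)" by (simp add: lborel_distr_plus)
  then show ?thesis
    by (subst (asm) integral_distr) (auto simp: add.commute)
qed

lemma nn_integral_lborel_shift:
  fixes f :: "'a::euclidean_space \<Rightarrow> ennreal"
  assumes [measurable]: "f \<in> borel_measurable borel"
  shows "(\<integral>\<^sup>+z. f (z + a) \<partial>lborel) = (\<integral>\<^sup>+z. f z \<partial>lborel)"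
proof -
  have "(\<integral>\<^sup>+z. f z \<partial>lborel) = (\<integral>\<^sup>+z. f z \<partial>distr lborel borel ((+) a))" by (simp add: lborel_distr_plus)
  then show ?thesis
    by (subst (asm) nn_integral_distr) (auto simp: add.commute)
qed

text \<open>Licenses the interchanges of integrals over z and t below. For fixed t translation
  invariance removes the shift from \<open>f\<close>, so the double integral is at most
  \<open>C\<close> times the L1 norm of \<open>f\<close>.\<close>

lemma integrable_pair_mult_bounded_shift:
  fixes f :: "'a::euclidean_space \<Rightarrow> real" and g :: "'a \<Rightarrow> real \<Rightarrow> real"
  assumes f: "integrable lborel f" and [measurable]: "case_prod g \<in> borel_measurable (borel \<Otimes>\<^sub>M borel)"
    and g: "\<And>z t. t \<in> {0..1} \<Longrightarrow> \<bar>g z t\<bar> \<le> C"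
  shows "integrable (lborel \<Otimes>\<^sub>M lborel) (\<lambda>(z, t). indicator {0..1} t * (f (z + t *\<^sub>R h) * g z t))"
proof -
  note [measurable] = borel_measurable_integrable[OF f]
  have C: "0 \<le> C" using g[of 0 undefined] by (auto intro: order_trans[OF abs_ge_zero])
  have "(\<integral>\<^sup>+z. \<integral>\<^sup>+t. ennreal (norm (indicator {0..1} t * (f (z + t *\<^sub>R h) * g z t))) \<partial>lborel \<partial>lborel)
     = (\<integral>\<^sup>+t. \<integral>\<^sup>+z. ennreal (norm (indicator {0..1} t * (f (z + t *\<^sub>R h) * g z t))) \<partial>lborel \<partial>lborel)"
    by (rule lborel_pair.Fubini'[symmetric]) measurable
  also have "\<dots> \<le> (\<integral>\<^sup>+t. indicator {0..1::real} t * (\<integral>\<^sup>+z. ennreal (C * norm (f (z + t *\<^sub>R h))) \<partial>lborel) \<partial>lborel)"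
  proof (rule nn_integral_mono)
    fix t :: real
    show "(\<integral>\<^sup>+z. ennreal (norm (indicator {0..1} t * (f (z + t *\<^sub>R h) * g z t))) \<partial>lborel)
       \<le> indicator {0..1} t * (\<integral>\<^sup>+z. ennreal (C * norm (f (z + t *\<^sub>R h))) \<partial>lborel)"
    proof (cases "t \<in> {0..1}")
      case True
      then show ?thesis
        using g by (auto intro!: nn_integral_mono ennreal_leI mult_right_mono simp: abs_mult mult.commute[of "\<bar>f _\<bar>"])
    qed simp
  qed
  also have "\<dots> = (\<integral>\<^sup>+t. indicator {0..1::real} t * (\<integral>\<^sup>+z. ennreal (C * norm (f z)) \<partial>lborel) \<partial>lborel)"
    by (subst nn_integral_lborel_shift[where f = "\<lambda>z. ennreal (C * norm (f z))"]) auto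
  also have "\<dots> = (\<integral>\<^sup>+z. ennreal (norm (C * f z)) \<partial>lborel)"
    using C by (subst nn_integral_multc) (auto simp: abs_mult)
  also have "\<dots> < \<infinity>"
    using integrable_mult_right[OF f, of C] unfolding integrable_iff_bounded by blast
  finally have fin: "(\<integral>\<^sup>+z. \<integral>\<^sup>+t. ennreal (norm (indicator {0..1} t * (f (z + t *\<^sub>R h) * g z t))) \<partial>lborel \<partial>lborel) < \<infinity>" .
  show ?thesis
  proof (rule integrableI_bounded)
    show "(\<integral>\<^sup>+ x. ennreal (norm (case x of (z, t) \<Rightarrow> indicat_real {0..1} t * (f (z + t *\<^sub>R h) * g z t))) \<partial>(lborel \<Otimes>\<^sub>M lborel)) < \<infinity>"
      using fin by (subst lborel.nn_integral_fst[symmetric]) (auto simp: case_prod_beta')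
  qed measurable
qed

text \<open>The only use of the fundamental theorem of calculus: it is applied along a segment to a
  smooth bump, where it is elementary, and never to a Sobolev function.\<close>

lemma FTC_bump: "(LINT t|lborel. indicator {0..1} t * dbump l u m h (w - t *\<^sub>R h)) = bump l u m w - bump l u m (w - h)"
proof -
  have "(LINT t|lborel. indicator {0..1} t *\<^sub>R dbump l u m h (w - t *\<^sub>R h)) = - bump l u m (w - 1 *\<^sub>R h) - (- bump l u m (w - 0 *\<^sub>R h))"
  proof (rule integral_FTC_Icc)
    fix t :: real
    have "((\<lambda>t. bump l u m (w - t *\<^sub>R h)) has_derivative (\<lambda>s. dbump l u m (- (s *\<^sub>R h)) (w - t *\<^sub>R h))) (at t within {0..1})"
      by (rule has_derivative_compose[OF _ bump_has_derivative]) (auto intro!: derivative_eq_intros)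
    moreover have "dbump l u m (- (s *\<^sub>R h)) z = s * - dbump l u m h z" for s z
      using linear_scale[OF has_derivative_linear[OF bump_has_derivative[of l u m z]], of "- s" h] by simp
    ultimately have "((\<lambda>t. bump l u m (w - t *\<^sub>R h)) has_vector_derivative - dbump l u m h (w - t *\<^sub>R h)) (at t within {0..1})"
      by (simp add: has_vector_derivative_def)
    then show "((\<lambda>t. - bump l u m (w - t *\<^sub>R h)) has_vector_derivative dbump l u m h (w - t *\<^sub>R h)) (at t within {0..1})"
      by (auto dest: has_vector_derivative_minus)
  next
    show "continuous_on {0..1} (\<lambda>t. dbump l u m h (w - t *\<^sub>R h))"
      by (rule continuous_on_compose2[OF continuous_dbump]) (auto intro!: continuous_intros)
  qed simp
  then show ?thesis by simp
qed

lemma dbump_shift: "dbump (l + a) (u + a) m h z = dbump l u m h (z - a)"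
proof -
  have "((\<lambda>z. bump l u m (z - a)) has_derivative (\<lambda>h. dbump l u m h (z - a))) (at z)"
    by (rule has_derivative_compose[OF _ bump_has_derivative]) (auto intro!: derivative_eq_intros)
  then have "(bump (l + a) (u + a) m has_derivative (\<lambda>h. dbump l u m h (z - a))) (at z)"
    by (simp add: bump_shift[abs_def])
  then show ?thesis
    using bump_has_derivative has_derivative_unique by metis
qed

text \<open>
  The weak formulation is only required for bump functions; since translates of bump functions are
  bump functions, this is all that the translation estimate needs.
\<close>

locale weak_gradient_pair =
  fixes u :: "'a::euclidean_space \<Rightarrow> real" and G :: "'a \<Rightarrow> 'a" and L :: "'a set"
  assumes u: "integrable lborel u" and G: "integrable lborel G"
    and weak: "\<And>l r m b. cbox l r \<subseteq> L \<Longrightarrow> b \<in> Basis \<Longrightarrow>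
      (LINT z|lborel. u z * dbump l r m b z) = - (LINT z|lborel. (G z \<bullet> b) * bump l r m z)"
begin

lemma u_measurable [measurable]: "u \<in> borel_measurable borel"
  using borel_measurable_integrable[OF u] by simp

lemma G_measurable [measurable]: "G \<in> borel_measurable borel"
  using borel_measurable_integrable[OF G] by simp

lemma integrable_u_dbump: "integrable lborel (\<lambda>z. u z * dbump l r m h z)"
proof -
  obtain C where C: "\<And>z. \<bar>dbump l r m h z\<bar> \<le> C" using dbump_bounded by blast
  show ?thesis
  proof (rule Bochner_Integration.integrable_bound[OF integrable_mult_right[OF integrable_norm[OF u], of C]])
    show "AE z in lborel. norm (u z * dbump l r m h z) \<le> norm (C * norm (u z))"
      using order_trans[OF C abs_ge_self] by (auto simp: abs_mult mult.commute[of "\<bar>u _\<bar>"] intro!: mult_right_mono)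
  qed measurable
qed

lemma integrable_G_bump: "integrable lborel (\<lambda>z. (G z \<bullet> h) * bump l r m z)"
proof -
  have "integrable lborel (\<lambda>z. G z \<bullet> h)" using G by simp
  then show ?thesis
    by (rule Bochner_Integration.integrable_bound) (auto simp: abs_mult bump_bounds intro!: mult_left_le)
qed

lemma weak_direction:
  assumes "cbox l r \<subseteq> L"
  shows "(LINT z|lborel. u z * dbump l r m h z) = - (LINT z|lborel. (G z \<bullet> h) * bump l r m z)"
proof -
  have "(LINT z|lborel. u z * dbump l r m h z) = (LINT z|lborel. (\<Sum>b\<in>Basis. (h \<bullet> b) * (u z * dbump l r m b z)))"
    by (subst dbump_sum) (simp add: sum_distrib_left mult.left_commute)
  also have "\<dots> = (\<Sum>b\<in>Basis. (h \<bullet> b) * (LINT z|lborel. u z * dbump l r m b z))"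
    by (subst Bochner_Integration.integral_sum) (auto intro: integrable_u_dbump)
  also have "\<dots> = - (\<Sum>b\<in>Basis. (h \<bullet> b) * (LINT z|lborel. (G z \<bullet> b) * bump l r m z))"
    by (simp add: weak[OF assms] sum_negf)
  also have "(\<Sum>b\<in>Basis. (h \<bullet> b) * (LINT z|lborel. (G z \<bullet> b) * bump l r m z))
      = (LINT z|lborel. (\<Sum>b\<in>Basis. (h \<bullet> b) * ((G z \<bullet> b) * bump l r m z)))"
    by (subst Bochner_Integration.integral_sum) (auto intro: integrable_G_bump)
  also have "\<dots> = (LINT z|lborel. (G z \<bullet> h) * bump l r m z)"
    by (intro Bochner_Integration.integral_cong refl)
      (subst euclidean_inner[of _ h], simp add: sum_distrib_right sum_distrib_left mult_ac)
  finally show ?thesis .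
qed

text \<open>Both sides are compared as distributions on \<open>\<Omega>\<close>. Against a bump, the
  integral over t of the translated gradient becomes an integral of \<open>u\<close> against
  derivatives of translated bumps; by \<open>FTC_bump\<close> these sum up to a difference of two
  bumps, which is the translation difference of \<open>u\<close> after moving the shift back. The
  assumption \<open>seg\<close> keeps the supports of all these translates in
  \<open>L\<close>.\<close>

lemma translation_AE:
  assumes "open \<Omega>" and seg: "\<And>z t. z \<in> \<Omega> \<Longrightarrow> t \<in> {0..1} \<Longrightarrow> z + t *\<^sub>R h \<in> L"
  shows "AE z in lborel. z \<in> \<Omega> \<longrightarrow>
    u (z + h) - u z = (LINT t|lborel. indicator {0..1} t * (G (z + t *\<^sub>R h) \<bullet> h))"
proof -
  define V where "V z = (LINT t|lborel. indicator {0..1} t * (G (z + t *\<^sub>R h) \<bullet> h))" for z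
  have Gh: "integrable lborel (\<lambda>z. G z \<bullet> h)" using G by simp
  have V: "integrable lborel V"
    using lborel_pair.integrable_fst[OF integrable_pair_mult_bounded_shift[OF Gh, of "\<lambda>_ _. 1" 1 h]]
    by (simp add: V_def[abs_def])
  have uh: "integrable lborel (\<lambda>z. u (z + h))" by (rule integrable_lborel_shift[OF u])
  have "AE z in lborel. z \<in> \<Omega> \<longrightarrow> u (z + h) - u z - V z = 0"
  proof (rule AE_eq_0_if_integral_bump_eq_0[OF _ \<open>open \<Omega>\<close>])
    show "integrable lborel (\<lambda>z. u (z + h) - u z - V z)" using u uh V by simp
    fix l r m assume sub: "cbox l r \<subseteq> \<Omega>"
    let ?\<eta> = "bump l r m"
    have ib: "integrable lborel (\<lambda>z. f z * ?\<eta> z)" if "integrable lborel f" for f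
      using that by (rule Bochner_Integration.integrable_bound)
        (use borel_measurable_integrable[OF that] in \<open>auto simp: abs_mult bump_bounds intro!: mult_left_le\<close>)
    have shift: "(LINT z|lborel. (G (z + t *\<^sub>R h) \<bullet> h) * ?\<eta> z) = - (LINT w|lborel. u w * dbump l r m h (w - t *\<^sub>R h))"
      if t: "t \<in> {0..1}" for t
    proof -
      \<comment> \<open>The shift moves from \<open>G\<close> to the bump, because the weak
        formulation is a statement about unshifted \<open>u\<close> and \<open>G\<close>.\<close>
      have "(LINT z|lborel. (G (z + t *\<^sub>R h) \<bullet> h) * ?\<eta> z)
        = (LINT z|lborel. (\<lambda>w. (G w \<bullet> h) * bump (l + t *\<^sub>R h) (r + t *\<^sub>R h) m w) (z + t *\<^sub>R h))"
        by (simp add: bump_shift)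
      also have "\<dots> = (LINT w|lborel. (G w \<bullet> h) * bump (l + t *\<^sub>R h) (r + t *\<^sub>R h) m w)"
        by (rule integral_lborel_shift) measurable
      also have "\<dots> = - (LINT w|lborel. u w * dbump (l + t *\<^sub>R h) (r + t *\<^sub>R h) m h w)"
      proof (subst weak_direction)
        show "cbox (l + t *\<^sub>R h) (r + t *\<^sub>R h) \<subseteq> L"
        proof
          fix w assume "w \<in> cbox (l + t *\<^sub>R h) (r + t *\<^sub>R h)"
          then have "w - t *\<^sub>R h \<in> cbox l r" by (auto simp: mem_box inner_simps algebra_simps)
          then show "w \<in> L" using seg[of "w - t *\<^sub>R h" t] sub t by auto
        qed
      qed simp
      finally show ?thesis by (simp add: dbump_shift)
    qed
    have "(LINT z|lborel. V z * ?\<eta> z)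
       = (LINT z|lborel. LINT t|lborel. indicator {0..1} t * ((G (z + t *\<^sub>R h) \<bullet> h) * ?\<eta> z))"
      unfolding V_def by (subst integral_mult_left_zero[symmetric]) (simp add: mult_ac)
    also have "\<dots> = (LINT t|lborel. LINT z|lborel. indicator {0..1} t * ((G (z + t *\<^sub>R h) \<bullet> h) * ?\<eta> z))"
      by (rule lborel_pair.Fubini_integral[symmetric], rule integrable_pair_mult_bounded_shift[OF Gh, where C = 1])
        (measurable, simp add: bump_bounds)
    also have "\<dots> = (LINT t|lborel. indicator {0..1} t * - (LINT w|lborel. u w * dbump l r m h (w - t *\<^sub>R h)))"
      by (intro Bochner_Integration.integral_cong refl) (auto simp: indicator_def shift)
    also have "\<dots> = - (LINT t|lborel. LINT w|lborel. indicator {0..1} t * (u w * dbump l r m h (w - t *\<^sub>R h)))"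
      by simp
    also have "(LINT t|lborel. LINT w|lborel. indicator {0..1} t * (u w * dbump l r m h (w - t *\<^sub>R h)))
       = (LINT w|lborel. LINT t|lborel. indicator {0..1} t * (u w * dbump l r m h (w - t *\<^sub>R h)))"
    proof -
      obtain C where "\<And>z. \<bar>dbump l r m h z\<bar> \<le> C" using dbump_bounded by blast
      then show ?thesis
        \<comment> \<open>Shift vector \<open>0\<close>: the dependence on t now sits entirely in
          the bounded factor \<open>dbump\<close>.\<close>
        using integrable_pair_mult_bounded_shift[OF u, of "\<lambda>w t. dbump l r m h (w - t *\<^sub>R h)" C 0]
        by (intro lborel_pair.Fubini_integral) simp
    qed
    also have "\<dots> = (LINT w|lborel. u w * (LINT t|lborel. indicator {0..1} t * dbump l r m h (w - t *\<^sub>R h)))"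
      by (subst integral_mult_right_zero[symmetric]) (simp add: mult_ac)
    also have "\<dots> = (LINT w|lborel. u w * ?\<eta> w - u w * ?\<eta> (w - h))"
      by (simp add: FTC_bump right_diff_distrib)
    finally have VV: "(LINT z|lborel. V z * ?\<eta> z) = - (LINT w|lborel. u w * ?\<eta> w - u w * ?\<eta> (w - h))" .
    have "(LINT z|lborel. u (z + h) * ?\<eta> z) = (LINT z|lborel. (\<lambda>w. u w * ?\<eta> (w - h)) (z + h))" by simp
    also have "\<dots> = (LINT w|lborel. u w * ?\<eta> (w - h))" by (rule integral_lborel_shift) measurable
    finally have uu: "(LINT z|lborel. u (z + h) * ?\<eta> z) = (LINT w|lborel. u w * ?\<eta> (w - h))" .
    have i1: "integrable lborel (\<lambda>w. u w * ?\<eta> (w - h))"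
      using integrable_lborel_shift[OF ib[OF uh], of "- h"] by simp
    have "(LINT z|lborel. (u (z + h) - u z - V z) * ?\<eta> z)
       = (LINT z|lborel. u (z + h) * ?\<eta> z) - (LINT z|lborel. u z * ?\<eta> z) - (LINT z|lborel. V z * ?\<eta> z)"
      using ib[OF u] ib[OF uh] ib[OF V] by (simp add: left_diff_distrib)
    also have "\<dots> = 0" unfolding VV uu using ib[OF u] i1 by simp
    finally show "(LINT z|lborel. (u (z + h) - u z - V z) * ?\<eta> z) = 0" .
  qed
  then show ?thesis by (simp add: V_def)
qed

text \<open>Cauchy-Schwarz on the unit interval moves the square inside the integral over t; after
  Tonelli, translation invariance makes the inner integral independent of t.\<close>

lemma translation_L2:
  assumes "open \<Omega>" and seg: "\<And>z t. z \<in> \<Omega> \<Longrightarrow> t \<in> {0..1} \<Longrightarrow> z + t *\<^sub>R h \<in> L"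
  shows "(\<integral>\<^sup>+z\<in>\<Omega>. ennreal ((u (z + h) - u z)\<^sup>2) \<partial>lborel) \<le> ennreal ((norm h)\<^sup>2) * (\<integral>\<^sup>+z. ennreal ((norm (G z))\<^sup>2) \<partial>lborel)"
proof -
  have "(\<integral>\<^sup>+z\<in>\<Omega>. ennreal ((u (z + h) - u z)\<^sup>2) \<partial>lborel)
     \<le> (\<integral>\<^sup>+z. (\<integral>\<^sup>+t\<in>{0..1}. ennreal ((G (z + t *\<^sub>R h) \<bullet> h)\<^sup>2) \<partial>lborel) \<partial>lborel)"
  proof (rule nn_integral_mono_AE)
    show "AE z in lborel. ennreal ((u (z + h) - u z)\<^sup>2) * indicator \<Omega> z \<le> (\<integral>\<^sup>+t\<in>{0..1}. ennreal ((G (z + t *\<^sub>R h) \<bullet> h)\<^sup>2) \<partial>lborel)"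
      using translation_AE[OF \<open>open \<Omega>\<close> seg, simplified]
    proof eventually_elim
      case (elim z)
      have "ennreal ((LINT t|lborel. indicator {0..1} t * (G (z + t *\<^sub>R h) \<bullet> h))\<^sup>2)
         \<le> ennreal (measure lborel {0..1::real}) * (\<integral>\<^sup>+t\<in>{0..1}. ennreal ((G (z + t *\<^sub>R h) \<bullet> h)\<^sup>2) \<partial>lborel)"
        by (rule Cauchy_Schwarz_indicator) auto
      then show ?case using elim by (auto simp: indicator_def)
    qed
  qed
  also have "\<dots> = (\<integral>\<^sup>+t. \<integral>\<^sup>+z. ennreal ((G (z + t *\<^sub>R h) \<bullet> h)\<^sup>2) * indicator {0..1::real} t \<partial>lborel \<partial>lborel)"
    by (rule lborel_pair.Fubini'[symmetric]) measurable
  also have "\<dots> \<le> (\<integral>\<^sup>+t. ennreal ((norm h)\<^sup>2) * (\<integral>\<^sup>+z. ennreal ((norm (G z))\<^sup>2) \<partial>lborel) * indicator {0..1::real} t \<partial>lborel)"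
  proof (rule nn_integral_mono)
    fix t :: real
    have "(\<integral>\<^sup>+z. ennreal ((G (z + t *\<^sub>R h) \<bullet> h)\<^sup>2) \<partial>lborel) = (\<integral>\<^sup>+z. ennreal ((G z \<bullet> h)\<^sup>2) \<partial>lborel)"
      by (rule nn_integral_lborel_shift) measurable
    also have "\<dots> \<le> (\<integral>\<^sup>+z. ennreal ((norm h)\<^sup>2) * ennreal ((norm (G z))\<^sup>2) \<partial>lborel)"
    proof (rule nn_integral_mono)
      fix z
      have "(G z \<bullet> h)\<^sup>2 \<le> (norm h)\<^sup>2 * (norm (G z))\<^sup>2"
        using Cauchy_Schwarz_ineq[of "G z" h] by (simp add: power2_norm_eq_inner mult.commute)
      then show "ennreal ((G z \<bullet> h)\<^sup>2) \<le> ennreal ((norm h)\<^sup>2) * ennreal ((norm (G z))\<^sup>2)"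
        by (simp add: ennreal_mult[symmetric] ennreal_leI)
    qed
    also have "\<dots> = ennreal ((norm h)\<^sup>2) * (\<integral>\<^sup>+z. ennreal ((norm (G z))\<^sup>2) \<partial>lborel)"
      by (rule nn_integral_cmult) measurable
    finally show "(\<integral>\<^sup>+z. ennreal ((G (z + t *\<^sub>R h) \<bullet> h)\<^sup>2) * indicator {0..1::real} t \<partial>lborel)
       \<le> ennreal ((norm h)\<^sup>2) * (\<integral>\<^sup>+z. ennreal ((norm (G z))\<^sup>2) \<partial>lborel) * indicator {0..1::real} t"
      by (auto simp: indicator_def)
  qed
  also have "\<dots> = ennreal ((norm h)\<^sup>2) * (\<integral>\<^sup>+z. ennreal ((norm (G z))\<^sup>2) \<partial>lborel)"
    by (subst nn_integral_cmult) auto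
  finally show ?thesis .
qed

end

section \<open>Local compactness\<close>

lemma pred_ball [measurable]: "Measurable.pred borel (\<lambda>z. z \<in> ball (c::'a::euclidean_space) r)"
  unfolding mem_ball by measurable

lemma integrable_indicator_ball: "integrable lborel (indicator (ball (c::'a::euclidean_space) r) :: 'a \<Rightarrow> real)"
  using emeasure_bounded_finite[OF bounded_ball, of c r] by (simp add: less_top)

context weak_gradient_pair
begin

text \<open>Translation differences are integrated over all small shifts. This gives a single
  function of \<open>z\<close> which dominates the deviation of \<open>u z\<close> from its mean
  over any ball of half the radius containing \<open>z\<close>.\<close>

definition osc :: "real \<Rightarrow> 'a \<Rightarrow> ennreal" where
  "osc r z = (\<integral>\<^sup>+k\<in>ball 0 r. ennreal ((u (z + k) - u z)\<^sup>2) \<partial>lborel)"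

lemma osc_measurable [measurable]: "osc r \<in> borel_measurable borel"
  unfolding osc_def[abs_def] by measurable

lemma nn_integral_osc:
  assumes "open \<Omega>" and sub: "\<And>z. z \<in> \<Omega> \<Longrightarrow> ball z r \<subseteq> L" and "r > 0"
  shows "(\<integral>\<^sup>+z\<in>\<Omega>. osc r z \<partial>lborel) \<le> emeasure lborel (ball (0::'a) r) * ennreal (r\<^sup>2) * (\<integral>\<^sup>+z. ennreal ((norm (G z))\<^sup>2) \<partial>lborel)"
proof -
  have [measurable]: "\<Omega> \<in> sets borel" using \<open>open \<Omega>\<close> by simp
  have "(\<integral>\<^sup>+z\<in>\<Omega>. osc r z \<partial>lborel)
     = (\<integral>\<^sup>+z. (\<integral>\<^sup>+k. ennreal ((u (z + k) - u z)\<^sup>2) * indicator \<Omega> z * indicator (ball 0 r) k \<partial>lborel) \<partial>lborel)"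
    unfolding osc_def by (subst nn_integral_multc[symmetric]) (auto intro!: nn_integral_cong simp: mult_ac)
  also have "\<dots> = (\<integral>\<^sup>+k. (\<integral>\<^sup>+z. ennreal ((u (z + k) - u z)\<^sup>2) * indicator \<Omega> z * indicator (ball 0 r) k \<partial>lborel) \<partial>lborel)"
    by (rule lborel_pair.Fubini'[symmetric]) measurable
  also have "\<dots> \<le> (\<integral>\<^sup>+k. ennreal (r\<^sup>2) * (\<integral>\<^sup>+z. ennreal ((norm (G z))\<^sup>2) \<partial>lborel) * indicator (ball (0::'a) r) k \<partial>lborel)"
  proof (rule nn_integral_mono)
    fix k :: 'a
    show "(\<integral>\<^sup>+z. ennreal ((u (z + k) - u z)\<^sup>2) * indicator \<Omega> z * indicator (ball 0 r) k \<partial>lborel)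
        \<le> ennreal (r\<^sup>2) * (\<integral>\<^sup>+z. ennreal ((norm (G z))\<^sup>2) \<partial>lborel) * indicator (ball 0 r) k"
    proof (cases "k \<in> ball 0 r")
      case True
      have "z + t *\<^sub>R k \<in> L" if "z \<in> \<Omega>" "t \<in> {0..1}" for z t
      proof -
        have "norm (t *\<^sub>R k) \<le> norm k" using that by (auto intro!: mult_left_le_one_le)
        then show ?thesis using True sub[OF that(1)] by (auto simp: dist_norm subset_iff)
      qed
      then have "(\<integral>\<^sup>+z\<in>\<Omega>. ennreal ((u (z + k) - u z)\<^sup>2) \<partial>lborel) \<le> ennreal ((norm k)\<^sup>2) * (\<integral>\<^sup>+z. ennreal ((norm (G z))\<^sup>2) \<partial>lborel)"
        by (rule translation_L2[OF \<open>open \<Omega>\<close>])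
      also have "\<dots> \<le> ennreal (r\<^sup>2) * (\<integral>\<^sup>+z. ennreal ((norm (G z))\<^sup>2) \<partial>lborel)"
        using True by (intro mult_right_mono ennreal_leI power_mono) auto
      finally show ?thesis using True by simp
    qed simp
  qed
  also have "\<dots> = emeasure lborel (ball (0::'a) r) * ennreal (r\<^sup>2) * (\<integral>\<^sup>+z. ennreal ((norm (G z))\<^sup>2) \<partial>lborel)"
    by (subst nn_integral_cmult) (auto simp: mult_ac)
  finally show ?thesis .
qed

text \<open>A ball of radius \<open>r\<close> containing \<open>z\<close> lies in the ball of radius
  \<open>2 * r\<close> about \<open>z\<close>. The centre \<open>d\<close> differs from
  \<open>z\<close> on purpose: finitely many averages then have to serve all points of a compact
  set.\<close>

lemma average_deviation:
  assumes z: "z \<in> ball d r"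
  defines "\<beta> \<equiv> measure lborel (ball (0::'a) r)"
  shows "ennreal ((u z - (LINT w|lborel. indicator (ball d r) w * u w) / \<beta>)\<^sup>2) \<le> ennreal (1 / \<beta>) * osc (2 * r) z"
proof -
  have r: "r > 0" using z by (auto intro: le_less_trans[OF zero_le_dist])
  have \<beta>: "measure lborel (ball d r) = \<beta>" "\<beta> > 0"
    using r by (auto simp: \<beta>_def content_ball)
  have iu: "integrable lborel (\<lambda>w. indicator (ball d r) w * u w)"
    using integrable_real_mult_indicator[OF _ u, of "ball d r"] by (simp add: mult.commute)
  have ii: "integrable lborel (\<lambda>w. indicator (ball d r) w * u z)"
    by (simp add: integrable_indicator_ball)
  have "(LINT w|lborel. indicator (ball d r) w * (u z - u w)) = \<beta> * u z - (LINT w|lborel. indicator (ball d r) w * u w)"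
    using iu ii \<beta> by (simp add: right_diff_distrib)
  then have "u z - (LINT w|lborel. indicator (ball d r) w * u w) / \<beta> = (LINT w|lborel. indicator (ball d r) w * (u z - u w)) / \<beta>"
    using \<beta> by (simp add: field_simps)
  then have "ennreal ((u z - (LINT w|lborel. indicator (ball d r) w * u w) / \<beta>)\<^sup>2)
      = ennreal (1 / \<beta>\<^sup>2) * ennreal ((LINT w|lborel. indicator (ball d r) w * (u z - u w))\<^sup>2)"
    by (simp add: power_divide ennreal_mult'[symmetric])
  \<comment> \<open>Cauchy-Schwarz contributes one factor \<open>\<beta>\<close>, so the
    normalisation \<open>1 / \<beta>\<^sup>2\<close> of the squared mean drops to
    \<open>1 / \<beta>\<close>.\<close>
  also have "\<dots> \<le> ennreal (1 / \<beta>\<^sup>2) * (ennreal \<beta> * (\<integral>\<^sup>+w\<in>ball d r. ennreal ((u z - u w)\<^sup>2) \<partial>lborel))"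
    by (rule mult_left_mono[OF Cauchy_Schwarz_indicator[of _ lborel "ball d r", unfolded \<beta>]])
      (use emeasure_lborel_ball_finite[of d r] in auto)
  also have "\<dots> = ennreal (1 / \<beta>) * (\<integral>\<^sup>+w\<in>ball d r. ennreal ((u z - u w)\<^sup>2) \<partial>lborel)"
    using \<beta> by (simp add: mult.assoc[symmetric] ennreal_mult'[symmetric] power2_eq_square)
  also have "(\<integral>\<^sup>+w\<in>ball d r. ennreal ((u z - u w)\<^sup>2) \<partial>lborel) \<le> (\<integral>\<^sup>+w\<in>ball z (2 * r). ennreal ((u w - u z)\<^sup>2) \<partial>lborel)"
  proof (rule nn_integral_mono)
    fix w
    have "w \<in> ball d r \<Longrightarrow> w \<in> ball z (2 * r)"
      using z dist_triangle[of z w d] by (auto simp: dist_commute)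
    then show "ennreal ((u z - u w)\<^sup>2) * indicator (ball d r) w \<le> ennreal ((u w - u z)\<^sup>2) * indicator (ball z (2 * r)) w"
      by (auto simp: indicator_def power2_commute)
  qed
  also have "\<dots> = (\<integral>\<^sup>+k. (\<lambda>w. ennreal ((u w - u z)\<^sup>2) * indicator (ball z (2 * r)) w) (k + z) \<partial>lborel)"
    by (rule nn_integral_lborel_shift[symmetric]) measurable
  also have "\<dots> = osc (2 * r) z"
    unfolding osc_def by (intro nn_integral_cong) (auto simp: indicator_def dist_norm add.commute)
  finally show ?thesis by (simp add: mult_left_mono)
qed

end

section \<open>Cauchy sequences from convergent averages\<close>

lemma three_square_le: "(a + b + c)\<^sup>2 \<le> 3 * (a\<^sup>2 + b\<^sup>2 + (c::real)\<^sup>2)"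
  using zero_le_power2[of "a - b"] zero_le_power2[of "b - c"] zero_le_power2[of "a - c"]
  by (simp add: power2_eq_square algebra_simps)

lemma ennreal_three_mult: "x \<ge> 0 \<Longrightarrow> 3 * ennreal x = ennreal (3 * x)"
  by (subst ennreal_mult') simp_all

text \<open>On a small ball the difference \<open>U i - U j\<close> splits into the deviations of
  the two functions from their averages and the difference of the averages. The deviations are small
  uniformly in the index by the gradient bound; only finitely many averages occur, and each of them
  converges.\<close>

lemma local_Cauchy_L2:
  fixes U :: "nat \<Rightarrow> 'a::euclidean_space \<Rightarrow> real" and G :: "nat \<Rightarrow> 'a \<Rightarrow> 'a" and D :: "'a set"
  assumes wg: "\<And>n. weak_gradient_pair (U n) (G n) L"
    and GC: "\<And>n. (\<integral>\<^sup>+z. ennreal ((norm (G n z))\<^sup>2) \<partial>lborel) \<le> ennreal C"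
    and "compact K" "K \<subseteq> \<Omega>" "open \<Omega>" "\<rho> > 0" and \<rho>: "\<And>z. z \<in> \<Omega> \<Longrightarrow> ball z \<rho> \<subseteq> L"
    and dense: "closure D = UNIV"
    and conv: "\<And>d m. d \<in> D \<Longrightarrow> ball d (inverse (real (Suc m))) \<subseteq> L \<Longrightarrow>
       convergent (\<lambda>n. LINT w|lborel. indicator (ball d (inverse (real (Suc m)))) w * U n w)"
    and "e > 0"
  shows "\<exists>N. \<forall>i\<ge>N. \<forall>j\<ge>N. (\<integral>\<^sup>+z\<in>K. ennreal ((U i z - U j z)\<^sup>2) \<partial>lborel) \<le> ennreal e"
proof -
  interpret W: weak_gradient_pair "U n" "G n" L for n by (rule wg)
  define C' where "C' = max C 0"
  have C': "C' \<ge> 0" and GC': "\<And>n. (\<integral>\<^sup>+z. ennreal ((norm (G n z))\<^sup>2) \<partial>lborel) \<le> ennreal C'"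
    using order_trans[OF GC ennreal_leI[of C C']] by (auto simp: C'_def)
  \<comment> \<open>\<open>osc\<close> is taken at radius \<open>2 * r\<close>: the volume ratio of
    the balls gives \<open>2 ^ DIM('a)\<close>, and the square of the radius gives the factor
    4.\<close>
  define A where "A = 2 ^ DIM('a) * (4 * C')"
  have A: "A \<ge> 0" using C' by (simp add: A_def)
  \<comment> \<open>The factor 6 is the 3 from \<open>three_square_le\<close> times the two
    deviation terms; together they may use half of \<open>e\<close>.\<close>
  have "(\<lambda>m. 6 * A * (inverse (real (Suc m)))\<^sup>2) \<longlonglongrightarrow> 6 * A * 0\<^sup>2"
    by (intro tendsto_intros LIMSEQ_inverse_real_of_nat)
  then have "\<forall>\<^sub>F m in sequentially. 6 * A * (inverse (real (Suc m)))\<^sup>2 < e / 2"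
    using \<open>e > 0\<close> by (intro order_tendstoD) auto
  moreover have "\<forall>\<^sub>F m in sequentially. inverse (real (Suc m)) < \<rho> / 2"
    using \<open>\<rho> > 0\<close> by (intro order_tendstoD[OF LIMSEQ_inverse_real_of_nat]) auto
  ultimately obtain m where m: "6 * A * (inverse (real (Suc m)))\<^sup>2 < e / 2" "inverse (real (Suc m)) < \<rho> / 2"
    by (metis (mono_tags, lifting) eventually_conj eventually_happens trivial_limit_sequentially)
  define r where "r = inverse (real (Suc m))"
  have r: "r > 0" "6 * A * r\<^sup>2 < e / 2" "2 * r < \<rho>" using m by (auto simp: r_def)
  define \<beta> where "\<beta> = measure lborel (ball (0::'a) r)"
  have \<beta>: "\<beta> > 0" using r by (simp add: \<beta>_def content_ball)
  have vol: "emeasure lborel (ball (0::'a) (2 * r)) = ennreal (2 ^ DIM('a) * \<beta>)"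
    using r by (simp add: \<beta>_def content_ball emeasure_ball power_mult_distrib mult_ac)
  define a where "a d n = (LINT w|lborel. indicator (ball d r) w * U n w) / \<beta>" for d n
  obtain F where F: "F \<subseteq> {d \<in> D. ball d r \<inter> K \<noteq> {}}" "finite F" "K \<subseteq> (\<Union>d\<in>F. ball d r)"
  proof (rule compactE_image[OF \<open>compact K\<close>, of "{d \<in> D. ball d r \<inter> K \<noteq> {}}" "\<lambda>d. ball d r"])
    show "K \<subseteq> (\<Union>d\<in>{d \<in> D. ball d r \<inter> K \<noteq> {}}. ball d r)"
    proof
      fix z assume "z \<in> K"
      obtain d where "d \<in> D" "dist d z < r"
        using dense r(1) closure_approachable[of z D] by auto
      then show "z \<in> (\<Union>d\<in>{d \<in> D. ball d r \<inter> K \<noteq> {}}. ball d r)" using \<open>z \<in> K\<close>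
        by (intro UN_I[of d]) auto
    qed
  qed auto
  define V where "V = measure lborel K"
  have V: "V \<ge> 0" "emeasure lborel K = ennreal V"
    using emeasure_compact_finite[OF \<open>compact K\<close>] by (auto simp: V_def emeasure_eq_ennreal_measure)
  \<comment> \<open>Chosen so that \<open>3 * s * V\<close> is at most the other half of
    \<open>e\<close>; adding 1 keeps the denominator positive when \<open>K\<close> is null.\<close>
  define s where "s = e / (6 * (V + 1))"
  have s: "s > 0" using \<open>e > 0\<close> V by (simp add: s_def)
  have "\<exists>N. \<forall>i\<ge>N. \<forall>j\<ge>N. (a d i - a d j)\<^sup>2 \<le> s" if "d \<in> F" for d
  proof -
    have "d \<in> D" "ball d r \<inter> K \<noteq> {}" using that F(1) by blast+
    then obtain z where z: "d \<in> D" "z \<in> K" "z \<in> ball d r" by blast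
    have "ball d r \<subseteq> ball z \<rho>"
    proof
      fix w assume "w \<in> ball d r"
      then show "w \<in> ball z \<rho>" using z(3) r(3) dist_triangle[of z w d] by (auto simp: dist_commute)
    qed
    then have "ball d r \<subseteq> L" using \<rho>[of z] z \<open>K \<subseteq> \<Omega>\<close> by auto
    then obtain l where "(\<lambda>n. LINT w|lborel. indicator (ball d r) w * U n w) \<longlonglongrightarrow> l"
      using conv[of d m] z(1) unfolding r_def convergent_def by blast
    then have "(\<lambda>n. a d n) \<longlonglongrightarrow> l / \<beta>"
      unfolding a_def using \<beta> by (intro tendsto_divide tendsto_const) auto
    then have "convergent (\<lambda>n. a d n)" by (rule convergentI)
    then have "Cauchy (\<lambda>n. a d n)" by (rule convergent_Cauchy)
    then obtain N where N: "\<And>i j. i \<ge> N \<Longrightarrow> j \<ge> N \<Longrightarrow> \<bar>a d i - a d j\<bar> < sqrt s"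
      using s unfolding Cauchy_def dist_real_def by (meson real_sqrt_gt_zero)
    have "(a d i - a d j)\<^sup>2 \<le> s" if "i \<ge> N" "j \<ge> N" for i j
      using N[OF that] s by (metis abs_ge_zero less_eq_real_def power2_abs power_mono real_sqrt_pow2)
    then show ?thesis by blast
  qed
  then obtain N where N: "\<And>d i j. d \<in> F \<Longrightarrow> i \<ge> N d \<Longrightarrow> j \<ge> N d \<Longrightarrow> (a d i - a d j)\<^sup>2 \<le> s"
    by metis
  have osc_bound: "(\<integral>\<^sup>+z\<in>K. ennreal (1 / \<beta>) * W.osc n (2 * r) z \<partial>lborel) \<le> ennreal (A * r\<^sup>2)" for n
  proof -
    have "(\<integral>\<^sup>+z\<in>K. ennreal (1 / \<beta>) * W.osc n (2 * r) z \<partial>lborel) \<le> (\<integral>\<^sup>+z. ennreal (1 / \<beta>) * (W.osc n (2 * r) z * indicator \<Omega> z) \<partial>lborel)"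
      using \<open>K \<subseteq> \<Omega>\<close> by (intro nn_integral_mono) (auto simp: indicator_def)
    also have "\<dots> = ennreal (1 / \<beta>) * (\<integral>\<^sup>+z\<in>\<Omega>. W.osc n (2 * r) z \<partial>lborel)"
      using \<open>open \<Omega>\<close> by (intro nn_integral_cmult) measurable
    also have "\<dots> \<le> ennreal (1 / \<beta>) * (ennreal (2 ^ DIM('a) * \<beta>) * ennreal ((2 * r)\<^sup>2) * ennreal C')"
    proof (rule mult_left_mono)
      have "ball z (2 * r) \<subseteq> L" if "z \<in> \<Omega>" for z using \<rho>[OF that] r(3) by force
      then have "(\<integral>\<^sup>+z\<in>\<Omega>. W.osc n (2 * r) z \<partial>lborel)
         \<le> emeasure lborel (ball (0::'a) (2 * r)) * ennreal ((2 * r)\<^sup>2) * (\<integral>\<^sup>+z. ennreal ((norm (G n z))\<^sup>2) \<partial>lborel)"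
        using r by (intro W.nn_integral_osc \<open>open \<Omega>\<close>) auto
      also have "\<dots> \<le> ennreal (2 ^ DIM('a) * \<beta>) * ennreal ((2 * r)\<^sup>2) * ennreal C'"
        unfolding vol by (intro mult_left_mono GC') simp
      finally show "(\<integral>\<^sup>+z\<in>\<Omega>. W.osc n (2 * r) z \<partial>lborel) \<le> ennreal (2 ^ DIM('a) * \<beta>) * ennreal ((2 * r)\<^sup>2) * ennreal C'" .
    qed simp
    also have "\<dots> = ennreal (A * r\<^sup>2)"
      using \<beta> C' by (simp add: ennreal_mult'[symmetric] ennreal_mult''[symmetric] A_def power_mult_distrib field_simps)
    finally show ?thesis .
  qed
  show ?thesis
  proof (intro exI allI impI)
    \<comment> \<open>\<open>insert 0\<close> keeps \<open>Max\<close> meaningful when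
      \<open>F\<close> is empty.\<close>
    fix i j assume "i \<ge> Max (insert 0 (N ` F))" "j \<ge> Max (insert 0 (N ` F))"
    then have ij: "\<And>d. d \<in> F \<Longrightarrow> (a d i - a d j)\<^sup>2 \<le> s"
      using \<open>finite F\<close> by (intro N) auto
    have [measurable]: "K \<in> sets borel" using \<open>compact K\<close> by (simp add: borel_compact)
    have pw: "ennreal ((U i z - U j z)\<^sup>2) * indicator K z \<le>
       3 * (ennreal (1 / \<beta>) * W.osc i (2 * r) z * indicator K z + ennreal (1 / \<beta>) * W.osc j (2 * r) z * indicator K z + ennreal s * indicator K z)" for z
    proof (cases "z \<in> K")
      case True
      then obtain d where d: "d \<in> F" "z \<in> ball d r" using F(3) by blast
      have "(U i z - U j z)\<^sup>2 = ((U i z - a d i) + (a d j - U j z) + (a d i - a d j))\<^sup>2" by simp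
      also have "\<dots> \<le> 3 * ((U i z - a d i)\<^sup>2 + (U j z - a d j)\<^sup>2 + (a d i - a d j)\<^sup>2)"
        using three_square_le by (metis power2_commute)
      also have "\<dots> \<le> 3 * ((U i z - a d i)\<^sup>2 + (U j z - a d j)\<^sup>2 + s)"
        using ij[OF d(1)] by simp
      finally have "ennreal ((U i z - U j z)\<^sup>2) \<le> ennreal (3 * ((U i z - a d i)\<^sup>2 + (U j z - a d j)\<^sup>2 + s))"
        by (rule ennreal_leI)
      also have "\<dots> = 3 * (ennreal ((U i z - a d i)\<^sup>2) + ennreal ((U j z - a d j)\<^sup>2) + ennreal s)"
        using s by (simp add: ennreal_three_mult[symmetric] ennreal_plus[symmetric] del: ennreal_plus distrib_left_numeral)
      also have "\<dots> \<le> 3 * (ennreal (1 / \<beta>) * W.osc i (2 * r) z + ennreal (1 / \<beta>) * W.osc j (2 * r) z + ennreal s)"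
        unfolding a_def \<beta>_def by (intro mult_left_mono add_mono W.average_deviation d order_refl) simp
      finally show ?thesis using True by simp
    qed simp
    have "(\<integral>\<^sup>+z\<in>K. ennreal ((U i z - U j z)\<^sup>2) \<partial>lborel) \<le>
      (\<integral>\<^sup>+z. 3 * (ennreal (1 / \<beta>) * W.osc i (2 * r) z * indicator K z + ennreal (1 / \<beta>) * W.osc j (2 * r) z * indicator K z + ennreal s * indicator K z) \<partial>lborel)"
      by (rule nn_integral_mono) (rule pw)
    also have "\<dots> = 3 * ((\<integral>\<^sup>+z\<in>K. ennreal (1 / \<beta>) * W.osc i (2 * r) z \<partial>lborel) + (\<integral>\<^sup>+z\<in>K. ennreal (1 / \<beta>) * W.osc j (2 * r) z \<partial>lborel) + ennreal s * emeasure lborel K)"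
      by (simp add: nn_integral_cmult nn_integral_add)
    also have "\<dots> \<le> 3 * (ennreal (A * r\<^sup>2) + ennreal (A * r\<^sup>2) + ennreal s * ennreal V)"
      unfolding V by (intro mult_left_mono add_mono osc_bound order_refl) simp
    also have "\<dots> = ennreal (3 * (A * r\<^sup>2 + A * r\<^sup>2 + s * V))"
      using A s V(1) by (simp add: ennreal_three_mult[symmetric] ennreal_plus[symmetric] ennreal_mult''[symmetric]
          del: ennreal_plus distrib_left_numeral)
    also have "\<dots> \<le> ennreal e"
    proof (rule ennreal_leI)
      have "s * V \<le> s * (V + 1)" using s by simp
      also have "\<dots> = e / 6" using V by (simp add: s_def field_simps)
      finally show "3 * (A * r\<^sup>2 + A * r\<^sup>2 + s * V) \<le> e" using r(2) by simp
    qed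
    finally show "(\<integral>\<^sup>+z\<in>K. ennreal ((U i z - U j z)\<^sup>2) \<partial>lborel) \<le> ennreal e" .
  qed
qed

section \<open>The weighted measure\<close>

lemma open_halfspace: "open (halfspace :: 'n::finite point set)"
  unfolding halfspace_def by (intro open_Collect_less continuous_intros)

lemma halfspace_borel [measurable, simp]: "(halfspace :: 'n::finite point set) \<in> sets borel"
  by (rule borel_open[OF open_halfspace])

text \<open>
  Admissibility bounds the profile only for almost every radius. That the norm pulls null sets back to
  null sets is checked on lines parallel to the first axis, where the radius has a differentiable inverse.
\<close>

lemma negligible_norm_slice:
  fixes Z :: "real set" and a :: real
  assumes "negligible Z"
  shows "negligible {y. y > 0 \<and> sqrt (y\<^sup>2 + a\<^sup>2) \<in> Z}"
proof (rule negligible_subset)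
  \<comment> \<open>The strict inequality removes the point where the square root fails to be
    differentiable; nothing is lost because y > 0.\<close>
  let ?S = "{\<rho> \<in> Z. \<rho>\<^sup>2 - a\<^sup>2 > 0}"
  show "negligible ((\<lambda>\<rho>. sqrt (\<rho>\<^sup>2 - a\<^sup>2)) ` ?S)"
  proof (rule negligible_differentiable_image_negligible)
    show "negligible ?S" using assms by (rule negligible_subset) auto
    show "(\<lambda>\<rho>. sqrt (\<rho>\<^sup>2 - a\<^sup>2)) differentiable_on ?S"
      unfolding differentiable_on_def
    proof
      fix \<rho> assume "\<rho> \<in> ?S"
      then have "((\<lambda>\<rho>. sqrt (\<rho>\<^sup>2 - a\<^sup>2)) has_real_derivative (2 * \<rho>) * (inverse (sqrt (\<rho>\<^sup>2 - a\<^sup>2)) / 2)) (at \<rho> within ?S)"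
        by (auto intro!: derivative_eq_intros)
      then show "(\<lambda>\<rho>. sqrt (\<rho>\<^sup>2 - a\<^sup>2)) differentiable at \<rho> within ?S"
        by (auto simp: differentiable_def has_field_derivative_def)
    qed
  qed simp
  show "{y. y > 0 \<and> sqrt (y\<^sup>2 + a\<^sup>2) \<in> Z} \<subseteq> (\<lambda>\<rho>. sqrt (\<rho>\<^sup>2 - a\<^sup>2)) ` ?S"
  proof
    fix y assume "y \<in> {y. y > 0 \<and> sqrt (y\<^sup>2 + a\<^sup>2) \<in> Z}"
    then show "y \<in> (\<lambda>\<rho>. sqrt (\<rho>\<^sup>2 - a\<^sup>2)) ` ?S"
      by (intro image_eqI[of _ _ "sqrt (y\<^sup>2 + a\<^sup>2)"]) auto
  qed
qed

text \<open>By Tonelli it suffices that every line with fixed \<open>x\<close> meets the exceptional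
  set in a null set, and along such a line the radius is sqrt(y^2 + |x|^2).\<close>

lemma AE_norm_not_in_null_set:
  assumes Z: "Z \<in> null_sets lborel"
  shows "AE z::'n::finite point in lborel. z \<in> halfspace \<longrightarrow> norm z \<notin> Z"
proof -
  let ?Q = "{z :: 'n point. z \<in> halfspace \<and> norm z \<in> Z}"
  have [measurable]: "Z \<in> sets borel" using Z by auto
  have Q: "?Q \<in> sets (lborel \<Otimes>\<^sub>M lborel)"
    unfolding lborel_prod by measurable
  have "emeasure (lborel \<Otimes>\<^sub>M lborel) ?Q = (\<integral>\<^sup>+x. emeasure lborel ((\<lambda>y. (y, x)) -` ?Q) \<partial>lborel)"
    by (rule lborel_pair.emeasure_pair_measure_alt2[OF Q])
  also have "\<dots> = (\<integral>\<^sup>+(x::real^'n). 0 \<partial>lborel)"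
  proof (rule nn_integral_cong)
    fix x :: "real^'n"
    have "(\<lambda>y. (y, x)) -` ?Q = {y. y > 0 \<and> sqrt (y\<^sup>2 + (norm x)\<^sup>2) \<in> Z}"
      by (auto simp: halfspace_def norm_Pair)
    moreover have "negligible Z"
      using Z by (auto simp: negligible_iff_null_sets intro: null_sets_completionI)
    ultimately have "(\<lambda>y. (y, x)) -` ?Q \<in> null_sets lebesgue"
      using negligible_norm_slice by (simp add: negligible_iff_null_sets)
    moreover have "(\<lambda>y. (y, x)) -` ?Q \<in> sets borel"
      using measurable_sets[of "\<lambda>y. (y, x)" lborel "lborel \<Otimes>\<^sub>M lborel" ?Q] Q by simp
    ultimately show "emeasure lborel ((\<lambda>y. (y, x)) -` ?Q) = 0"
      by (simp add: null_sets_def)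
  qed
  finally have "?Q \<in> null_sets lborel"
    using Q unfolding lborel_prod by (auto simp: null_sets_def)
  then have "AE z in lborel. z \<notin> ?Q" by (rule AE_not_in)
  then show ?thesis by eventually_elim simp
qed

section \<open>Comparison of the weighted measure with Lebesgue measure\<close>

lemma space_weighted_measure [simp]: "space (weighted_measure c \<phi> :: 'n::finite point measure) = halfspace"
  by (simp add: weighted_measure_def)

lemma sets_weighted_measure [measurable_cong]: "sets (weighted_measure c \<phi> :: 'n::finite point measure) = sets (lebesgue_on halfspace)"
  by (simp add: weighted_measure_def)

context
  fixes c :: real and \<phi> :: "real \<Rightarrow> real"
  assumes adm: "admissible \<phi>"
begin

lemma weight_measurable [measurable]: "(weight c \<phi> :: 'n::finite point \<Rightarrow> real) \<in> borel_measurable borel"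
proof -
  have "(\<lambda>z::'n point. \<phi> (norm z)) \<in> borel_measurable borel"
  proof (rule measurable_compose[of norm])
    show "(norm :: 'n point \<Rightarrow> real) \<in> borel \<rightarrow>\<^sub>M restrict_space borel {0..}"
      by (rule measurable_restrict_space2) auto
    show "\<phi> \<in> borel_measurable (restrict_space borel {0..})"
      using adm by (simp add: admissible_def)
  qed
  moreover have "(fst :: 'n point \<Rightarrow> real) \<in> borel_measurable borel"
    by (intro borel_measurable_continuous_onI continuous_intros)
  ultimately show ?thesis unfolding weight_def[abs_def] by measurable
qed

lemma weight_pos: "z \<in> halfspace \<Longrightarrow> weight c \<phi> z > 0"
  using adm by (auto simp: weight_def admissible_def halfspace_def)

text \<open>Compactness inside the half-space keeps \<open>fst z\<close> away from 0, so the power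
  attains positive extrema, and it confines the radii to a compact interval, on which admissibility
  bounds the profile.\<close>

lemma weight_bounds:
  fixes L :: "'n::finite point set"
  assumes "compact L" "L \<subseteq> halfspace"
  obtains m M where "0 < m" "0 < M" "AE z in lborel. z \<in> L \<longrightarrow> m \<le> weight c \<phi> z \<and> weight c \<phi> z \<le> M"
proof (cases "L = {}")
  case True
  then show ?thesis by (intro that[of 1 1]) auto
next
  case False
  have pos: "\<And>z. z \<in> L \<Longrightarrow> 0 < fst z" using assms by (auto simp: halfspace_def)
  then have cont: "continuous_on L (\<lambda>z. fst z powr c)"
    by (intro continuous_intros) (auto simp: less_imp_neq[symmetric])
  obtain z1 where z1: "z1 \<in> L" "\<And>z. z \<in> L \<Longrightarrow> fst z1 powr c \<le> fst z powr c"
    using continuous_attains_inf[OF \<open>compact L\<close> False cont] by auto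
  obtain z2 where z2: "z2 \<in> L" "\<And>z. z \<in> L \<Longrightarrow> fst z powr c \<le> fst z2 powr c"
    using continuous_attains_sup[OF \<open>compact L\<close> False cont] by auto
  obtain R where R: "\<And>z. z \<in> L \<Longrightarrow> norm z \<le> R" "R > 0"
    using compact_imp_bounded[OF \<open>compact L\<close>] by (auto simp: bounded_pos)
  obtain m M where mM: "0 < m" "m \<le> M" and ae: "AE \<rho> in lborel. \<rho> \<in> {0..R} \<longrightarrow> m \<le> \<phi> \<rho> \<and> \<phi> \<rho> \<le> M"
    using adm R(2) unfolding admissible_def by (metis less_eq_real_def)
  \<comment> \<open>The set of bad radii is enlarged to a Borel null set, as required for pulling it
    back along the norm.\<close>
  obtain Z where Z: "{\<rho>. \<not> (\<rho> \<in> {0..R} \<longrightarrow> m \<le> \<phi> \<rho> \<and> \<phi> \<rho> \<le> M)} \<subseteq> Z" "Z \<in> null_sets lborel"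
    using ae by (auto elim!: AE_E simp: null_sets_def)
  show ?thesis
  proof (rule that[of "fst z1 powr c * m" "fst z2 powr c * M"])
    show "AE z in lborel. z \<in> L \<longrightarrow> fst z1 powr c * m \<le> weight c \<phi> z \<and> weight c \<phi> z \<le> fst z2 powr c * M"
      using AE_norm_not_in_null_set[OF Z(2)]
    proof eventually_elim
      case (elim z)
      show ?case
      proof
        assume "z \<in> L"
        then have "norm z \<notin> Z" using elim assms by auto
        moreover have "norm z \<in> {0..R}" using R(1)[OF \<open>z \<in> L\<close>] by simp
        ultimately have "m \<le> \<phi> (norm z) \<and> \<phi> (norm z) \<le> M" using Z(1) by blast
        then show "fst z1 powr c * m \<le> weight c \<phi> z \<and> weight c \<phi> z \<le> fst z2 powr c * M"
          using mM z1(2)[OF \<open>z \<in> L\<close>] z2(2)[OF \<open>z \<in> L\<close>] unfolding weight_def by (auto intro!: mult_mono)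
      qed
    qed
  qed (use mM pos[OF z1(1)] pos[OF z2(1)] in \<open>auto intro!: mult_pos_pos\<close>)
qed

lemma weight_measurable_lebesgue_on: "(\<lambda>z::'n::finite point. ennreal (weight c \<phi> z)) \<in> borel_measurable (lebesgue_on halfspace)"
  by (intro measurable_restrict_space1 measurable_completion) measurable

lemma nn_integral_weighted_measure:
  fixes f :: "'n::finite point \<Rightarrow> ennreal"
  assumes "f \<in> borel_measurable (lebesgue_on halfspace)"
  shows "(\<integral>\<^sup>+z. f z \<partial>weighted_measure c \<phi>) = (\<integral>\<^sup>+z\<in>halfspace. ennreal (weight c \<phi> z) * f z \<partial>lborel)"
  unfolding weighted_measure_def
  by (subst nn_integral_density[OF weight_measurable_lebesgue_on assms])
    (simp add: nn_integral_restrict_space nn_integral_completion)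

text \<open>Strict positivity of the weight on the whole half-space makes the null sets of the two
  measures the same.\<close>

lemma AE_weighted_measure_iff:
  "(AE z in weighted_measure c \<phi>. P z) \<longleftrightarrow> (AE z::'n::finite point in lborel. z \<in> halfspace \<longrightarrow> P z)"
proof -
  have "(AE z in weighted_measure c \<phi>. P z) \<longleftrightarrow> (AE z::'n point in lebesgue. z \<in> halfspace \<longrightarrow> 0 < ennreal (weight c \<phi> z) \<longrightarrow> P z)"
    unfolding weighted_measure_def by (subst AE_density[OF weight_measurable_lebesgue_on]) (simp add: AE_restrict_space_iff)
  also have "\<dots> \<longleftrightarrow> (AE z::'n point in lborel. z \<in> halfspace \<longrightarrow> P z)"
    unfolding AE_completion_iff by (intro AE_cong) (use weight_pos in auto)
  finally show ?thesis .
qed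

text \<open>The constants depend on \<open>L\<close> alone; quantifying over \<open>f\<close> inside
  the obtained facts lets one pair of constants serve a whole sequence of functions and
  gradients.\<close>

lemma weighted_measure_comparable_on_compact:
  fixes L :: "'n::finite point set"
  assumes "compact L" "L \<subseteq> halfspace"
  obtains m M where "0 < m" "0 < M"
    "\<forall>f\<in>borel_measurable (lebesgue_on halfspace). (\<integral>\<^sup>+z\<in>L. f z \<partial>lborel) \<le> ennreal m * (\<integral>\<^sup>+z\<in>L. f z \<partial>weighted_measure c \<phi>)"
    "\<forall>f\<in>borel_measurable (lebesgue_on halfspace). (\<integral>\<^sup>+z\<in>L. f z \<partial>weighted_measure c \<phi>) \<le> ennreal M * (\<integral>\<^sup>+z\<in>L. f z \<partial>lborel)"
proof -
  obtain m M where mM: "0 < m" "0 < M" and ae: "AE z in lborel. z \<in> L \<longrightarrow> m \<le> weight c \<phi> z \<and> weight c \<phi> z \<le> M"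
    using weight_bounds[OF assms] by blast
  have Ls [measurable]: "L \<in> sets (lebesgue_on halfspace)"
    using assms by (auto simp: sets_restrict_space_iff borel_compact)
  have eq: "(\<integral>\<^sup>+z\<in>L. f z \<partial>weighted_measure c \<phi>) = (\<integral>\<^sup>+z. ennreal (weight c \<phi> z) * (f z * indicator L z) \<partial>lborel)"
    if [measurable]: "f \<in> borel_measurable (lebesgue_on halfspace)" for f :: "'n point \<Rightarrow> ennreal"
    using assms Ls by (subst nn_integral_weighted_measure) (auto intro!: nn_integral_cong simp: indicator_def)
  have cm: "(\<integral>\<^sup>+z. ennreal a * (f z * indicator L z) \<partial>lborel) = ennreal a * (\<integral>\<^sup>+z\<in>L. f z \<partial>lborel)"
    if [measurable]: "f \<in> borel_measurable (lebesgue_on halfspace)" for f :: "'n point \<Rightarrow> ennreal" and a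
  proof -
    \<comment> \<open>As \<open>f\<close> is only Lebesgue measurable, the constant is pulled out
      over the completed measure, where \<open>f\<close> is measurable; nonnegative integrals over
      \<open>lborel\<close> and its completion have equal values.\<close>
    have "(\<integral>\<^sup>+z. ennreal a * (f z * indicator L z) \<partial>lborel) = (\<integral>\<^sup>+z. ennreal a * (f z * indicator L z) \<partial>lebesgue_on halfspace)"
      using assms by (subst nn_integral_restrict_space)
        (auto simp: nn_integral_completion intro!: nn_integral_cong, auto simp: indicator_def)
    also have "\<dots> = ennreal a * (\<integral>\<^sup>+z\<in>L. f z \<partial>lebesgue_on halfspace)"
      using Ls by (intro nn_integral_cmult) measurable
    also have "(\<integral>\<^sup>+z\<in>L. f z \<partial>lebesgue_on halfspace) = (\<integral>\<^sup>+z\<in>L. f z \<partial>lborel)"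
      using assms by (subst nn_integral_restrict_space)
        (auto simp: nn_integral_completion intro!: nn_integral_cong, auto simp: indicator_def)
    finally show ?thesis .
  qed
  show ?thesis
  proof (rule that[of "1 / m" M]; (intro ballI)?)
    fix f :: "'n point \<Rightarrow> ennreal" assume f: "f \<in> borel_measurable (lebesgue_on halfspace)"
    have "ennreal m * (\<integral>\<^sup>+z\<in>L. f z \<partial>lborel) \<le> (\<integral>\<^sup>+z\<in>L. f z \<partial>weighted_measure c \<phi>)"
      unfolding eq[OF f] cm[OF f, symmetric]
    proof (rule nn_integral_mono_AE)
      show "AE z in lborel. ennreal m * (f z * indicator L z) \<le> ennreal (weight c \<phi> z) * (f z * indicator L z)"
        using ae by eventually_elim (auto simp: indicator_def intro!: mult_right_mono ennreal_leI)
    qed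
    then have "ennreal (1 / m) * (ennreal m * (\<integral>\<^sup>+z\<in>L. f z \<partial>lborel)) \<le> ennreal (1 / m) * (\<integral>\<^sup>+z\<in>L. f z \<partial>weighted_measure c \<phi>)"
      by (rule mult_left_mono) simp
    then show "(\<integral>\<^sup>+z\<in>L. f z \<partial>lborel) \<le> ennreal (1 / m) * (\<integral>\<^sup>+z\<in>L. f z \<partial>weighted_measure c \<phi>)"
      using mM by (simp add: mult.assoc[symmetric] ennreal_mult'[symmetric])
    show "(\<integral>\<^sup>+z\<in>L. f z \<partial>weighted_measure c \<phi>) \<le> ennreal M * (\<integral>\<^sup>+z\<in>L. f z \<partial>lborel)"
      unfolding eq[OF f] cm[OF f, symmetric]
    proof (rule nn_integral_mono_AE)
      show "AE z in lborel. ennreal (weight c \<phi> z) * (f z * indicator L z) \<le> ennreal M * (f z * indicator L z)"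
        using ae by eventually_elim (auto simp: indicator_def intro!: mult_right_mono ennreal_leI)
    qed
  qed (use mM in auto)
qed

end

section \<open>Uniqueness of weak gradients and completeness\<close>

lemma borel_measurable_lebesgue_on_halfspace_iff:
  fixes f :: "'n::finite point \<Rightarrow> 'b::real_normed_vector"
  shows "f \<in> borel_measurable (lebesgue_on halfspace) \<longleftrightarrow> (\<lambda>z. indicator halfspace z *\<^sub>R f z) \<in> borel_measurable lebesgue"
  by (rule borel_measurable_restrict_space_iff) simp

lemma borel_imp_lebesgue_on: "f \<in> borel_measurable borel \<Longrightarrow> f \<in> borel_measurable (lebesgue_on S)"
  by (intro measurable_restrict_space1 measurable_completion) simp

lemma borel_representative:
  fixes f :: "'n::finite point \<Rightarrow> 'b::euclidean_space"
  assumes "f \<in> borel_measurable (lebesgue_on halfspace)"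
  obtains g where "g \<in> borel_measurable borel" "AE z in lborel. z \<in> halfspace \<longrightarrow> g z = f z"
proof -
  have f: "(\<lambda>z. indicator halfspace z *\<^sub>R f z) \<in> borel_measurable lebesgue"
    using assms by (simp add: borel_measurable_lebesgue_on_halfspace_iff)
  have "\<exists>g'\<in>borel_measurable lborel. AE z in lborel. (indicator halfspace z *\<^sub>R f z) \<bullet> b = g' z" for b
    by (rule completion_ex_borel_measurable_real) (use f in measurable)
  then have "\<forall>b. \<exists>g'. g' \<in> borel_measurable lborel \<and> (AE z in lborel. (indicator halfspace z *\<^sub>R f z) \<bullet> b = g' z)"
    by blast
  from choice[OF this]
  obtain g where g: "\<And>b. g b \<in> borel_measurable lborel" "\<And>b. AE z in lborel. (indicator halfspace z *\<^sub>R f z) \<bullet> b = g b z"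
    by blast
  show ?thesis
  proof (rule that[of "\<lambda>z. \<Sum>b\<in>Basis. g b z *\<^sub>R b"])
    show "(\<lambda>z. \<Sum>b\<in>Basis. g b z *\<^sub>R b) \<in> borel_measurable borel"
      using g(1) by (auto intro!: borel_measurable_sum borel_measurable_scaleR)
    have "AE z in lborel. \<forall>b\<in>Basis. (indicator halfspace z *\<^sub>R f z) \<bullet> b = g b z"
      using g(2) by (intro AE_finite_allI) auto
    then show "AE z in lborel. z \<in> halfspace \<longrightarrow> (\<Sum>b\<in>Basis. g b z *\<^sub>R b) = f z"
    proof eventually_elim
      case (elim z)
      have "(\<Sum>b\<in>Basis. g b z *\<^sub>R b) = (\<Sum>b\<in>Basis. (f z \<bullet> b) *\<^sub>R b)" if "z \<in> halfspace"
        using elim that by (intro sum.cong) auto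
      then show ?case by (intro impI) (simp add: euclidean_representation)
    qed
  qed
qed

text \<open>The bridge to \<open>weak_gradient_pair\<close>: integrability over
  \<open>lborel\<close> includes Borel measurability, and vanishing everywhere off \<open>L\<close>
  turns integrals over the whole space into integrals over \<open>L\<close>.\<close>

definition truncation_of :: "('n::finite point \<Rightarrow> 'b::euclidean_space) \<Rightarrow> 'n point set \<Rightarrow> ('n point \<Rightarrow> 'b) \<Rightarrow> bool" where
  "truncation_of f L g \<longleftrightarrow> integrable lborel g \<and> (AE z in lborel. z \<in> L \<longrightarrow> g z = f z) \<and> (\<forall>z. z \<notin> L \<longrightarrow> g z = 0)"

lemma truncation_exists:
  fixes f :: "'n::finite point \<Rightarrow> 'b::euclidean_space"
  assumes f: "f \<in> L1_loc" and L: "compact L" "L \<subseteq> halfspace"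
  obtains g where "truncation_of f L g"
proof -
  have fm: "f \<in> borel_measurable (lebesgue_on halfspace)" and fi: "integrable (lebesgue_on L) f"
    using f L by (auto simp: L1_loc_def)
  obtain g0 where g0 [measurable]: "g0 \<in> borel_measurable borel" and ae: "AE z in lborel. z \<in> halfspace \<longrightarrow> g0 z = f z"
    using borel_representative[OF fm] .
  have Lb [measurable]: "L \<in> sets borel" using L by (simp add: borel_compact)
  define g where "g z = indicator L z *\<^sub>R g0 z" for z
  have gm [measurable]: "g \<in> borel_measurable borel" unfolding g_def by measurable
  have aeL: "AE z in lborel. z \<in> L \<longrightarrow> g z = f z"
    using ae by eventually_elim (use L in \<open>auto simp: g_def\<close>)
  have fL: "integrable lebesgue (\<lambda>z. indicator L z *\<^sub>R f z)"
    using fi Lb by (subst (asm) integrable_restrict_space) auto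
  have "integrable lebesgue g"
  proof (rule integrable_cong_AE_imp[OF fL])
    show "g \<in> borel_measurable lebesgue" using gm by (intro measurable_completion) simp
    show "AE z in lebesgue. indicator L z *\<^sub>R f z = g z"
      unfolding AE_completion_iff using aeL by eventually_elim (auto simp: g_def indicator_def)
  qed
  then have "integrable lborel g"
    by (subst (asm) integrable_completion) auto
  then show ?thesis
    using aeL by (intro that[of g]) (auto simp: truncation_of_def g_def)
qed

lemma set_integral_halfspace_eq:
  fixes f f' :: "'n::finite point \<Rightarrow> real"
  assumes "f \<in> borel_measurable (lebesgue_on halfspace)" and [measurable]: "f' \<in> borel_measurable borel"
    and ae: "AE z in lborel. indicator halfspace z * f z = f' z"
  shows "(LINT z:halfspace|lebesgue. f z) = (LINT z|lborel. f' z)"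
proof -
  have "(LINT z:halfspace|lebesgue. f z) = (LINT z|lebesgue. f' z)"
    unfolding set_lebesgue_integral_def
  proof (rule integral_cong_AE)
    show "(\<lambda>z. indicator halfspace z *\<^sub>R f z) \<in> borel_measurable lebesgue"
      using assms(1) by (simp only: borel_measurable_lebesgue_on_halfspace_iff)
    show "f' \<in> borel_measurable lebesgue" by (intro measurable_completion) simp
    show "AE z in lebesgue. indicator halfspace z *\<^sub>R f z = f' z"
      unfolding AE_completion_iff using ae by simp
  qed
  also have "\<dots> = (LINT z|lborel. f' z)" by (rule integral_completion) simp
  finally show ?thesis .
qed

text \<open>Cutting off destroys weak differentiability across the boundary of \<open>L\<close>, but
  a bump supported in \<open>L\<close> does not see the cut. This is why the locale tests only boxes
  inside \<open>L\<close>.\<close>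

lemma weak_gradient_pair_truncation:
  fixes u :: "'n::finite point \<Rightarrow> real"
  assumes wg: "has_weak_gradient u G" and L: "L \<subseteq> halfspace"
    and u': "truncation_of u L u'" and G': "truncation_of G L G'"
  shows "weak_gradient_pair u' G' L"
proof
  show iu: "integrable lborel u'" and iG: "integrable lborel G'"
    using u' G' by (auto simp: truncation_of_def)
  note [measurable] = borel_measurable_integrable[OF iu] borel_measurable_integrable[OF iG]
  have um: "u \<in> borel_measurable (lebesgue_on halfspace)" and Gm: "G \<in> borel_measurable (lebesgue_on halfspace)"
    using wg by (auto simp: has_weak_gradient_def L1_loc_def)
  have aeu: "AE z in lborel. z \<in> L \<longrightarrow> u' z = u z" and aeG: "AE z in lborel. z \<in> L \<longrightarrow> G' z = G z"
    using u' G' by (auto simp: truncation_of_def)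
  fix l r m and b :: "'n point" assume sub: "cbox l r \<subseteq> L" and b: "b \<in> Basis"
  have "test_function (bump l r m)" using sub L by (intro test_function_bump) auto
  then have "(LINT z:halfspace|lebesgue. u z * dbump l r m b z) = - (LINT z:halfspace|lebesgue. (G z \<bullet> b) * bump l r m z)"
    using wg b unfolding has_weak_gradient_def dbump_def by blast
  moreover have "(LINT z:halfspace|lebesgue. u z * dbump l r m b z) = (LINT z|lborel. u' z * dbump l r m b z)"
  proof (rule set_integral_halfspace_eq)
    show "(\<lambda>z. u z * dbump l r m b z) \<in> borel_measurable (lebesgue_on halfspace)"
      by (intro borel_measurable_times um borel_imp_lebesgue_on dbump_measurable)
    show "AE z in lborel. indicator halfspace z * (u z * dbump l r m b z) = u' z * dbump l r m b z"
      using aeu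
    proof eventually_elim
      case (elim z)
      show ?case
      proof (cases "z \<in> cbox l r")
        case True
        then have "z \<in> L" "z \<in> halfspace" using sub L by blast+
        then show ?thesis using elim by simp
      qed (simp add: dbump_eq_0)
    qed
  qed measurable
  moreover have "(LINT z:halfspace|lebesgue. (G z \<bullet> b) * bump l r m z) = (LINT z|lborel. (G' z \<bullet> b) * bump l r m z)"
  proof (rule set_integral_halfspace_eq)
    show "(\<lambda>z. (G z \<bullet> b) * bump l r m z) \<in> borel_measurable (lebesgue_on halfspace)"
      by (intro borel_measurable_times borel_measurable_inner Gm borel_imp_lebesgue_on bump_measurable) simp
    show "AE z in lborel. indicator halfspace z * ((G z \<bullet> b) * bump l r m z) = (G' z \<bullet> b) * bump l r m z"
      using aeG
    proof eventually_elim
      case (elim z)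
      show ?case
      proof (cases "z \<in> cbox l r")
        case True
        then have "z \<in> L" "z \<in> halfspace" using sub L by blast+
        then show ?thesis using elim by simp
      next
        case False
        then have "z \<notin> box l r" using box_subset_cbox by blast
        then show ?thesis by (simp add: bump_eq_0)
      qed
    qed
  qed measurable
  ultimately show "(LINT z|lborel. u' z * dbump l r m b z) = - (LINT z|lborel. (G' z \<bullet> b) * bump l r m z)"
    by simp
qed

text \<open>One index controls both cutoffs, so what a slab omits from the half-space is a boundary
  strip together with a tail, exactly the two regions that tightness controls.\<close>

definition slab :: "nat \<Rightarrow> 'n::finite point set" where
  "slab n = {z. inverse (real (Suc n)) \<le> fst z \<and> norm z \<le> real n}"

lemma compact_slab: "compact (slab n :: 'a::finite point set)"
  and slab_subset: "slab n \<subseteq> (halfspace :: 'a::finite point set)"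
proof -
  have "closed {z::'a point. inverse (real (Suc n)) \<le> fst z}"
    by (intro closed_Collect_le continuous_intros)
  moreover have "slab n = {z. inverse (real (Suc n)) \<le> fst z} \<inter> (cball 0 (real n) :: 'a point set)"
    by (auto simp: slab_def)
  ultimately show "compact (slab n :: 'a point set)" by (simp add: closed_Int_compact)
  show "slab n \<subseteq> (halfspace :: 'a point set)"
    by (auto simp: slab_def halfspace_def intro: less_le_trans[rotated])
qed

definition open_slab :: "nat \<Rightarrow> 'n::finite point set" where
  "open_slab n = {z. inverse (real (Suc n)) < fst z \<and> norm z < real n}"

lemma open_slab: "open (open_slab n)"
  unfolding open_slab_def by (intro open_Collect_conj open_Collect_less continuous_intros)

lemma open_slab_subset: "open_slab n \<subseteq> slab n"
  by (auto simp: open_slab_def slab_def)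

lemma halfspace_eq_UN_open_slab: "(halfspace :: 'a::finite point set) = (\<Union>n. open_slab n)"
proof -
  have "\<exists>n. z \<in> open_slab n" if "z \<in> halfspace" for z :: "'a point"
  proof -
    have "\<forall>\<^sub>F n in sequentially. inverse (real (Suc n)) < fst z"
      using that by (intro order_tendstoD[OF LIMSEQ_inverse_real_of_nat]) (auto simp: halfspace_def)
    moreover have "\<forall>\<^sub>F n in sequentially. norm z < real n"
      by (rule filterlim_at_top_dense[THEN iffD1, OF filterlim_real_sequentially, rule_format])
    ultimately have "\<forall>\<^sub>F n in sequentially. z \<in> open_slab n"
      by eventually_elim (simp add: open_slab_def)
    then show ?thesis by (auto dest: eventually_happens)
  qed
  moreover have "open_slab n \<subseteq> (halfspace :: 'a point set)" for n
    using open_slab_subset slab_subset by (rule order_trans)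
  ultimately show ?thesis by blast
qed

text \<open>
  Uniqueness makes the representative chosen by \<^const>\<open>weak_gradient\<close> scale with the function, up to
  null sets; without it a multiple of a function could not be moved into the unit ball.
\<close>

lemma has_weak_gradient_unique:
  fixes u :: "'n::finite point \<Rightarrow> real"
  assumes 1: "has_weak_gradient u G1" and 2: "has_weak_gradient u G2"
  shows "AE z in lborel. z \<in> halfspace \<longrightarrow> G1 z = G2 z"
proof -
  have "AE z in lborel. z \<in> open_slab n \<longrightarrow> G1 z = G2 z" for n
  proof -
    have L1: "u \<in> L1_loc" "G1 \<in> L1_loc" "G2 \<in> L1_loc" using 1 2 by (auto simp: has_weak_gradient_def)
    obtain u' where u': "truncation_of u (slab n) u'" using truncation_exists[OF L1(1) compact_slab slab_subset] .
    obtain G1' where G1': "truncation_of G1 (slab n) G1'" using truncation_exists[OF L1(2) compact_slab slab_subset] .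
    obtain G2' where G2': "truncation_of G2 (slab n) G2'" using truncation_exists[OF L1(3) compact_slab slab_subset] .
    interpret W1: weak_gradient_pair u' G1' "slab n" by (rule weak_gradient_pair_truncation[OF 1 slab_subset u' G1'])
    interpret W2: weak_gradient_pair u' G2' "slab n" by (rule weak_gradient_pair_truncation[OF 2 slab_subset u' G2'])
    have "AE z in lborel. z \<in> open_slab n \<longrightarrow> (G1' z - G2' z) \<bullet> b = 0" if b: "b \<in> Basis" for b
    proof (rule AE_eq_0_if_integral_bump_eq_0[OF _ open_slab])
      show "integrable lborel (\<lambda>z. (G1' z - G2' z) \<bullet> b)" using W1.G W2.G by simp
      fix l r :: "'n point" and m assume "cbox l r \<subseteq> open_slab n"
      then have "cbox l r \<subseteq> slab n" using open_slab_subset by blast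
      then have "(LINT z|lborel. (G1' z \<bullet> b) * bump l r m z) = (LINT z|lborel. (G2' z \<bullet> b) * bump l r m z)"
        using W1.weak[of l r b m] W2.weak[of l r b m] b by simp
      then show "(LINT z|lborel. ((G1' z - G2' z) \<bullet> b) * bump l r m z) = 0"
        using W1.integrable_G_bump W2.integrable_G_bump by (simp add: inner_diff_left left_diff_distrib)
    qed
    then have "AE z in lborel. \<forall>b\<in>Basis. z \<in> open_slab n \<longrightarrow> (G1' z - G2' z) \<bullet> b = 0"
      by (intro AE_finite_allI) auto
    moreover have "AE z in lborel. z \<in> slab n \<longrightarrow> G1' z = G1 z" "AE z in lborel. z \<in> slab n \<longrightarrow> G2' z = G2 z"
      using G1' G2' by (auto simp: truncation_of_def)
    ultimately show ?thesis
    proof eventually_elim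
      case (elim z)
      show ?case
      proof
        assume z: "z \<in> open_slab n"
        have "(G1' z - G2' z) \<bullet> b = 0" if "b \<in> Basis" for b using elim(1) that z by blast
        then have "G1' z = G2' z" by (simp add: euclidean_eq_iff[of "G1' z"] inner_diff_left)
        moreover have "z \<in> slab n" using z open_slab_subset by blast
        ultimately show "G1 z = G2 z" using elim by simp
      qed
    qed
  qed
  then have "AE z in lborel. \<forall>n. z \<in> open_slab n \<longrightarrow> G1 z = G2 z"
    unfolding AE_all_countable ..
  then show ?thesis by eventually_elim (auto simp: halfspace_eq_UN_open_slab)
qed

text \<open>The Riesz-Fischer argument, written with nonnegative integrals so that only differences
  of the functions have to be square integrable. A rapidly converging subsequence has a pointwise
  limit almost everywhere, and Fatou transfers the Cauchy bound to it.\<close>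

lemma L2_complete:
  fixes f :: "nat \<Rightarrow> 'a \<Rightarrow> real"
  assumes [measurable]: "\<And>n. f n \<in> borel_measurable M"
    and Cauchy: "\<And>e. e > 0 \<Longrightarrow> \<exists>N. \<forall>i\<ge>N. \<forall>j\<ge>N. (\<integral>\<^sup>+z. ennreal ((f i z - f j z)\<^sup>2) \<partial>M) \<le> ennreal e"
  obtains v where "v \<in> borel_measurable M"
    "\<forall>e>0. \<exists>N. \<forall>i\<ge>N. (\<integral>\<^sup>+z. ennreal ((f i z - v z)\<^sup>2) \<partial>M) \<le> ennreal e"
proof -
  define P where "P e N \<longleftrightarrow> (\<forall>i\<ge>N. \<forall>j\<ge>N. (\<integral>\<^sup>+z. ennreal ((f i z - f j z)\<^sup>2) \<partial>M) \<le> ennreal e)" for e N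
  \<comment> \<open>The rate 1/8 leaves room for the weights \<open>4 ^ k\<close> in
    \<open>S\<close>: the series is then dominated by powers of 1/2, while finiteness of
    \<open>S z\<close> bounds the increments at \<open>z\<close> by a multiple of
    \<open>(1 / 2) ^ k\<close>.\<close>
  have "\<exists>N. \<forall>k. P ((1 / 8) ^ k) (N k)"
    using Cauchy by (intro choice allI) (auto simp: P_def)
  then obtain N where N: "\<And>k. P ((1 / 8) ^ k) (N k)" by blast
  \<comment> \<open>Summing the successors of the thresholds makes \<open>r\<close> strictly
    increasing and at the same time at least \<open>N k\<close>.\<close>
  define r where "r k = (\<Sum>i\<le>k. Suc (N i))" for k
  have rN: "N k \<le> r k" for k
    unfolding r_def by (rule order_trans[OF _ member_le_sum[of k]]) auto
  have r_mono: "strict_mono r"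
    by (auto simp: strict_mono_Suc_iff r_def)
  have step: "(\<integral>\<^sup>+z. ennreal ((f (r (Suc k)) z - f (r k) z)\<^sup>2) \<partial>M) \<le> ennreal ((1 / 8) ^ k)" for k
  proof -
    have "N k \<le> r (Suc k)" using rN[of k] r_mono by (meson le_trans less_imp_le strict_mono_Suc_iff)
    then show ?thesis using N[of k] rN[of k] unfolding P_def by blast
  qed
  define S where "S z = (\<Sum>k. ennreal (4 ^ k * (f (r (Suc k)) z - f (r k) z)\<^sup>2))" for z
  have [measurable]: "S \<in> borel_measurable M" unfolding S_def by measurable
  have "(\<integral>\<^sup>+z. S z \<partial>M) = (\<Sum>k. \<integral>\<^sup>+z. ennreal (4 ^ k * (f (r (Suc k)) z - f (r k) z)\<^sup>2) \<partial>M)"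
    unfolding S_def by (rule nn_integral_suminf) measurable
  also have "\<dots> \<le> (\<Sum>k. ennreal ((1 / 2) ^ k))"
  proof (rule suminf_le)
    fix k
    have "(\<integral>\<^sup>+z. ennreal (4 ^ k * (f (r (Suc k)) z - f (r k) z)\<^sup>2) \<partial>M)
      = (\<integral>\<^sup>+z. ennreal (4 ^ k) * ennreal ((f (r (Suc k)) z - f (r k) z)\<^sup>2) \<partial>M)"
      by (intro nn_integral_cong) (simp add: ennreal_mult')
    also have "\<dots> = ennreal (4 ^ k) * (\<integral>\<^sup>+z. ennreal ((f (r (Suc k)) z - f (r k) z)\<^sup>2) \<partial>M)"
      by (rule nn_integral_cmult) measurable
    also have "\<dots> \<le> ennreal (4 ^ k) * ennreal ((1 / 8) ^ k)"
      by (intro mult_left_mono step) simp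
    also have "\<dots> = ennreal ((1 / 2) ^ k)"
      by (simp add: ennreal_mult'[symmetric] power_mult_distrib[symmetric])
    finally show "(\<integral>\<^sup>+z. ennreal (4 ^ k * (f (r (Suc k)) z - f (r k) z)\<^sup>2) \<partial>M) \<le> ennreal ((1 / 2) ^ k)" .
  qed auto
  also have "\<dots> = ennreal (\<Sum>k. (1 / 2) ^ k)"
    by (rule suminf_ennreal2) (auto intro: summable_geometric)
  finally have "(\<integral>\<^sup>+z. S z \<partial>M) \<noteq> \<infinity>" by (auto simp: top_unique)
  then have ae: "AE z in M. S z \<noteq> \<infinity>" by (rule nn_integral_noteq_infinite[rotated]) measurable
  define v where "v z = lim (\<lambda>k. f (r k) z)" for z
  have vm [measurable]: "v \<in> borel_measurable M"
    unfolding v_def by (rule borel_measurable_lim_metric) measurable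
  have conv: "AE z in M. (\<lambda>k. f (r k) z) \<longlonglongrightarrow> v z"
    using ae
  proof eventually_elim
    case (elim z)
    define C where "C = enn2real (S z)"
    have C: "S z = ennreal C" "C \<ge> 0" using elim by (auto simp: C_def less_top)
    have d: "\<bar>f (r (Suc k)) z - f (r k) z\<bar> \<le> sqrt C * (1 / 2) ^ k" for k
    proof -
      have "ennreal (4 ^ k * (f (r (Suc k)) z - f (r k) z)\<^sup>2) \<le> S z"
        unfolding S_def by (rule order_trans[OF _ sum_le_suminf[of _ "{k}"]]) auto
      then have "4 ^ k * (f (r (Suc k)) z - f (r k) z)\<^sup>2 \<le> C" using C by simp
      then have "(2 ^ k * \<bar>f (r (Suc k)) z - f (r k) z\<bar>)\<^sup>2 \<le> C"
        by (simp add: power_mult_distrib power_mult[symmetric] mult.commute[of k] power_mult)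
      then have "2 ^ k * \<bar>f (r (Suc k)) z - f (r k) z\<bar> \<le> sqrt C" by (rule real_le_rsqrt)
      then show ?thesis by (simp add: field_simps power_divide)
    qed
    have "summable (\<lambda>k. f (r (Suc k)) z - f (r k) z)"
      by (rule summable_comparison_test[of _ "\<lambda>k. sqrt C * (1 / 2) ^ k"]) (use d in \<open>auto intro!: summable_mult summable_geometric\<close>)
    then have "convergent (\<lambda>n. \<Sum>k<n. f (r (Suc k)) z - f (r k) z)"
      by (simp add: summable_iff_convergent)
    moreover have "(\<Sum>k<n. f (r (Suc k)) z - f (r k) z) = f (r n) z - f (r 0) z" for n
      by (rule sum_lessThan_telescope[of "\<lambda>k. f (r k) z"])
    ultimately have "convergent (\<lambda>n. f (r n) z - f (r 0) z)" by simp
    then have "convergent (\<lambda>n. (f (r n) z - f (r 0) z) + f (r 0) z)"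
      by (intro convergent_add convergent_const)
    then have "convergent (\<lambda>n. f (r n) z)" by simp
    then show ?case unfolding v_def by (simp add: convergent_LIMSEQ_iff)
  qed
  show ?thesis
  proof (rule that[OF vm], intro allI impI)
    fix e :: real assume "e > 0"
    then obtain N' where N': "\<And>i j. i \<ge> N' \<Longrightarrow> j \<ge> N' \<Longrightarrow> (\<integral>\<^sup>+z. ennreal ((f i z - f j z)\<^sup>2) \<partial>M) \<le> ennreal e"
      using Cauchy by blast
    have "(\<integral>\<^sup>+z. ennreal ((f i z - v z)\<^sup>2) \<partial>M) \<le> ennreal e" if i: "i \<ge> N'" for i
    proof -
      have "(\<integral>\<^sup>+z. ennreal ((f i z - v z)\<^sup>2) \<partial>M) = (\<integral>\<^sup>+z. liminf (\<lambda>k. ennreal ((f i z - f (r k) z)\<^sup>2)) \<partial>M)"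
      proof (rule nn_integral_cong_AE)
        show "AE z in M. ennreal ((f i z - v z)\<^sup>2) = liminf (\<lambda>k. ennreal ((f i z - f (r k) z)\<^sup>2))"
          using conv
        proof eventually_elim
          case (elim z)
          then have "(\<lambda>k. ennreal ((f i z - f (r k) z)\<^sup>2)) \<longlonglongrightarrow> ennreal ((f i z - v z)\<^sup>2)"
            by (intro tendsto_ennrealI tendsto_intros)
          then show ?case by (rule lim_imp_Liminf[OF trivial_limit_sequentially, symmetric])
        qed
      qed
      also have "\<dots> \<le> liminf (\<lambda>k. \<integral>\<^sup>+z. ennreal ((f i z - f (r k) z)\<^sup>2) \<partial>M)"
        by (rule nn_integral_liminf) measurable
      also have "\<dots> \<le> ennreal e"
      proof (rule Liminf_le)
        have "r k \<ge> N'" if "k \<ge> N'" for k using strict_mono_imp_increasing[OF r_mono, of k] that by simp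
        then show "\<forall>\<^sub>F k in sequentially. (\<integral>\<^sup>+z. ennreal ((f i z - f (r k) z)\<^sup>2) \<partial>M) \<le> ennreal e"
          using N'[OF i] by (auto simp: eventually_sequentially)
      qed simp
      finally show ?thesis .
    qed
    then show "\<exists>N. \<forall>i\<ge>N. (\<integral>\<^sup>+z. ennreal ((f i z - v z)\<^sup>2) \<partial>M) \<le> ennreal e" by blast
  qed
qed

section \<open>Weighted spaces\<close>

lemma square_add_le: "(a + b)\<^sup>2 \<le> 2 * a\<^sup>2 + 2 * (b::real)\<^sup>2"
  using zero_le_power2[of "a - b"] by (simp add: power2_eq_square algebra_simps)

lemma nn_integral_square_add_le:
  fixes f g :: "'a \<Rightarrow> real"
  assumes [measurable]: "f \<in> borel_measurable M" "g \<in> borel_measurable M" "A \<in> sets M"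
  shows "(\<integral>\<^sup>+z\<in>A. ennreal ((f z + g z)\<^sup>2) \<partial>M) \<le> 2 * (\<integral>\<^sup>+z\<in>A. ennreal ((f z)\<^sup>2) \<partial>M) + 2 * (\<integral>\<^sup>+z\<in>A. ennreal ((g z)\<^sup>2) \<partial>M)"
proof -
  have "ennreal ((f z + g z)\<^sup>2) \<le> 2 * ennreal ((f z)\<^sup>2) + 2 * ennreal ((g z)\<^sup>2)" for z
  proof -
    have "ennreal ((f z + g z)\<^sup>2) \<le> ennreal (2 * (f z)\<^sup>2 + 2 * (g z)\<^sup>2)"
      by (rule ennreal_leI[OF square_add_le])
    also have "\<dots> = 2 * ennreal ((f z)\<^sup>2) + 2 * ennreal ((g z)\<^sup>2)"
      by (simp add: ennreal_mult')
    finally show ?thesis .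
  qed
  then have "(\<integral>\<^sup>+z\<in>A. ennreal ((f z + g z)\<^sup>2) \<partial>M)
     \<le> (\<integral>\<^sup>+z. 2 * (ennreal ((f z)\<^sup>2) * indicator A z) + 2 * (ennreal ((g z)\<^sup>2) * indicator A z) \<partial>M)"
    by (intro nn_integral_mono) (auto simp: indicator_def)
  also have "\<dots> = 2 * (\<integral>\<^sup>+z\<in>A. ennreal ((f z)\<^sup>2) \<partial>M) + 2 * (\<integral>\<^sup>+z\<in>A. ennreal ((g z)\<^sup>2) \<partial>M)"
    by (simp add: nn_integral_add nn_integral_cmult)
  finally show ?thesis .
qed

text \<open>The diagonal argument is available for one bound common to all points; each point is
  normalised by its own bound and scaled back afterwards.\<close>

lemma convergent_subsequence_countable:
  fixes a :: "nat \<Rightarrow> 'a \<Rightarrow> real"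
  assumes "countable S" and bnd: "\<And>p. p \<in> S \<Longrightarrow> \<exists>B. \<forall>k. \<bar>a k p\<bar> \<le> B"
  obtains r where "strict_mono (r :: nat \<Rightarrow> nat)" "\<forall>p\<in>S. convergent (\<lambda>k. a (r k) p)"
proof -
  have "\<forall>p. \<exists>B>0. p \<in> S \<longrightarrow> (\<forall>k. \<bar>a k p\<bar> \<le> B)"
  proof
    fix p
    show "\<exists>B>0. p \<in> S \<longrightarrow> (\<forall>k. \<bar>a k p\<bar> \<le> B)"
    proof (cases "p \<in> S")
      case True
      then obtain B where "\<forall>k. \<bar>a k p\<bar> \<le> B" using bnd by blast
      then have "\<forall>k. \<bar>a k p\<bar> \<le> max B 1" by (auto simp: le_max_iff_disj)
      then show ?thesis by (intro exI[of _ "max B 1"]) auto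
    qed (auto intro: exI[of _ 1])
  qed
  from choice[OF this] obtain B where B: "\<And>p. B p > 0" "\<And>p k. p \<in> S \<Longrightarrow> \<bar>a k p\<bar> \<le> B p" by blast
  obtain r where r: "strict_mono r" "\<And>p. p \<in> S \<Longrightarrow> \<exists>l. (\<lambda>k. a (r k) p / B p) \<longlonglongrightarrow> l"
  proof (rule function_convergent_subsequence[OF \<open>countable S\<close>, of "\<lambda>k p. a k p / B p" 1])
    show "norm (a k p / B p) \<le> 1" if "p \<in> S" for k p
      using B(1)[of p] B(2)[OF that, of k] by (simp add: field_simps)
  qed blast
  show ?thesis
  proof (rule that[OF r(1)], rule ballI)
    fix p assume "p \<in> S"
    then obtain l where "(\<lambda>k. a (r k) p / B p) \<longlonglongrightarrow> l" using r(2) by blast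
    then have "(\<lambda>k. a (r k) p / B p * B p) \<longlonglongrightarrow> l * B p" by (intro tendsto_intros)
    then show "convergent (\<lambda>k. a (r k) p)"
      using B(1)[of p] by (auto simp: convergent_def)
  qed
qed

lemma L1_loc_scaleR:
  assumes "f \<in> L1_loc"
  shows "(\<lambda>z. a *\<^sub>R f z) \<in> L1_loc"
  using assms by (auto simp: L1_loc_def intro!: borel_measurable_scaleR)

lemma has_weak_gradient_scale:
  fixes u :: "'n::finite point \<Rightarrow> real"
  assumes "has_weak_gradient u G"
  shows "has_weak_gradient (\<lambda>z. a * u z) (\<lambda>z. a *\<^sub>R G z)"
  unfolding has_weak_gradient_def
proof (intro conjI allI impI ballI)
  show "(\<lambda>z. a * u z) \<in> L1_loc"
    using L1_loc_scaleR[of u a] assms by (simp add: has_weak_gradient_def)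
  show "(\<lambda>z. a *\<^sub>R G z) \<in> L1_loc"
    using L1_loc_scaleR[of G a] assms by (simp add: has_weak_gradient_def)
  fix \<eta> :: "'n point \<Rightarrow> real" and b :: "'n point" assume "test_function \<eta>" "b \<in> Basis"
  then have "(LINT z:halfspace|lebesgue. u z * frechet_derivative \<eta> (at z) b) = - (LINT z:halfspace|lebesgue. (G z \<bullet> b) * \<eta> z)"
    using assms by (auto simp: has_weak_gradient_def)
  then show "(LINT z:halfspace|lebesgue. a * u z * frechet_derivative \<eta> (at z) b) = - (LINT z:halfspace|lebesgue. (a *\<^sub>R G z \<bullet> b) * \<eta> z)"
    by (simp add: mult.assoc)
qed

lemma L2_norm_on_scaleR: "L2_norm_on c \<phi> A (\<lambda>z. a *\<^sub>R f z) = \<bar>a\<bar> * L2_norm_on c \<phi> A f"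
  by (simp add: L2_norm_on_def power_mult_distrib real_sqrt_mult)

lemma measurable_weighted_measure_iff:
  fixes f :: "'n::finite point \<Rightarrow> 'b::topological_space"
  shows "f \<in> borel_measurable (weighted_measure c \<phi>) \<longleftrightarrow> f \<in> borel_measurable (lebesgue_on halfspace)"
  by (rule arg_cong2[where f = "(\<in>)"]) (auto intro!: measurable_cong_sets sets_weighted_measure)

lemma L2_norm_on_nonneg: "0 \<le> L2_norm_on c \<phi> A f"
  unfolding L2_norm_on_def set_lebesgue_integral_def by (intro real_sqrt_ge_zero integral_nonneg_AE) auto

lemma nn_integral_weighted_halfspace:
  fixes f :: "'n::finite point \<Rightarrow> ennreal"
  shows "(\<integral>\<^sup>+z\<in>halfspace. f z \<partial>weighted_measure c \<phi>) = (\<integral>\<^sup>+z. f z \<partial>weighted_measure c \<phi>)"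
  by (intro nn_integral_cong) (simp add: space_weighted_measure)

lemma has_weak_gradient_weak_gradient:
  assumes "u \<in> H1 c \<phi>"
  shows "has_weak_gradient u (weak_gradient u)"
proof -
  obtain G where "has_weak_gradient u G" using assms by (auto simp: H1_def)
  then show ?thesis unfolding weak_gradient_def by (rule someI[of "has_weak_gradient u"])
qed

context
  fixes c :: real and \<phi> :: "real \<Rightarrow> real"
  assumes adm: "admissible \<phi>"
begin

text \<open>Local integrability comes for free: on a compact set the weight is bounded below, the
  measure is finite, and |x| <= 1 + x^2.\<close>

lemma L2_iff:
  fixes f :: "'n::finite point \<Rightarrow> 'b::euclidean_space"
  shows "f \<in> L2 c \<phi> \<longleftrightarrow> f \<in> borel_measurable (lebesgue_on halfspace) \<and>
    (\<integral>\<^sup>+z. ennreal ((norm (f z))\<^sup>2) \<partial>weighted_measure c \<phi>) < \<infinity>"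
proof
  assume "f \<in> L2 c \<phi>"
  then show "f \<in> borel_measurable (lebesgue_on halfspace) \<and> (\<integral>\<^sup>+z. ennreal ((norm (f z))\<^sup>2) \<partial>weighted_measure c \<phi>) < \<infinity>"
    by (auto simp: L2_def L1_loc_def integrable_iff_bounded)
next
  assume *: "f \<in> borel_measurable (lebesgue_on halfspace) \<and> (\<integral>\<^sup>+z. ennreal ((norm (f z))\<^sup>2) \<partial>weighted_measure c \<phi>) < \<infinity>"
  then have f [measurable]: "f \<in> borel_measurable (lebesgue_on halfspace)" and f2: "(\<integral>\<^sup>+z. ennreal ((norm (f z))\<^sup>2) \<partial>weighted_measure c \<phi>) < \<infinity>"
    by auto
  have i2: "integrable (weighted_measure c \<phi>) (\<lambda>z. (norm (f z))\<^sup>2)"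
    using f2 by (auto simp: integrable_iff_bounded measurable_weighted_measure_iff)
  have "integrable (lebesgue_on K) f" if K: "compact K" "K \<subseteq> halfspace" for K
  proof (rule integrableI_bounded)
    show "f \<in> borel_measurable (lebesgue_on K)"
      using f K by (intro measurable_restrict_mono[OF f]) auto
    obtain m where m: "\<forall>f\<in>borel_measurable (lebesgue_on halfspace). (\<integral>\<^sup>+z\<in>K. f z \<partial>lborel) \<le> ennreal m * (\<integral>\<^sup>+z\<in>K. f z \<partial>weighted_measure c \<phi>)"
      using weighted_measure_comparable_on_compact[OF adm K, of c] by blast
    have le: "(\<integral>\<^sup>+z\<in>K. ennreal ((norm (f z))\<^sup>2) \<partial>lborel) \<le> ennreal m * (\<integral>\<^sup>+z\<in>K. ennreal ((norm (f z))\<^sup>2) \<partial>weighted_measure c \<phi>)"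
      by (rule m[rule_format]) measurable
    have Kl [measurable]: "K \<in> sets (lebesgue_on halfspace)" "K \<in> sets lebesgue"
      using K by (auto simp: sets_restrict_space_iff borel_compact)
    have eqK: "(\<integral>\<^sup>+z. g z * indicator K z \<partial>lborel) = (\<integral>\<^sup>+z. g z * indicator K z \<partial>lebesgue_on halfspace)" for g :: "'n point \<Rightarrow> ennreal"
      using K by (subst nn_integral_restrict_space)
        (auto simp: nn_integral_completion indicator_def intro!: nn_integral_cong)
    have "(\<integral>\<^sup>+z. ennreal (norm (f z)) \<partial>lebesgue_on K) = (\<integral>\<^sup>+z\<in>K. ennreal (norm (f z)) \<partial>lborel)"
      using Kl by (subst nn_integral_restrict_space) (auto simp: nn_integral_completion)
    also have "\<dots> \<le> (\<integral>\<^sup>+z. (1 + ennreal ((norm (f z))\<^sup>2)) * indicator K z \<partial>lborel)"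
    proof (intro nn_integral_mono mult_right_mono)
      fix z
      show "ennreal (norm (f z)) \<le> 1 + ennreal ((norm (f z))\<^sup>2)"
        using ennreal_leI[OF abs_le_one_plus_square[of "norm (f z)"]] by simp
    qed simp
    \<comment> \<open>The detour through \<open>lebesgue_on halfspace\<close> is needed for
      additivity, as \<open>f\<close> need not be Borel.\<close>
    also have "\<dots> = (\<integral>\<^sup>+z. indicator K z + ennreal ((norm (f z))\<^sup>2) * indicator K z \<partial>lebesgue_on halfspace)"
      unfolding eqK by (simp add: distrib_right)
    also have "\<dots> = (\<integral>\<^sup>+z. 1 * indicator K z \<partial>lebesgue_on halfspace) + (\<integral>\<^sup>+z\<in>K. ennreal ((norm (f z))\<^sup>2) \<partial>lebesgue_on halfspace)"
      by (subst nn_integral_add) simp_all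
    also have "\<dots> = emeasure lborel K + (\<integral>\<^sup>+z\<in>K. ennreal ((norm (f z))\<^sup>2) \<partial>lborel)"
      unfolding eqK[symmetric] using K by (simp add: borel_compact)
    also have "\<dots> < \<infinity>"
    proof -
      have "(\<integral>\<^sup>+z\<in>K. ennreal ((norm (f z))\<^sup>2) \<partial>weighted_measure c \<phi>) \<le> (\<integral>\<^sup>+z. ennreal ((norm (f z))\<^sup>2) \<partial>weighted_measure c \<phi>)"
        by (intro nn_integral_mono) (auto simp: indicator_def)
      then have "(\<integral>\<^sup>+z\<in>K. ennreal ((norm (f z))\<^sup>2) \<partial>lborel) < \<infinity>"
        using f2 le by (auto intro!: le_less_trans[OF le] simp: ennreal_mult_less_top)
      then show ?thesis using emeasure_compact_finite[OF K(1)] by simp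
    qed
    finally show "(\<integral>\<^sup>+z. ennreal (norm (f z)) \<partial>lebesgue_on K) < \<infinity>" .
  qed
  then show "f \<in> L2 c \<phi>" using f i2 by (auto simp: L2_def L1_loc_def)
qed

text \<open>Membership in \<open>L2\<close> matters here: for a non-integrable square the Bochner
  integral in \<open>L2_norm_on\<close> would take its default value 0.\<close>

lemma L2_norm_on_square:
  fixes f :: "'n::finite point \<Rightarrow> 'b::euclidean_space"
  assumes f: "f \<in> L2 c \<phi>" and A: "A \<in> sets (lebesgue_on halfspace)"
  shows "(\<integral>\<^sup>+z\<in>A. ennreal ((norm (f z))\<^sup>2) \<partial>weighted_measure c \<phi>) = ennreal ((L2_norm_on c \<phi> A f)\<^sup>2)"
proof -
  have "integrable (weighted_measure c \<phi>) (\<lambda>z. (norm (f z))\<^sup>2)" using f by (simp add: L2_def)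
  then have "integrable (weighted_measure c \<phi>) (\<lambda>z. indicator A z *\<^sub>R (norm (f z))\<^sup>2)"
    using A by (intro integrable_mult_indicator) (auto simp: sets_weighted_measure)
  then have "(\<integral>\<^sup>+z. ennreal (indicator A z *\<^sub>R (norm (f z))\<^sup>2) \<partial>weighted_measure c \<phi>)
      = ennreal (LINT z:A|weighted_measure c \<phi>. (norm (f z))\<^sup>2)"
    unfolding set_lebesgue_integral_def by (intro nn_integral_eq_integral) auto
  moreover have "0 \<le> (LINT z:A|weighted_measure c \<phi>. (norm (f z))\<^sup>2)"
    unfolding set_lebesgue_integral_def by (intro integral_nonneg_AE) auto
  moreover have "(\<integral>\<^sup>+z\<in>A. ennreal ((norm (f z))\<^sup>2) \<partial>weighted_measure c \<phi>) = (\<integral>\<^sup>+z. ennreal (indicator A z *\<^sub>R (norm (f z))\<^sup>2) \<partial>weighted_measure c \<phi>)"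
    by (intro nn_integral_cong) (auto simp: indicator_def)
  ultimately show ?thesis by (simp add: L2_norm_on_def)
qed

lemma L2_norm_square:
  fixes f :: "'n::finite point \<Rightarrow> 'b::euclidean_space"
  assumes f: "f \<in> L2 c \<phi>"
  shows "(\<integral>\<^sup>+z. ennreal ((norm (f z))\<^sup>2) \<partial>weighted_measure c \<phi>) = ennreal ((L2_norm c \<phi> f)\<^sup>2)"
  using L2_norm_on_square[OF f, of halfspace] by (simp add: nn_integral_weighted_halfspace)

lemma H1_norm_bounds:
  fixes u :: "'n::finite point \<Rightarrow> real"
  assumes u: "u \<in> H1 c \<phi>" and M: "H1_norm c \<phi> u \<le> M"
  shows "(\<integral>\<^sup>+z. ennreal ((u z)\<^sup>2) \<partial>weighted_measure c \<phi>) \<le> ennreal (M\<^sup>2)"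
    and "(\<integral>\<^sup>+z. ennreal ((norm (weak_gradient u z))\<^sup>2) \<partial>weighted_measure c \<phi>) \<le> ennreal (M\<^sup>2)"
proof -
  have u2: "u \<in> L2 c \<phi>" "weak_gradient u \<in> L2 c \<phi>" using u by (auto simp: H1_def)
  have "(L2_norm c \<phi> u)\<^sup>2 + (L2_norm c \<phi> (weak_gradient u))\<^sup>2 \<le> M\<^sup>2"
    using M by (simp add: H1_norm_def sqrt_le_D)
  then have "(L2_norm c \<phi> u)\<^sup>2 \<le> M\<^sup>2" "(L2_norm c \<phi> (weak_gradient u))\<^sup>2 \<le> M\<^sup>2"
    by (smt (verit) zero_le_power2)+
  then show "(\<integral>\<^sup>+z. ennreal ((u z)\<^sup>2) \<partial>weighted_measure c \<phi>) \<le> ennreal (M\<^sup>2)"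
    and "(\<integral>\<^sup>+z. ennreal ((norm (weak_gradient u z))\<^sup>2) \<partial>weighted_measure c \<phi>) \<le> ennreal (M\<^sup>2)"
    using L2_norm_square[OF u2(1)] L2_norm_square[OF u2(2)] by (auto intro: ennreal_leI)
qed

text \<open>The representatives chosen for \<open>u\<close> and for its multiple are unrelated as
  functions; uniqueness identifies them almost everywhere, which settles both membership and norm.
  Dividing by a positive bound instead of the norm includes \<open>u = 0\<close>.\<close>

lemma scale_in_H1_unit_ball:
  fixes u :: "'n::finite point \<Rightarrow> real"
  assumes u: "u \<in> H1 c \<phi>" and M: "H1_norm c \<phi> u \<le> M" "M > 0"
  shows "(\<lambda>z. (1 / M) *\<^sub>R u z) \<in> H1_unit_ball c \<phi>"
proof -
  let ?v = "\<lambda>z. (1 / M) *\<^sub>R u z" and ?G = "\<lambda>z. (1 / M) *\<^sub>R weak_gradient u z"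
  have u2: "u \<in> L2 c \<phi>" "weak_gradient u \<in> L2 c \<phi>" using u by (auto simp: H1_def)
  have sc: "(\<lambda>z. (1 / M) *\<^sub>R f z) \<in> L2 c \<phi>" if "f \<in> L2 c \<phi>" for f :: "'n point \<Rightarrow> 'b::euclidean_space"
    using that L1_loc_scaleR[of f "1 / M"] by (auto simp: L2_def power_mult_distrib power_divide)
  have g: "has_weak_gradient ?v ?G"
    using has_weak_gradient_scale[OF has_weak_gradient_weak_gradient[OF u], of "1 / M"] by simp
  have g': "has_weak_gradient ?v (weak_gradient ?v)"
    using someI[of "has_weak_gradient ?v", OF g] by (simp only: weak_gradient_def[of ?v])
  have ae: "AE z in weighted_measure c \<phi>. weak_gradient ?v z = ?G z"
    unfolding AE_weighted_measure_iff[OF adm] by (rule has_weak_gradient_unique[OF g' g])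
  have m: "weak_gradient ?v \<in> borel_measurable (lebesgue_on halfspace)"
    using g' by (auto simp: has_weak_gradient_def L1_loc_def)
  have nn: "(\<integral>\<^sup>+z. ennreal ((norm (weak_gradient ?v z))\<^sup>2) \<partial>weighted_measure c \<phi>)
     = (\<integral>\<^sup>+z. ennreal ((norm (?G z))\<^sup>2) \<partial>weighted_measure c \<phi>)"
    by (rule nn_integral_cong_AE) (use ae in eventually_elim, simp)
  have L2': "weak_gradient ?v \<in> L2 c \<phi>"
    using sc[OF u2(2)] m nn by (simp add: L2_iff)
  have "ennreal ((L2_norm c \<phi> (weak_gradient ?v))\<^sup>2) = ennreal ((L2_norm c \<phi> ?G)\<^sup>2)"
    using nn L2_norm_square[OF L2'] L2_norm_square[OF sc[OF u2(2)]] by simp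
  then have n2: "(L2_norm c \<phi> (weak_gradient ?v))\<^sup>2 = (1 / M)\<^sup>2 * (L2_norm c \<phi> (weak_gradient u))\<^sup>2"
    by (simp add: L2_norm_on_scaleR power_mult_distrib power_divide del: scaleR_scaleR)
  have n1: "(L2_norm c \<phi> ?v)\<^sup>2 = (1 / M)\<^sup>2 * (L2_norm c \<phi> u)\<^sup>2"
    by (simp only: L2_norm_on_scaleR power_mult_distrib power2_abs)
  have "(L2_norm c \<phi> u)\<^sup>2 + (L2_norm c \<phi> (weak_gradient u))\<^sup>2 \<le> M\<^sup>2"
    using M by (simp add: H1_norm_def sqrt_le_D)
  then have "(1 / M)\<^sup>2 * ((L2_norm c \<phi> u)\<^sup>2 + (L2_norm c \<phi> (weak_gradient u))\<^sup>2) \<le> (1 / M)\<^sup>2 * M\<^sup>2"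
    by (rule mult_left_mono) simp
  also have "\<dots> = 1" using M by (simp add: power_divide)
  finally have "H1_norm c \<phi> ?v \<le> 1"
    unfolding H1_norm_def n1 n2 by (simp add: distrib_left)
  moreover have "?v \<in> H1 c \<phi>"
    using sc[OF u2(1)] g' L2' by (auto simp: H1_def)
  ultimately show ?thesis by (simp add: H1_unit_ball_def)
qed

end

section \<open>Local compactness and tightness in the weighted spaces\<close>

lemma slab_sets [measurable]: "(slab n :: 'n::finite point set) \<in> sets (lebesgue_on halfspace)"
  using borel_compact[OF compact_slab[where 'a = 'n], of n] slab_subset[where 'a = 'n, of n]
  by (simp add: sets_restrict_space_iff)

lemma borel_subset_halfspace_sets:
  "A \<in> sets borel \<Longrightarrow> A \<subseteq> halfspace \<Longrightarrow> A \<in> sets (lebesgue_on (halfspace :: 'n::finite point set))"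
  by (auto simp: sets_restrict_space_iff)

lemma tail_sets: "{z \<in> halfspace. norm z > R} \<in> sets (lebesgue_on (halfspace :: 'n::finite point set))"
proof (rule borel_subset_halfspace_sets)
  show "{z \<in> halfspace. norm z > R} \<in> sets (borel :: 'n point measure)" by measurable
qed auto

lemma strip_sets: "{z. 0 < fst z \<and> fst z < \<delta>} \<in> sets (lebesgue_on (halfspace :: 'n::finite point set))"
proof (rule borel_subset_halfspace_sets)
  have "open {z :: 'n point. 0 < fst z \<and> fst z < \<delta>}"
    by (intro open_Collect_conj open_Collect_less continuous_intros)
  then show "{z :: 'n point. 0 < fst z \<and> fst z < \<delta>} \<in> sets borel" by (rule borel_open)
qed (auto simp: halfspace_def)

section \<open>Truncations and ball averages in the weighted setting\<close>

lemma truncation_nn_integral: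
  assumes "truncation_of f L g"
  shows "(\<integral>\<^sup>+z. ennreal ((norm (g z))\<^sup>2) \<partial>lborel) = (\<integral>\<^sup>+z\<in>L. ennreal ((norm (f z))\<^sup>2) \<partial>lborel)"
proof (rule nn_integral_cong_AE)
  have ae: "AE z in lborel. z \<in> L \<longrightarrow> g z = f z" and 0: "\<And>z. z \<notin> L \<Longrightarrow> g z = 0"
    using assms by (auto simp: truncation_of_def)
  show "AE z in lborel. ennreal ((norm (g z))\<^sup>2) = ennreal ((norm (f z))\<^sup>2) * indicator L z"
    using ae by eventually_elim (auto simp: indicator_def 0)
qed

text \<open>Truncations depend on the slab, so the averages used to select a subsequence are
  expressed through \<open>u\<close> itself; otherwise a new subsequence would be needed for each
  slab.\<close>

lemma truncation_ball_integral:
  fixes u :: "'n::finite point \<Rightarrow> real"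
  assumes u: "u \<in> borel_measurable (lebesgue_on halfspace)" and g: "truncation_of u L g"
    and sub: "ball d r \<subseteq> L" "L \<subseteq> halfspace"
  shows "(LINT z:halfspace|lebesgue. indicator (ball d r) z * u z) = (LINT z|lborel. indicator (ball d r) z * g z)"
proof (rule set_integral_halfspace_eq)
  have gi: "integrable lborel g" and ae: "AE z in lborel. z \<in> L \<longrightarrow> g z = u z"
    using g by (auto simp: truncation_of_def)
  note [measurable] = borel_measurable_integrable[OF gi]
  show "(\<lambda>z. indicator (ball d r) z * u z) \<in> borel_measurable (lebesgue_on halfspace)"
    by (intro borel_measurable_times u borel_imp_lebesgue_on borel_measurable_indicator) simp
  show "(\<lambda>z. indicator (ball d r) z * g z) \<in> borel_measurable borel" by measurable
  show "AE z in lborel. indicator halfspace z * (indicator (ball d r) z * u z) = indicator (ball d r) z * g z"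
    using ae
  proof eventually_elim
    case (elim z)
    show ?case
    proof (cases "z \<in> ball d r")
      case True
      then have "z \<in> L" "z \<in> halfspace" using sub by blast+
      then show ?thesis using elim by simp
    qed simp
  qed
qed

context
  fixes c :: real and \<phi> :: "real \<Rightarrow> real"
  assumes adm: "admissible \<phi>"
begin

lemma ball_integral_bounded:
  fixes u :: "nat \<Rightarrow> 'n::finite point \<Rightarrow> real"
  assumes u: "\<And>k. u k \<in> H1 c \<phi>" "\<And>k. H1_norm c \<phi> (u k) \<le> M" and sub: "ball d r \<subseteq> slab n"
  shows "\<exists>B. \<forall>k. \<bar>LINT z:halfspace|lebesgue. indicator (ball d r) z * u k z\<bar> \<le> B"
proof -
  obtain m where m: "0 < m" "\<forall>f\<in>borel_measurable (lebesgue_on (halfspace :: 'n point set)). (\<integral>\<^sup>+z\<in>slab n. f z \<partial>lborel) \<le> ennreal m * (\<integral>\<^sup>+z\<in>slab n. f z \<partial>weighted_measure c \<phi>)"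
    by (rule weighted_measure_comparable_on_compact[OF adm compact_slab slab_subset, of n c]) (rule that[rotated])
  define \<beta> where "\<beta> = measure lborel (ball d r)"
  have "\<bar>LINT z:halfspace|lebesgue. indicator (ball d r) z * u k z\<bar> \<le> sqrt (\<beta> * (m * M\<^sup>2))" for k
  proof -
    have um [measurable]: "u k \<in> borel_measurable (lebesgue_on halfspace)" and uL: "u k \<in> L1_loc"
      using u(1)[of k] by (auto simp: H1_def L2_def L1_loc_def)
    obtain g where g: "truncation_of (u k) (slab n) g"
      using truncation_exists[OF uL compact_slab slab_subset] .
    then have [measurable]: "g \<in> borel_measurable borel"
      by (auto simp: truncation_of_def dest: borel_measurable_integrable)
    have "(\<integral>\<^sup>+z\<in>ball d r. ennreal ((g z)\<^sup>2) \<partial>lborel) \<le> (\<integral>\<^sup>+z. ennreal ((norm (g z))\<^sup>2) \<partial>lborel)"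
      by (intro nn_integral_mono) (auto simp: indicator_def)
    also have "\<dots> = (\<integral>\<^sup>+z\<in>slab n. ennreal ((norm (u k z))\<^sup>2) \<partial>lborel)"
      by (rule truncation_nn_integral[OF g])
    also have "\<dots> \<le> ennreal m * (\<integral>\<^sup>+z\<in>slab n. ennreal ((norm (u k z))\<^sup>2) \<partial>weighted_measure c \<phi>)"
      by (rule m(2)[rule_format]) measurable
    also have "\<dots> \<le> ennreal m * (\<integral>\<^sup>+z. ennreal ((u k z)\<^sup>2) \<partial>weighted_measure c \<phi>)"
      by (intro mult_left_mono nn_integral_mono) (auto simp: indicator_def)
    also have "\<dots> \<le> ennreal m * ennreal (M\<^sup>2)"
      by (intro mult_left_mono H1_norm_bounds[OF adm u]) simp
    finally have "ennreal \<beta> * (\<integral>\<^sup>+z\<in>ball d r. ennreal ((g z)\<^sup>2) \<partial>lborel) \<le> ennreal \<beta> * (ennreal m * ennreal (M\<^sup>2))"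
      by (rule mult_left_mono) simp
    moreover have "ennreal ((LINT z|lborel. indicator (ball d r) z * g z)\<^sup>2) \<le> ennreal \<beta> * (\<integral>\<^sup>+z\<in>ball d r. ennreal ((g z)\<^sup>2) \<partial>lborel)"
      unfolding \<beta>_def using emeasure_lborel_ball_finite[of d r] by (intro Cauchy_Schwarz_indicator) auto
    ultimately have "ennreal ((LINT z|lborel. indicator (ball d r) z * g z)\<^sup>2) \<le> ennreal \<beta> * (ennreal m * ennreal (M\<^sup>2))"
      by (rule order_trans[rotated])
    also have "\<dots> = ennreal (\<beta> * (m * M\<^sup>2))"
      using m(1) by (simp add: \<beta>_def ennreal_mult)
    finally have "(LINT z|lborel. indicator (ball d r) z * g z)\<^sup>2 \<le> \<beta> * (m * M\<^sup>2)"
      using m(1) by (simp add: \<beta>_def)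
    then show ?thesis
      unfolding truncation_ball_integral[OF um g sub slab_subset] by (simp add: real_le_rsqrt)
  qed
  then show ?thesis by blast
qed

text \<open>Three nested slabs supply the margins for \<open>local_Cauchy_L2\<close>: the estimate
  holds on slab n, the shifts start in the open slab n+1, and all data live on slab n+2. On these
  the weight costs only constant factors.\<close>

lemma slab_Cauchy:
  fixes u :: "nat \<Rightarrow> 'n::finite point \<Rightarrow> real"
  assumes u: "\<And>k. u k \<in> H1 c \<phi>" "\<And>k. H1_norm c \<phi> (u k) \<le> M" and dense: "closure D = UNIV"
    and conv: "\<And>d m n. d \<in> D \<Longrightarrow> ball d (inverse (real (Suc m))) \<subseteq> slab n \<Longrightarrow>
       convergent (\<lambda>k. LINT z:halfspace|lebesgue. indicator (ball d (inverse (real (Suc m)))) z * u k z)"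
    and "e > 0"
  shows "\<exists>N. \<forall>i\<ge>N. \<forall>j\<ge>N. (\<integral>\<^sup>+z\<in>slab n. ennreal ((u i z - u j z)\<^sup>2) \<partial>weighted_measure c \<phi>) \<le> ennreal e"
proof -
  define L where "L = (slab (Suc (Suc n)) :: 'n point set)"
  have L: "compact L" "L \<subseteq> halfspace" by (simp_all add: L_def compact_slab slab_subset)
  obtain m where m: "0 < m" "\<forall>f\<in>borel_measurable (lebesgue_on halfspace). (\<integral>\<^sup>+z\<in>L. f z \<partial>lborel) \<le> ennreal m * (\<integral>\<^sup>+z\<in>L. f z \<partial>weighted_measure c \<phi>)"
    by (rule weighted_measure_comparable_on_compact[OF adm L, of c]) (rule that[rotated])
  obtain M' where M': "0 < M'" "\<forall>f\<in>borel_measurable (lebesgue_on (halfspace :: 'n point set)). (\<integral>\<^sup>+z\<in>slab n. f z \<partial>weighted_measure c \<phi>) \<le> ennreal M' * (\<integral>\<^sup>+z\<in>slab n. f z \<partial>lborel)"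
    by (rule weighted_measure_comparable_on_compact[OF adm compact_slab slab_subset, of n c]) (rule that[rotated])
  have wg: "has_weak_gradient (u k) (weak_gradient (u k))" for k
    by (rule has_weak_gradient_weak_gradient[OF u(1)])
  then have L1: "u k \<in> L1_loc" "weak_gradient (u k) \<in> L1_loc" for k
    by (auto simp: has_weak_gradient_def)
  have um [measurable]: "u k \<in> borel_measurable (lebesgue_on halfspace)" "weak_gradient (u k) \<in> borel_measurable (lebesgue_on halfspace)" for k
    using L1[of k] by (auto simp: L1_loc_def)
  have "\<forall>k. \<exists>g. truncation_of (u k) L g"
    using truncation_exists[OF L1(1) L] by blast
  then obtain U where U: "\<And>k. truncation_of (u k) L (U k)" by metis
  have "\<forall>k. \<exists>g. truncation_of (weak_gradient (u k)) L g"
    using truncation_exists[OF L1(2) L] by blast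
  then obtain G where G: "\<And>k. truncation_of (weak_gradient (u k)) L (G k)" by metis
  \<comment> \<open>The gap between the lower cutoffs of slabs n+1 and n+2. It is at most 1, the gap
    between their radii, so it serves as the margin in both respects.\<close>
  define \<rho> where "\<rho> = inverse (real (Suc (Suc n))) - inverse (real (Suc (Suc (Suc n))))"
  have "inverse (real (Suc (Suc (Suc n)))) < inverse (real (Suc (Suc n)))" "inverse (real (Suc (Suc n))) \<le> 1"
    "0 \<le> inverse (real (Suc (Suc (Suc n))))"
    by (simp_all add: divide_simps)
  then have \<rho>: "\<rho> > 0" "\<rho> \<le> 1" unfolding \<rho>_def by linarith+
  have "\<exists>N. \<forall>i\<ge>N. \<forall>j\<ge>N. (\<integral>\<^sup>+z\<in>slab n. ennreal ((U i z - U j z)\<^sup>2) \<partial>lborel) \<le> ennreal (e / M')"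
  proof (rule local_Cauchy_L2)
    show "weak_gradient_pair (U k) (G k) L" for k
      by (rule weak_gradient_pair_truncation[OF wg L(2) U G])
    show "(\<integral>\<^sup>+z. ennreal ((norm (G k z))\<^sup>2) \<partial>lborel) \<le> ennreal (m * M\<^sup>2)" for k
    proof -
      have "(\<integral>\<^sup>+z. ennreal ((norm (G k z))\<^sup>2) \<partial>lborel) = (\<integral>\<^sup>+z\<in>L. ennreal ((norm (weak_gradient (u k) z))\<^sup>2) \<partial>lborel)"
        by (rule truncation_nn_integral[OF G])
      also have "\<dots> \<le> ennreal m * (\<integral>\<^sup>+z\<in>L. ennreal ((norm (weak_gradient (u k) z))\<^sup>2) \<partial>weighted_measure c \<phi>)"
        by (rule m(2)[rule_format]) measurable
      also have "\<dots> \<le> ennreal m * (\<integral>\<^sup>+z. ennreal ((norm (weak_gradient (u k) z))\<^sup>2) \<partial>weighted_measure c \<phi>)"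
        by (intro mult_left_mono nn_integral_mono) (auto simp: indicator_def)
      also have "\<dots> \<le> ennreal m * ennreal (M\<^sup>2)"
        by (intro mult_left_mono H1_norm_bounds[OF adm u]) simp
      also have "\<dots> = ennreal (m * M\<^sup>2)" using m(1) by (simp add: ennreal_mult)
      finally show ?thesis .
    qed
    show "compact (slab n :: 'n point set)" by (rule compact_slab)
    show "slab n \<subseteq> (open_slab (Suc n) :: 'n point set)"
    proof
      fix z :: "'n point" assume "z \<in> slab n"
      moreover have "inverse (real (Suc (Suc n))) < inverse (real (Suc n))" by (simp add: field_simps)
      moreover have "real n < real (Suc n)" by simp
      ultimately show "z \<in> open_slab (Suc n)" unfolding slab_def open_slab_def mem_Collect_eq by linarith
    qed
    show "open (open_slab (Suc n) :: 'n point set)" by (rule open_slab)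
    show "\<rho> > 0" by fact
    show "ball z \<rho> \<subseteq> L" if z: "z \<in> open_slab (Suc n)" for z :: "'n point"
    proof
      fix w assume "w \<in> ball z \<rho>"
      then have d: "norm (w - z) < \<rho>" by (simp add: dist_norm norm_minus_commute)
      have "\<bar>fst w - fst z\<bar> \<le> norm (w - z)" using norm_fst_le[of "fst (w - z)" "snd (w - z)"]
        by (simp only: prod.collapse) simp
      then have "inverse (real (Suc (Suc (Suc n)))) \<le> fst w"
        using d z by (auto simp: open_slab_def \<rho>_def simp del: of_nat_Suc)
      moreover have "norm w \<le> real (Suc (Suc n))"
        using norm_triangle_ineq[of z "w - z"] d z \<rho>(2) by (auto simp: open_slab_def)
      ultimately show "w \<in> L" by (simp add: L_def slab_def)
    qed
    show "closure D = UNIV" by fact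
    fix d j assume "d \<in> D" and s: "ball d (inverse (real (Suc j))) \<subseteq> L"
    then show "convergent (\<lambda>k. LINT w|lborel. indicator (ball d (inverse (real (Suc j)))) w * U k w)"
      using conv[of d j "Suc (Suc n)"] unfolding truncation_ball_integral[OF um(1) U s L(2)] by (simp add: L_def)
  qed (use \<open>e > 0\<close> M'(1) in auto)
  then obtain N where N: "\<And>i j. i \<ge> N \<Longrightarrow> j \<ge> N \<Longrightarrow> (\<integral>\<^sup>+z\<in>slab n. ennreal ((U i z - U j z)\<^sup>2) \<partial>lborel) \<le> ennreal (e / M')"
    by blast
  have "(\<integral>\<^sup>+z\<in>slab n. ennreal ((u i z - u j z)\<^sup>2) \<partial>weighted_measure c \<phi>) \<le> ennreal e" if ij: "i \<ge> N" "j \<ge> N" for i j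
  proof -
    have "(\<integral>\<^sup>+z\<in>slab n. ennreal ((u i z - u j z)\<^sup>2) \<partial>weighted_measure c \<phi>) \<le> ennreal M' * (\<integral>\<^sup>+z\<in>slab n. ennreal ((u i z - u j z)\<^sup>2) \<partial>lborel)"
      by (rule M'(2)[rule_format]) measurable
    also have "(\<integral>\<^sup>+z\<in>slab n. ennreal ((u i z - u j z)\<^sup>2) \<partial>lborel) = (\<integral>\<^sup>+z\<in>slab n. ennreal ((U i z - U j z)\<^sup>2) \<partial>lborel)"
    proof (rule nn_integral_cong_AE)
      have sL: "z \<in> L" if "z \<in> slab n" for z :: "'n point"
      proof -
        have "inverse (real (Suc (Suc (Suc n)))) \<le> inverse (real (Suc n))" "real n \<le> real (Suc (Suc n))"
          by (simp_all add: field_simps)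
        then show ?thesis using that unfolding slab_def L_def mem_Collect_eq by linarith
      qed
      have "AE z in lborel. z \<in> L \<longrightarrow> U i z = u i z" "AE z in lborel. z \<in> L \<longrightarrow> U j z = u j z"
        using U by (auto simp: truncation_of_def)
      then show "AE z in lborel. ennreal ((u i z - u j z)\<^sup>2) * indicator (slab n) z = ennreal ((U i z - U j z)\<^sup>2) * indicator (slab n) z"
        by eventually_elim (use sL in \<open>auto simp: indicator_def\<close>)
    qed
    also have "ennreal M' * \<dots> \<le> ennreal M' * ennreal (e / M')"
      by (intro mult_left_mono N ij) simp
    also have "\<dots> = ennreal e" using M'(1) by (simp add: ennreal_mult'[symmetric])
    finally show ?thesis .
  qed
  then show ?thesis by blast
qed

text \<open>Tightness concerns the unit ball; a function of norm at most \<open>M\<close> is scaled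
  into it, which accounts for the factor \<open>M\<close>.\<close>

lemma tight_nn_integral_le:
  fixes u :: "'n::finite point \<Rightarrow> real"
  assumes u: "u \<in> H1 c \<phi>" "H1_norm c \<phi> u \<le> M" and M: "M > 0" and A: "A \<in> sets (lebesgue_on halfspace)"
    and s: "(SUP v\<in>H1_unit_ball c \<phi>. ennreal (L2_norm_on c \<phi> A v)) < ennreal s"
  shows "(\<integral>\<^sup>+z\<in>A. ennreal ((u z)\<^sup>2) \<partial>weighted_measure c \<phi>) \<le> ennreal ((M * s)\<^sup>2)"
proof -
  let ?v = "\<lambda>z. (1 / M) *\<^sub>R u z"
  have "ennreal (L2_norm_on c \<phi> A ?v) \<le> (SUP v\<in>H1_unit_ball c \<phi>. ennreal (L2_norm_on c \<phi> A v))"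
    by (intro SUP_upper scale_in_H1_unit_ball[OF adm u M])
  then have "ennreal (L2_norm_on c \<phi> A ?v) < ennreal s" using s by (rule le_less_trans)
  then have "L2_norm_on c \<phi> A ?v < s"
    by (rule ennreal_less_iff[THEN iffD1, OF L2_norm_on_nonneg])
  then have "(1 / M) * L2_norm_on c \<phi> A u < s"
    unfolding L2_norm_on_scaleR using M by simp
  then have "L2_norm_on c \<phi> A u \<le> M * s" using M by (simp add: field_simps)
  then have "(L2_norm_on c \<phi> A u)\<^sup>2 \<le> (M * s)\<^sup>2" by (rule power_mono) (rule L2_norm_on_nonneg)
  moreover have "u \<in> L2 c \<phi>" using u by (simp add: H1_def)
  ultimately show ?thesis
    using L2_norm_on_square[OF adm _ A, of u c] by (simp add: ennreal_leI)
qed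

lemma tight_imp_uniformly_small_outside_slab:
  assumes tight: "globally_tight c \<phi> (H1_unit_ball c \<phi> :: ('n::finite point \<Rightarrow> real) set)"
    and "M > 0" "e > 0"
  obtains n where "\<forall>u :: 'n point \<Rightarrow> real. u \<in> H1 c \<phi> \<longrightarrow> H1_norm c \<phi> u \<le> M \<longrightarrow>
    (\<integral>\<^sup>+z\<in>halfspace - slab n. ennreal ((u z)\<^sup>2) \<partial>weighted_measure c \<phi>) \<le> ennreal e"
proof -
  \<comment> \<open>With this choice the strip and the tail each carry at most \<open>e / 2\<close>
    after scaling back by \<open>M\<close>.\<close>
  define s where "s = sqrt (e / 2) / M"
  have s: "s > 0" "(M * s)\<^sup>2 = e / 2" using \<open>M > 0\<close> \<open>e > 0\<close> by (auto simp: s_def)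
  let ?B = "H1_unit_ball c \<phi> :: ('n point \<Rightarrow> real) set"
  have "\<forall>\<^sub>F R in at_top. (SUP v\<in>?B. ennreal (L2_norm_on c \<phi> {z \<in> halfspace. norm z > R} v)) < ennreal s"
    using tight s(1) by (intro order_tendstoD(2)) (auto simp: globally_tight_def)
  then obtain R where R: "(SUP v\<in>?B. ennreal (L2_norm_on c \<phi> {z \<in> halfspace. norm z > R} v)) < ennreal s"
    by (auto dest: eventually_happens)
  have "\<forall>\<^sub>F \<delta> in at_right 0. (SUP v\<in>?B. ennreal (L2_norm_on c \<phi> {z. 0 < fst z \<and> fst z < \<delta>} v)) < ennreal s"
    using tight s(1) by (intro order_tendstoD(2)) (auto simp: globally_tight_def)
  then obtain \<delta> where \<delta>: "\<delta> > 0" "(SUP v\<in>?B. ennreal (L2_norm_on c \<phi> {z. 0 < fst z \<and> fst z < \<delta>} v)) < ennreal s"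
    using eventually_happens'[OF trivial_limit_at_right_real eventually_conj[OF eventually_at_right_less[of "0::real"]]] by blast
  have "\<forall>\<^sub>F n in sequentially. inverse (real (Suc n)) < \<delta>"
    using \<delta>(1) by (intro order_tendstoD[OF LIMSEQ_inverse_real_of_nat])
  moreover have "\<forall>\<^sub>F n in sequentially. R < real n"
    by (rule filterlim_at_top_dense[THEN iffD1, OF filterlim_real_sequentially, rule_format])
  ultimately have "\<forall>\<^sub>F n in sequentially. inverse (real (Suc n)) < \<delta> \<and> R < real n" by (rule eventually_conj)
  then obtain n where n: "inverse (real (Suc n)) < \<delta>" "R < real n" by (auto dest: eventually_happens)
  show ?thesis
  proof (rule that, intro allI impI)
    fix u :: "'n point \<Rightarrow> real" assume u: "u \<in> H1 c \<phi>" "H1_norm c \<phi> u \<le> M"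
    let ?T = "{z \<in> halfspace. norm z > R} :: 'n point set" and ?S = "{z. 0 < fst z \<and> fst z < \<delta>} :: 'n point set"
    note [measurable] = tail_sets[of R] strip_sets[of \<delta>]
    have [measurable]: "u \<in> borel_measurable (lebesgue_on halfspace)"
      using u(1) by (auto simp: H1_def L2_def L1_loc_def)
    have "halfspace - slab n \<subseteq> ?T \<union> ?S" using n by (auto simp: halfspace_def slab_def)
    then have "(\<integral>\<^sup>+z\<in>halfspace - slab n. ennreal ((u z)\<^sup>2) \<partial>weighted_measure c \<phi>)
       \<le> (\<integral>\<^sup>+z. ennreal ((u z)\<^sup>2) * indicator ?T z + ennreal ((u z)\<^sup>2) * indicator ?S z \<partial>weighted_measure c \<phi>)"
      by (intro nn_integral_mono) (auto simp: indicator_def)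
    also have "\<dots> = (\<integral>\<^sup>+z\<in>?T. ennreal ((u z)\<^sup>2) \<partial>weighted_measure c \<phi>) + (\<integral>\<^sup>+z\<in>?S. ennreal ((u z)\<^sup>2) \<partial>weighted_measure c \<phi>)"
      by (rule nn_integral_add) measurable
    also have "\<dots> \<le> ennreal ((M * s)\<^sup>2) + ennreal ((M * s)\<^sup>2)"
      by (intro add_mono tight_nn_integral_le[OF u \<open>M > 0\<close>] tail_sets strip_sets R \<delta>(2))
    also have "\<dots> = ennreal e" using s \<open>e > 0\<close> by (simp add: ennreal_plus[symmetric] del: ennreal_plus)
    finally show "(\<integral>\<^sup>+z\<in>halfspace - slab n. ennreal ((u z)\<^sup>2) \<partial>weighted_measure c \<phi>) \<le> ennreal e" .
  qed
qed

end

section \<open>Compactness versus tightness\<close>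

lemma measurable_L2 [measurable_dest]:
  "f \<in> L2 c \<phi> \<Longrightarrow> f \<in> borel_measurable (lebesgue_on halfspace)"
  by (auto simp: L2_def L1_loc_def)

context
  fixes c :: real and \<phi> :: "real \<Rightarrow> real"
  assumes adm: "admissible \<phi>"
begin

lemma Cauchy_subsequence_of_tight:
  fixes u :: "nat \<Rightarrow> 'n::finite point \<Rightarrow> real"
  assumes tight: "globally_tight c \<phi> (H1_unit_ball c \<phi> :: ('n point \<Rightarrow> real) set)"
    and u: "\<And>k. u k \<in> H1 c \<phi>" "\<And>k. H1_norm c \<phi> (u k) \<le> M" and "M > 0"
  obtains r where "strict_mono (r :: nat \<Rightarrow> nat)"
    "\<forall>e>0. \<exists>N. \<forall>i\<ge>N. \<forall>j\<ge>N. (\<integral>\<^sup>+z. ennreal ((u (r i) z - u (r j) z)\<^sup>2) \<partial>weighted_measure c \<phi>) \<le> ennreal e"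
proof -
  obtain D :: "'n point set" where D: "countable D" "D \<subseteq> UNIV" "UNIV \<subseteq> closure D"
    by (rule separable[of UNIV])
  then have clD: "closure D = UNIV" by blast
  define a where "a k p = (LINT z:halfspace|lebesgue. indicator (ball (fst p) (inverse (real (Suc (snd p))))) z * u k z)"
    for k :: nat and p :: "'n point \<times> nat"
  define S where "S = {p \<in> D \<times> (UNIV :: nat set). \<exists>n. ball (fst p) (inverse (real (Suc (snd p)))) \<subseteq> slab n}"
  have "countable S"
    by (rule countable_subset[of _ "D \<times> UNIV"]) (use D(1) in \<open>auto simp: S_def\<close>)
  moreover have "\<exists>B. \<forall>k. \<bar>a k p\<bar> \<le> B" if p: "p \<in> S" for p
  proof -
    obtain n where "ball (fst p) (inverse (real (Suc (snd p)))) \<subseteq> slab n" using p by (auto simp: S_def)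
    then show ?thesis unfolding a_def by (rule ball_integral_bounded[where u = u and M = M, OF adm u])
  qed
  ultimately obtain r where r: "strict_mono r" and conv: "\<forall>p\<in>S. convergent (\<lambda>k. a (r k) p)"
    using convergent_subsequence_countable[of S a] by blast
  have slab: "\<exists>N. \<forall>i\<ge>N. \<forall>j\<ge>N. (\<integral>\<^sup>+z\<in>slab n. ennreal ((u (r i) z - u (r j) z)\<^sup>2) \<partial>weighted_measure c \<phi>) \<le> ennreal e"
    if "e > 0" for n e
  proof (rule slab_Cauchy[where u = "\<lambda>k. u (r k)" and M = M, OF adm u clD _ that])
    fix d :: "'n point" and m n
    assume "d \<in> D" "ball d (inverse (real (Suc m))) \<subseteq> slab n"
    then have "(d, m) \<in> S" by (auto simp: S_def)
    with conv show "convergent (\<lambda>k. LINT z:halfspace|lebesgue. indicator (ball d (inverse (real (Suc m)))) z * u (r k) z)"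
      by (auto simp: a_def)
  qed
  show ?thesis
  proof (rule that[OF r], intro allI impI)
    fix e :: real assume "e > 0"
    \<comment> \<open>Outside the slab the square of a difference is bounded by twice the squares of
      both functions, so \<open>e / 8\<close> for each adds up to \<open>e / 2\<close>.\<close>
    obtain n where "\<forall>u :: 'n point \<Rightarrow> real. u \<in> H1 c \<phi> \<longrightarrow> H1_norm c \<phi> u \<le> M \<longrightarrow>
       (\<integral>\<^sup>+z\<in>halfspace - slab n. ennreal ((u z)\<^sup>2) \<partial>weighted_measure c \<phi>) \<le> ennreal (e / 8)"
      by (rule tight_imp_uniformly_small_outside_slab[OF adm tight \<open>M > 0\<close>, of "e / 8"]) (use \<open>e > 0\<close> in simp)
    note n = this[rule_format, OF u]
    obtain N where N: "\<And>i j. i \<ge> N \<Longrightarrow> j \<ge> N \<Longrightarrow> (\<integral>\<^sup>+z\<in>slab n. ennreal ((u (r i) z - u (r j) z)\<^sup>2) \<partial>weighted_measure c \<phi>) \<le> ennreal (e / 2)"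
      using slab[of "e / 2" n] \<open>e > 0\<close> by auto
    have um [measurable]: "u k \<in> borel_measurable (lebesgue_on halfspace)" for k
      using u(1)[of k] by (auto simp: H1_def intro: measurable_L2)
    have "(\<integral>\<^sup>+z. ennreal ((u (r i) z - u (r j) z)\<^sup>2) \<partial>weighted_measure c \<phi>) \<le> ennreal e" if ij: "i \<ge> N" "j \<ge> N" for i j
    proof -
      let ?T = "halfspace - slab n :: 'n point set"
      have T [measurable]: "?T \<in> sets (lebesgue_on halfspace)"
        by (intro sets.Diff sets_lebesgue_on_refl slab_sets)
      have "(\<integral>\<^sup>+z. ennreal ((u (r i) z - u (r j) z)\<^sup>2) \<partial>weighted_measure c \<phi>)
         = (\<integral>\<^sup>+z. ennreal ((u (r i) z - u (r j) z)\<^sup>2) * indicator (slab n) z + ennreal ((u (r i) z + - u (r j) z)\<^sup>2) * indicator ?T z \<partial>weighted_measure c \<phi>)"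
        by (intro nn_integral_cong) (auto simp: indicator_def)
      also have "\<dots> = (\<integral>\<^sup>+z\<in>slab n. ennreal ((u (r i) z - u (r j) z)\<^sup>2) \<partial>weighted_measure c \<phi>) + (\<integral>\<^sup>+z\<in>?T. ennreal ((u (r i) z + - u (r j) z)\<^sup>2) \<partial>weighted_measure c \<phi>)"
        by (rule nn_integral_add) measurable
      also have "\<dots> \<le> ennreal (e / 2) + (2 * (\<integral>\<^sup>+z\<in>?T. ennreal ((u (r i) z)\<^sup>2) \<partial>weighted_measure c \<phi>) + 2 * (\<integral>\<^sup>+z\<in>?T. ennreal ((- u (r j) z)\<^sup>2) \<partial>weighted_measure c \<phi>))"
        using T um by (intro add_mono N ij nn_integral_square_add_le)
          (auto simp: measurable_weighted_measure_iff sets_weighted_measure)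
      also have "\<dots> \<le> ennreal (e / 2) + (2 * ennreal (e / 8) + 2 * ennreal (e / 8))"
        unfolding power2_minus by (intro add_mono mult_left_mono n order_refl) auto
      also have "\<dots> = ennreal e"
      proof -
        have "2 * ennreal (e / 8) = ennreal (e / 4)"
          using \<open>e > 0\<close> by (subst ennreal_numeral[symmetric], subst ennreal_mult'[symmetric]) simp_all
        then show ?thesis using \<open>e > 0\<close> by (simp add: ennreal_plus[symmetric] del: ennreal_plus)
      qed
      finally show ?thesis .
    qed
    then show "\<exists>N. \<forall>i\<ge>N. \<forall>j\<ge>N. (\<integral>\<^sup>+z. ennreal ((u (r i) z - u (r j) z)\<^sup>2) \<partial>weighted_measure c \<phi>) \<le> ennreal e" by blast
  qed
qed

lemma L2_diff:
  fixes f g :: "'n::finite point \<Rightarrow> real"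
  assumes f: "f \<in> L2 c \<phi>" and g: "g \<in> L2 c \<phi>"
  shows "(\<lambda>z. f z - g z) \<in> L2 c \<phi>"
proof -
  have fm [measurable]: "f \<in> borel_measurable (lebesgue_on halfspace)" "g \<in> borel_measurable (lebesgue_on halfspace)"
    using f g by (auto intro: measurable_L2)
  have [measurable]: "halfspace \<in> sets (lebesgue_on (halfspace :: 'n point set))" by (rule sets_lebesgue_on_refl)
  have "(\<integral>\<^sup>+z\<in>halfspace. ennreal ((f z + - g z)\<^sup>2) \<partial>weighted_measure c \<phi>) \<le>
     2 * (\<integral>\<^sup>+z\<in>halfspace. ennreal ((f z)\<^sup>2) \<partial>weighted_measure c \<phi>) + 2 * (\<integral>\<^sup>+z\<in>halfspace. ennreal ((- g z)\<^sup>2) \<partial>weighted_measure c \<phi>)"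
    by (rule nn_integral_square_add_le) measurable
  also have "\<dots> < \<infinity>"
    using f g unfolding nn_integral_weighted_halfspace by (auto simp: L2_iff[OF adm] ennreal_mult_less_top)
  finally show ?thesis
    unfolding nn_integral_weighted_halfspace by (simp add: L2_iff[OF adm])
qed

lemma tight_imp_compact_embedding:
  assumes tight: "globally_tight c \<phi> (H1_unit_ball c \<phi> :: ('n::finite point \<Rightarrow> real) set)"
  shows "compact_embedding TYPE('n) c \<phi>"
  unfolding compact_embedding_def
proof (intro allI impI, elim conjE exE)
  fix u :: "nat \<Rightarrow> 'n point \<Rightarrow> real" and M0
  assume u: "\<forall>k. u k \<in> H1 c \<phi>" "\<forall>k. H1_norm c \<phi> (u k) \<le> M0"
  have uH: "\<And>k. u k \<in> H1 c \<phi>" using u(1) by blast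
  \<comment> \<open>The maximum with 1 makes the bound positive, as the scaling into the unit ball
    requires.\<close>
  have uM: "\<And>k. H1_norm c \<phi> (u k) \<le> max M0 1" using u(2) by (auto simp: le_max_iff_disj)
  obtain r where r: "strict_mono (r :: nat \<Rightarrow> nat)" and Cauchy: "\<forall>e>0. \<exists>N. \<forall>i\<ge>N. \<forall>j\<ge>N. (\<integral>\<^sup>+z. ennreal ((u (r i) z - u (r j) z)\<^sup>2) \<partial>weighted_measure c \<phi>) \<le> ennreal e"
    by (rule Cauchy_subsequence_of_tight[where u = u, OF tight uH uM]) simp
  have u2: "u k \<in> L2 c \<phi>" for k using u(1) by (simp add: H1_def)
  have um: "u k \<in> borel_measurable (weighted_measure c \<phi>)" for k
    using measurable_L2[OF u2] by (simp add: measurable_weighted_measure_iff)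
  obtain v where vm: "v \<in> borel_measurable (weighted_measure c \<phi>)"
    and v: "\<forall>e>0. \<exists>N. \<forall>i\<ge>N. (\<integral>\<^sup>+z. ennreal ((u (r i) z - v z)\<^sup>2) \<partial>weighted_measure c \<phi>) \<le> ennreal e"
    by (rule L2_complete[of "\<lambda>i. u (r i)", OF um Cauchy[rule_format]])
  have vm' [measurable]: "v \<in> borel_measurable (lebesgue_on halfspace)"
    using vm by (simp add: measurable_weighted_measure_iff)
  \<comment> \<open>\<open>v\<close> is the difference of \<open>u (r N)\<close> and
    \<open>u (r N) - v\<close>, both square integrable.\<close>
  have v2: "v \<in> L2 c \<phi>"
  proof -
    obtain N where "(\<integral>\<^sup>+z. ennreal ((u (r N) z - v z)\<^sup>2) \<partial>weighted_measure c \<phi>) \<le> ennreal 1"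
      using v zero_less_one by blast
    then have "(\<lambda>z. u (r N) z - v z) \<in> L2 c \<phi>"
      using measurable_L2[OF u2[of "r N"]] by (auto simp: L2_iff[OF adm] intro: le_less_trans)
    from L2_diff[OF u2[of "r N"] this] show ?thesis by simp
  qed
  have "(\<lambda>k. L2_norm c \<phi> (\<lambda>z. u (r k) z - v z)) \<longlonglongrightarrow> 0"
  proof (rule LIMSEQ_I)
    fix e :: real assume "e > 0"
    obtain N where N: "\<And>i. i \<ge> N \<Longrightarrow> (\<integral>\<^sup>+z. ennreal ((u (r i) z - v z)\<^sup>2) \<partial>weighted_measure c \<phi>) \<le> ennreal ((e / 2)\<^sup>2)"
      using v[rule_format, of "(e / 2)\<^sup>2"] \<open>e > 0\<close> by auto
    have "norm (L2_norm c \<phi> (\<lambda>z. u (r i) z - v z) - 0) < e" if "i \<ge> N" for i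
    proof -
      have "ennreal ((L2_norm c \<phi> (\<lambda>z. u (r i) z - v z))\<^sup>2) \<le> ennreal ((e / 2)\<^sup>2)"
        using N[OF that] L2_norm_square[OF adm L2_diff[OF u2[of "r i"] v2]] by simp
      then have "(L2_norm c \<phi> (\<lambda>z. u (r i) z - v z))\<^sup>2 \<le> (e / 2)\<^sup>2" by simp
      then have "L2_norm c \<phi> (\<lambda>z. u (r i) z - v z) \<le> e / 2"
        by (rule power2_le_imp_le) (use \<open>e > 0\<close> in simp)
      then show ?thesis using \<open>e > 0\<close> by (simp add: L2_norm_on_nonneg)
    qed
    then show "\<exists>N. \<forall>i\<ge>N. norm (L2_norm c \<phi> (\<lambda>z. u (r i) z - v z) - 0) < e" by blast
  qed
  then show "\<exists>r v. strict_mono r \<and> v \<in> L2 c \<phi> \<and> (\<lambda>k. L2_norm c \<phi> (\<lambda>z. u (r k) z - v z)) \<longlonglongrightarrow> 0"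
    using r v2 by blast
qed

text \<open>Tails and boundary strips are treated together: all that dominated convergence asks of
  the sets \<open>A k\<close> is that each point eventually leaves them.\<close>

lemma compact_embedding_imp_uniformly_small:
  fixes A :: "nat \<Rightarrow> 'n::finite point set"
  assumes comp: "compact_embedding TYPE('n) c \<phi>"
    and A [measurable]: "\<And>k. A k \<in> sets (lebesgue_on halfspace)"
    and dec: "\<And>z. z \<in> halfspace \<Longrightarrow> \<forall>\<^sub>F k in sequentially. z \<notin> A k" and "e > 0"
  shows "\<exists>k. \<forall>u\<in>H1_unit_ball c \<phi>. L2_norm_on c \<phi> (A k) u \<le> e"
proof (rule ccontr)
  assume "\<not> ?thesis"
  then have "\<forall>k. \<exists>u. u \<in> H1_unit_ball c \<phi> \<and> e < L2_norm_on c \<phi> (A k) u" by (auto simp: not_le)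
  from choice[OF this] obtain u where u: "\<And>k. u k \<in> H1_unit_ball c \<phi>" "\<And>k. e < L2_norm_on c \<phi> (A k) (u k)"
    by blast
  have uH: "\<And>k. u k \<in> H1 c \<phi>" "\<And>k. H1_norm c \<phi> (u k) \<le> 1" using u(1) by (auto simp: H1_unit_ball_def)
  have u2: "u k \<in> L2 c \<phi>" for k using uH(1)[of k] by (simp add: H1_def)
  obtain r v where r: "strict_mono r" and v: "v \<in> L2 c \<phi>" and lim: "(\<lambda>k. L2_norm c \<phi> (\<lambda>z. u (r k) z - v z)) \<longlonglongrightarrow> 0"
    using comp[unfolded compact_embedding_def, rule_format, of u] uH by blast
  have [measurable]: "u k \<in> borel_measurable (lebesgue_on halfspace)" "v \<in> borel_measurable (lebesgue_on halfspace)" for k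
    using u2 v by (auto intro: measurable_L2)
  \<comment> \<open>From u = (u - v) + v on \<open>A (r k)\<close>. The first term on the right
    vanishes by convergence in norm and the second by dominated convergence, which contradicts
    \<open>e > 0\<close>.\<close>
  have est: "ennreal (e\<^sup>2) \<le> 2 * ennreal ((L2_norm c \<phi> (\<lambda>z. u (r k) z - v z))\<^sup>2) + 2 * (\<integral>\<^sup>+z\<in>A (r k). ennreal ((v z)\<^sup>2) \<partial>weighted_measure c \<phi>)" for k
  proof -
    have "e\<^sup>2 \<le> (L2_norm_on c \<phi> (A (r k)) (u (r k)))\<^sup>2"
      using u(2)[of "r k"] \<open>e > 0\<close> by (intro power_mono) auto
    then have "ennreal (e\<^sup>2) \<le> ennreal ((L2_norm_on c \<phi> (A (r k)) (u (r k)))\<^sup>2)" by (rule ennreal_leI)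
    also have "\<dots> = (\<integral>\<^sup>+z\<in>A (r k). ennreal (((u (r k) z - v z) + v z)\<^sup>2) \<partial>weighted_measure c \<phi>)"
      using L2_norm_on_square[OF adm u2 A, of "r k" "r k"] by simp
    also have "\<dots> \<le> 2 * (\<integral>\<^sup>+z\<in>A (r k). ennreal ((u (r k) z - v z)\<^sup>2) \<partial>weighted_measure c \<phi>) + 2 * (\<integral>\<^sup>+z\<in>A (r k). ennreal ((v z)\<^sup>2) \<partial>weighted_measure c \<phi>)"
      by (rule nn_integral_square_add_le) measurable
    also have "(\<integral>\<^sup>+z\<in>A (r k). ennreal ((u (r k) z - v z)\<^sup>2) \<partial>weighted_measure c \<phi>) \<le> (\<integral>\<^sup>+z. ennreal ((u (r k) z - v z)\<^sup>2) \<partial>weighted_measure c \<phi>)"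
      by (intro nn_integral_mono) (auto simp: indicator_def)
    also have "\<dots> = ennreal ((L2_norm c \<phi> (\<lambda>z. u (r k) z - v z))\<^sup>2)"
      using L2_norm_square[OF adm L2_diff[OF u2[of "r k"] v]] by simp
    finally show ?thesis by (simp add: add_mono mult_left_mono)
  qed
  have "(\<lambda>k. \<integral>\<^sup>+z\<in>A (r k). ennreal ((v z)\<^sup>2) \<partial>weighted_measure c \<phi>) \<longlonglongrightarrow> (\<integral>\<^sup>+z. 0 \<partial>(weighted_measure c \<phi> :: 'n point measure))"
  proof (rule nn_integral_dominated_convergence[where w = "\<lambda>z. ennreal ((v z)\<^sup>2)"])
    show "(\<integral>\<^sup>+z. ennreal ((v z)\<^sup>2) \<partial>weighted_measure c \<phi>) < \<infinity>" using v by (simp add: L2_iff[OF adm])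
    show "AE z in weighted_measure c \<phi>. (\<lambda>k. ennreal ((v z)\<^sup>2) * indicator (A (r k)) z) \<longlonglongrightarrow> 0"
    proof (rule AE_I2)
      fix z :: "'n point" assume "z \<in> space (weighted_measure c \<phi>)"
      then have "\<forall>\<^sub>F k in sequentially. z \<notin> A k" using dec by simp
      then have "\<forall>\<^sub>F k in sequentially. z \<notin> A (r k)"
        using eventually_subseq[OF r] by blast
      then show "(\<lambda>k. ennreal ((v z)\<^sup>2) * indicator (A (r k)) z) \<longlonglongrightarrow> 0"
        by (intro tendsto_eventually, elim eventually_mono) simp
    qed
    show "AE z in weighted_measure c \<phi>. ennreal ((v z)\<^sup>2) * indicator (A (r k)) z \<le> ennreal ((v z)\<^sup>2)" for k
      by (auto simp: indicator_def)
  qed measurable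
  then have "(\<lambda>k. 2 * ennreal ((L2_norm c \<phi> (\<lambda>z. u (r k) z - v z))\<^sup>2) + 2 * (\<integral>\<^sup>+z\<in>A (r k). ennreal ((v z)\<^sup>2) \<partial>weighted_measure c \<phi>))
     \<longlonglongrightarrow> 2 * ennreal (0\<^sup>2) + 2 * 0"
    by (intro tendsto_add ennreal_tendsto_cmult tendsto_ennrealI tendsto_power lim) auto
  then have "ennreal (e\<^sup>2) \<le> 2 * ennreal (0\<^sup>2) + 2 * 0"
    by (rule LIMSEQ_le_const) (use est in auto)
  then show False using \<open>e > 0\<close> by (simp add: ennreal_eq_0_iff)
qed

lemma L2_norm_on_mono:
  fixes u :: "'n::finite point \<Rightarrow> real"
  assumes u: "u \<in> L2 c \<phi>" and A: "A \<in> sets (lebesgue_on halfspace)" "B \<in> sets (lebesgue_on halfspace)" "A \<subseteq> B"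
  shows "L2_norm_on c \<phi> A u \<le> L2_norm_on c \<phi> B u"
proof -
  have "ennreal ((L2_norm_on c \<phi> A u)\<^sup>2) \<le> ennreal ((L2_norm_on c \<phi> B u)\<^sup>2)"
    unfolding L2_norm_on_square[OF adm u A(1), symmetric] L2_norm_on_square[OF adm u A(2), symmetric]
    using A(3) by (intro nn_integral_mono) (auto simp: indicator_def)
  then have "(L2_norm_on c \<phi> A u)\<^sup>2 \<le> (L2_norm_on c \<phi> B u)\<^sup>2" by simp
  then show ?thesis by (rule power2_le_imp_le) (rule L2_norm_on_nonneg)
qed

text \<open>Passes from a sequence of sets to a limit along a filter, so that R tending to infinity
  and \<delta> tending to 0 from the right are instances of one statement.\<close>

lemma SUP_L2_norm_on_tendsto_0:
  fixes A :: "'i \<Rightarrow> 'n::finite point set" and C :: "nat \<Rightarrow> 'n point set"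
  assumes comp: "compact_embedding TYPE('n) c \<phi>"
    and A: "\<And>i. A i \<in> sets (lebesgue_on halfspace)" and C: "\<And>k. C k \<in> sets (lebesgue_on halfspace)"
    and dec: "\<And>z. z \<in> halfspace \<Longrightarrow> \<forall>\<^sub>F k in sequentially. z \<notin> C k"
    and sub: "\<And>k. \<forall>\<^sub>F i in F. A i \<subseteq> C k"
  shows "((\<lambda>i. SUP u\<in>H1_unit_ball c \<phi>. ennreal (L2_norm_on c \<phi> (A i) u)) \<longlongrightarrow> 0) F"
proof (rule order_tendstoI)
  fix a :: ennreal assume "0 < a"
  \<comment> \<open>Here \<open>a\<close> may be infinite; a value strictly between 0 and
    \<open>a\<close> is finite and converts to a positive real.\<close>
  then obtain e' where e': "0 < e'" "e' < a" using dense by blast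
  define e where "e = enn2real e'"
  have e: "e > 0" "ennreal e < a"
    using e' order.strict_trans2[OF e'(2) top_greatest] by (auto simp: e_def enn2real_positive_iff)
  obtain k where k: "\<forall>u\<in>H1_unit_ball c \<phi>. L2_norm_on c \<phi> (C k) u \<le> e"
    using compact_embedding_imp_uniformly_small[OF comp C dec e(1)] by blast
  show "\<forall>\<^sub>F i in F. (SUP u\<in>H1_unit_ball c \<phi>. ennreal (L2_norm_on c \<phi> (A i) u)) < a"
    using sub[of k]
  proof eventually_elim
    case (elim i)
    have "(SUP u\<in>H1_unit_ball c \<phi>. ennreal (L2_norm_on c \<phi> (A i) u)) \<le> ennreal e"
    proof (rule SUP_least)
      fix u :: "'n point \<Rightarrow> real" assume u: "u \<in> H1_unit_ball c \<phi>"
      then have "u \<in> L2 c \<phi>" by (simp add: H1_unit_ball_def H1_def)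
      then have "L2_norm_on c \<phi> (A i) u \<le> L2_norm_on c \<phi> (C k) u"
        using elim by (intro L2_norm_on_mono A C)
      also have "\<dots> \<le> e" using k u by blast
      finally show "ennreal (L2_norm_on c \<phi> (A i) u) \<le> ennreal e" by (rule ennreal_leI)
    qed
    then show ?case using e(2) by (rule le_less_trans)
  qed
qed auto

lemma compact_embedding_imp_tight:
  assumes comp: "compact_embedding TYPE('n::finite) c \<phi>"
  shows "globally_tight c \<phi> (H1_unit_ball c \<phi> :: ('n point \<Rightarrow> real) set)"
  unfolding globally_tight_def
proof (intro conjI)
  show "H1_unit_ball c \<phi> \<subseteq> (L2 c \<phi> :: ('n point \<Rightarrow> real) set)"
    by (auto simp: H1_unit_ball_def H1_def)
  show "((\<lambda>R. SUP u\<in>(H1_unit_ball c \<phi> :: ('n point \<Rightarrow> real) set). ennreal (L2_norm_on c \<phi> {z \<in> halfspace. norm z > R} u)) \<longlongrightarrow> 0) at_top"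
  proof (rule SUP_L2_norm_on_tendsto_0[OF comp tail_sets])
    show "{z \<in> halfspace. norm z > real k} \<in> sets (lebesgue_on (halfspace :: 'n point set))" for k
      by (rule tail_sets)
    show "\<forall>\<^sub>F k in sequentially. z \<notin> {z \<in> halfspace. norm z > real k}" for z :: "'n point"
    proof -
      have "\<forall>\<^sub>F k in sequentially. norm z < real k"
        by (rule filterlim_at_top_dense[THEN iffD1, OF filterlim_real_sequentially, rule_format])
      then show ?thesis by eventually_elim simp
    qed
    show "\<forall>\<^sub>F R in at_top. {z \<in> halfspace. norm z > R} \<subseteq> {z \<in> halfspace :: 'n point set. norm z > real k}" for k
      using eventually_ge_at_top[of "real k"] by eventually_elim auto
  qed
  show "((\<lambda>\<delta>. SUP u\<in>(H1_unit_ball c \<phi> :: ('n point \<Rightarrow> real) set). ennreal (L2_norm_on c \<phi> {z. 0 < fst z \<and> fst z < \<delta>} u)) \<longlongrightarrow> 0) (at_right 0)"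
  proof (rule SUP_L2_norm_on_tendsto_0[OF comp strip_sets])
    show "{z. 0 < fst z \<and> fst z < inverse (real (Suc k))} \<in> sets (lebesgue_on (halfspace :: 'n point set))" for k
      by (rule strip_sets)
    show "\<forall>\<^sub>F k in sequentially. z \<notin> {z. 0 < fst z \<and> fst z < inverse (real (Suc k))}" if "z \<in> halfspace" for z :: "'n point"
    proof -
      have "\<forall>\<^sub>F k in sequentially. inverse (real (Suc k)) < fst z"
        using that by (intro order_tendstoD[OF LIMSEQ_inverse_real_of_nat]) (auto simp: halfspace_def)
      then show ?thesis by eventually_elim simp
    qed
    show "\<forall>\<^sub>F \<delta> in at_right 0. {z. 0 < fst z \<and> fst z < \<delta>} \<subseteq> {z :: 'n point. 0 < fst z \<and> fst z < inverse (real (Suc k))}" for k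
      unfolding eventually_at_right_field by (rule exI[of _ "inverse (real (Suc k))"]) auto
  qed
qed

end

theorem theorem7p2:
  fixes c :: real and \<phi> :: "real \<Rightarrow> real"
  assumes "admissible \<phi>"
  shows "compact_embedding TYPE('n::finite) c \<phi> \<longleftrightarrow>
         globally_tight c \<phi> (H1_unit_ball c \<phi> :: ('n point \<Rightarrow> real) set)"
  using compact_embedding_imp_tight[OF assms] tight_imp_compact_embedding[OF assms] by blast

end
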